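(* Let $(K,\delta)$ be an ordered differentially closed field. Then there exists an infinite set $T$ such that $(K,\delta)$ is $\mathbb{Q}$-differentially order isomorphic to $(\mathcal{N}^{\mathbb{R}}_{\varOmega},\delta_g)$ for some $c$-filter $\varOmega$ in $\mathbb{R}^T$ and some family $g=(g_t\in\mathcal{N}^{\mathbb{R}}_{\varOmega}:t\in T)$, where $\delta_g(f)=\sum_{t\in T}g_t\frac{\partial f}{\partial\Lambda_t}$ for $f\in\mathcal{N}^{\mathbb{R}}_{\varOmega}$.
   Context: **Ordered differentially closed fields.** For a field $R$ of characteristic zero with a derivation $\delta$, $R\{y\}=R[y_{\delta^0},y_\delta,y_{\delta^2},\ldots]$; $\operatorname{ord}p$ is the largest $n$ with $y_{\delta^n}$ occurring in $p$ ($-1$ if $p\in R$); $p^*\in R[x_0,\ldots,x_n]$ is the polynomial with $p=p^*(y_{\delta^0},\ldots,y_{\delta^n})$, so $p(a)=p^*(a,\delta(a),\ldots,\delta^n(a))$. A field $R$ with an ordering $\succ$ and a derivation $\delta$ is an ordered (ordinary) differentially closed field if $R$ is real closed and for any $p,q_1,\ldots,q_m\in R\{y\}$ with $n=\operatorname{ord}p\ge\operatorname{ord}q_i$, $1\le i\le m$, and any $a_0,\ldots,a_n\in R$ such that $p^*(a_0,\ldots,a_n)=0$, $\frac{\partial p^*}{\partial x_n}(a_0,\ldots,a_n)\ne0$ and $q_i^*(a_0,\ldots,a_n)\succ0$ for $1\le i\le m$, there exists $a\in R$ with $p(a)=0$ and $q_i(a)\succ0$ for $1\le i\le m$. **Nash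 functions.** $\Lambda_T=(\Lambda_t:t\in T)$ is a system of independent variables; $\mathbb{R}^T$ has the product topology. A subset of $\mathbb{R}^T$ is $\mathbb{Q}$-algebraic if it is defined by a finite system of equations $P=0$, $P\in\mathbb{Q}[\Lambda_T]$, and $\mathbb{Q}$-semialgebraic if it is defined by a finite boolean combination of inequalities $P>0$ or $P\ge0$, $P\in\mathbb{Q}[\Lambda_T]$. A $c$-filter in $\mathbb{R}^T$ is a family $\varOmega$ of subsets of $\mathbb{R}^T$ such that: (i) any $U\in\varOmega$ is a nonempty open connected $\mathbb{Q}$-semialgebraic set; (ii) for any $\mathbb{Q}$-algebraic $V\subsetneq\mathbb{R}^T$ there is $U\in\varOmega$ with $V\cap U=\emptyset$; (iii) for any $U_1,U_2\in\varOmega$ there is $U_3\in\varOmega$ with $U_3\subset U_1\cap U_2$; (iv) for any $U\in\varOmega$ there exist an open connected and simply connected $\mathbb{Q}$-semialgebraic set $U_0\subset\mathbb{R}^T$ and $U'\in\varOmega$ with $U'\subset U_0\subset U$. $\mathcal{N}^{\mathbb{R}}(U)$ is the ring of real analytic functions $f:U\to\mathbb{R}$ for which there is a nonzero $P\in\mathbb{Q}[\Lambda_T,Z]$ with $P(\lambda,f(\lambda))=0$ on $U$ (such functions depend on finitely many variables). $\mathcal{N}^{\mathbb{R}}_{\varOmega}$ is the field of classes of elements of $\bigcup_{U\in\varOmega}\mathcal{N}^{\mathbb{R}}(U)$, two functions being identified if they agree on some $U_3\in\varOmega$. It is ordered by $f\succ_\varOmega g$ iff there is $U\in\varOmega$ with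 $f(x)>g(x)$ for all $x\in U$. The isomorphism in the claim is a field isomorphism commuting with the derivations and preserving the orderings. *)

theory Defs
  imports
    "HOL-Analysis.Analysis"
    "HOL-Computational_Algebra.Polynomial"
    "HOL-Library.Poly_Mapping"
    "HOL-Algebra.QuotRing"
    "HOL-Algebra.Algebraic_Closure_Type"
begin

section \<open>Multivariate polynomials\<close>

text \<open>Polynomials over \<open>'a\<close> in variables from \<open>'v\<close>: finitely supported maps from
  monomials (finitely supported exponent vectors) to coefficients.\<close>

type_synonym ('v, 'a) mpoly = "('v \<Rightarrow>\<^sub>0 nat) \<Rightarrow>\<^sub>0 'a"

definition mpoly_vars :: "('v, 'a::zero) mpoly \<Rightarrow> 'v set" where
  "mpoly_vars p = (\<Union>m \<in> Poly_Mapping.keys p. Poly_Mapping.keys m)"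

text \<open>The first argument maps coefficients into the ring in which \<open>p\<close> is evaluated.\<close>

definition mpoly_eval :: "('a::zero \<Rightarrow> 'b::comm_semiring_1) \<Rightarrow> ('v \<Rightarrow> 'b) \<Rightarrow> ('v, 'a) mpoly \<Rightarrow> 'b" where
  "mpoly_eval c x p = (\<Sum>m \<in> Poly_Mapping.keys p. c (Poly_Mapping.lookup p m) *
     (\<Prod>v \<in> Poly_Mapping.keys m. x v ^ Poly_Mapping.lookup m v))"

definition mpoly_pderiv :: "'v \<Rightarrow> ('v, 'a::comm_semiring_1) mpoly \<Rightarrow> ('v, 'a) mpoly" where
  "mpoly_pderiv v p = (\<Sum>m \<in> Poly_Mapping.keys p.
     Poly_Mapping.single (m - Poly_Mapping.single v 1)
       (of_nat (Poly_Mapping.lookup m v) * Poly_Mapping.lookup p m))"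


section \<open>Ordered differentially closed fields\<close>

definition real_closed :: "'a::linordered_field itself \<Rightarrow> bool" where
  "real_closed _ \<longleftrightarrow>
     (\<forall>a::'a. 0 \<le> a \<longrightarrow> (\<exists>b. b ^ 2 = a)) \<and>
     (\<forall>p::'a poly. odd (Polynomial.degree p) \<longrightarrow> (\<exists>x. Polynomial.poly p x = 0))"

definition derivation :: "('a::comm_ring_1 \<Rightarrow> 'a) \<Rightarrow> bool" where
  "derivation \<delta> \<longleftrightarrow>
     (\<forall>x y. \<delta> (x + y) = \<delta> x + \<delta> y) \<and> (\<forall>x y. \<delta> (x * y) = \<delta> x * y + x * \<delta> y)"

text \<open>A differential polynomial \<open>p\<close> is given by \<open>p\<^sup>*\<close>, the variable
  \<open>i\<close> standing for the \<open>i\<close>-th derivative of \<open>y\<close>.\<close>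

type_synonym 'a dpoly = "(nat, 'a) mpoly"

definition dpoly_ord :: "'a::zero dpoly \<Rightarrow> int" where
  "dpoly_ord p = (if mpoly_vars p = {} then - 1 else int (Max (mpoly_vars p)))"

definition dpoly_eval :: "('a::comm_semiring_1 \<Rightarrow> 'a) \<Rightarrow> 'a dpoly \<Rightarrow> 'a \<Rightarrow> 'a" where
  "dpoly_eval \<delta> p a = mpoly_eval id (\<lambda>i. (\<delta> ^^ i) a) p"

text \<open>The separant condition needs \<open>x\<^sub>n\<close>, hence \<open>ord p = n \<ge> 0\<close>. Of the sequence
  \<open>a\<close> only the entries up to \<open>n\<close> matter.\<close>

definition ordered_diff_closed :: "('a::linordered_field \<Rightarrow> 'a) \<Rightarrow> bool" where
  "ordered_diff_closed \<delta> \<longleftrightarrow> derivation \<delta> \<and> real_closed TYPE('a) \<and>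
     (\<forall>(p::'a dpoly) (Q::'a dpoly set) (n::nat) (a::nat \<Rightarrow> 'a).
        finite Q \<and> dpoly_ord p = int n \<and> (\<forall>q\<in>Q. dpoly_ord q \<le> int n) \<and>
        mpoly_eval id a p = 0 \<and> mpoly_eval id a (mpoly_pderiv n p) \<noteq> 0 \<and>
        (\<forall>q\<in>Q. mpoly_eval id a q > 0) \<longrightarrow>
        (\<exists>b. dpoly_eval \<delta> p b = 0 \<and> (\<forall>q\<in>Q. dpoly_eval \<delta> q b > 0)))"


section \<open>Semialgebraic sets and \<open>c\<close>-filters\<close>

text \<open>The space \<open>\<real>\<^sup>T\<close> is \<^term>\<open>powertop_real T\<close>, on the set of functions that are
  \<open>undefined\<close> off \<open>T\<close>. By the next lemma its topology is the one induced from the function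
  type \<open>'v \<Rightarrow> real\<close>, which is what \<^const>\<open>simply_connected\<close> refers to.\<close>

lemma powertop_real_eq_top_of_set:
  "powertop_real T = top_of_set (extensional T :: ('v \<Rightarrow> real) set)"
proof -
  have ts: "topspace (powertop_real T) = extensional T"
    by (simp add: PiE_UNIV_domain PiE_def)
  have 1: "continuous_map (powertop_real T) (top_of_set (extensional T :: ('v \<Rightarrow> real) set)) (\<lambda>x. x)"
  proof -
    have "continuous_map (powertop_real T) euclideanreal (\<lambda>x. x i)" for i
    proof (cases "i \<in> T")
      case True
      then show ?thesis by (rule continuous_map_product_projection)
    next
      case False
      have "continuous_map (powertop_real T) euclideanreal (\<lambda>x. undefined)" by simp
      then show ?thesis
        by (rule continuous_map_eq) (use ts False in \<open>auto simp: extensional_def\<close>)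
    qed
    then have "continuous_map (powertop_real T) (powertop_real UNIV) (\<lambda>x. x)"
      by (simp add: continuous_map_componentwise_UNIV)
    then show ?thesis
      by (auto simp: euclidean_product_topology continuous_map_in_subtopology PiE_def)
  qed
  have 2: "continuous_map (top_of_set (extensional T :: ('v \<Rightarrow> real) set)) (powertop_real T) (\<lambda>x. x)"
    by (auto simp: continuous_map_componentwise
        intro: continuous_on_product_coordinates continuous_on_subset)
  show ?thesis
  proof (rule topology_eq[THEN iffD2], intro allI iffI)
    fix S assume S: "openin (powertop_real T) S"
    have "S \<subseteq> extensional T" using openin_subset[OF S] ts by simp
    then have "{x \<in> extensional T. x \<in> S} = S" by auto
    then show "openin (top_of_set (extensional T :: ('v \<Rightarrow> real) set)) S"
      using openin_continuous_map_preimage[OF 2 S] by simp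
  next
    fix S assume S: "openin (top_of_set (extensional T :: ('v \<Rightarrow> real) set)) S"
    have "S \<subseteq> extensional T" using openin_subset[OF S] by simp
    then have "{x \<in> extensional T. x \<in> S} = S" by auto
    then show "openin (powertop_real T) S"
      using openin_continuous_map_preimage[OF 1 S] ts by simp
  qed
qed

definition Q_algebraic :: "'v set \<Rightarrow> ('v \<Rightarrow> real) set \<Rightarrow> bool" where
  "Q_algebraic T V \<longleftrightarrow> (\<exists>S :: ('v, rat) mpoly set.
     finite S \<and> (\<forall>P\<in>S. mpoly_vars P \<subseteq> T) \<and>
     V = {x \<in> topspace (powertop_real T). \<forall>P\<in>S. mpoly_eval of_rat x P = 0})"

inductive Q_semialgebraic :: "'v set \<Rightarrow> ('v \<Rightarrow> real) set \<Rightarrow> bool" for T :: "'v set" where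
  greater: "mpoly_vars P \<subseteq> T \<Longrightarrow>
    Q_semialgebraic T {x \<in> topspace (powertop_real T). mpoly_eval of_rat x P > 0}"
| greater_eq: "mpoly_vars P \<subseteq> T \<Longrightarrow>
    Q_semialgebraic T {x \<in> topspace (powertop_real T). mpoly_eval of_rat x P \<ge> 0}"
| compl: "Q_semialgebraic T A \<Longrightarrow> Q_semialgebraic T (topspace (powertop_real T) - A)"
| union: "Q_semialgebraic T A \<Longrightarrow> Q_semialgebraic T B \<Longrightarrow> Q_semialgebraic T (A \<union> B)"
| inter: "Q_semialgebraic T A \<Longrightarrow> Q_semialgebraic T B \<Longrightarrow> Q_semialgebraic T (A \<inter> B)"

definition c_filter :: "'v set \<Rightarrow> ('v \<Rightarrow> real) set set \<Rightarrow> bool" where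
  "c_filter T \<Omega> \<longleftrightarrow>
     (\<forall>U\<in>\<Omega>. U \<noteq> {} \<and> openin (powertop_real T) U \<and> connectedin (powertop_real T) U \<and>
        Q_semialgebraic T U) \<and>
     (\<forall>V. Q_algebraic T V \<and> V \<subset> topspace (powertop_real T) \<longrightarrow> (\<exists>U\<in>\<Omega>. V \<inter> U = {})) \<and>
     (\<forall>U\<^sub>1\<in>\<Omega>. \<forall>U\<^sub>2\<in>\<Omega>. \<exists>U\<^sub>3\<in>\<Omega>. U\<^sub>3 \<subseteq> U\<^sub>1 \<inter> U\<^sub>2) \<and>
     (\<forall>U\<in>\<Omega>. \<exists>U\<^sub>0. \<exists>U'\<in>\<Omega>. openin (powertop_real T) U\<^sub>0 \<and> connectedin (powertop_real T) U\<^sub>0 \<and>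
        simply_connected U\<^sub>0 \<and> Q_semialgebraic T U\<^sub>0 \<and> U' \<subseteq> U\<^sub>0 \<and> U\<^sub>0 \<subseteq> U)"


section \<open>Nash functions and their germs\<close>

text \<open>Locally, \<open>f\<close> is the sum of a power series in finitely many of the coordinates of
  \<open>x - a\<close>. As a Nash function depends on finitely many variables only, allowing power series
  in infinitely many variables would not give more Nash functions.\<close>

definition analytic_on_RT :: "'v set \<Rightarrow> ('v \<Rightarrow> real) set \<Rightarrow> (('v \<Rightarrow> real) \<Rightarrow> real) \<Rightarrow> bool" where
  "analytic_on_RT T U f \<longleftrightarrow> (\<forall>a\<in>U. \<exists>F W. \<exists>c :: ('v \<Rightarrow>\<^sub>0 nat) \<Rightarrow> real.
     finite F \<and> F \<subseteq> T \<and> openin (powertop_real T) W \<and> a \<in> W \<and> W \<subseteq> U \<and>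
     (\<forall>x\<in>W. ((\<lambda>m. c m * (\<Prod>t\<in>F. (x t - a t) ^ Poly_Mapping.lookup m t)) has_sum f x)
        {m. Poly_Mapping.keys m \<subseteq> F}))"

text \<open>In \<open>P(\<Lambda>, Z)\<close> the variable \<open>\<Lambda>\<^sub>t\<close> is \<open>Some t\<close>, and \<open>Z\<close> is \<open>None\<close>.\<close>

definition nash_functions :: "'v set \<Rightarrow> ('v \<Rightarrow> real) set \<Rightarrow> (('v \<Rightarrow> real) \<Rightarrow> real) set" where
  "nash_functions T U = {f \<in> extensional U. analytic_on_RT T U f \<and>
     (\<exists>P :: ('v option, rat) mpoly. P \<noteq> 0 \<and> mpoly_vars P \<subseteq> insert None (Some ` T) \<and>
        (\<forall>x\<in>U. mpoly_eval of_rat (case_option (f x) x) P = 0))}"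

type_synonym 'v germ = "(('v \<Rightarrow> real) set \<times> (('v \<Rightarrow> real) \<Rightarrow> real)) set"

text \<open>The class of \<open>f : U \<rightarrow> \<real>\<close>, where \<open>(U, f)\<close> itself need not be a member: in the ring
  operations below \<open>U\<close> need not lie in \<open>\<Omega>\<close>, and \<open>f\<close> is not cut off outside \<open>U\<close>.\<close>

definition nash_class ::
    "'v set \<Rightarrow> ('v \<Rightarrow> real) set set \<Rightarrow> ('v \<Rightarrow> real) set \<Rightarrow> (('v \<Rightarrow> real) \<Rightarrow> real) \<Rightarrow> 'v germ" where
  "nash_class T \<Omega> U f = {(W, h). W \<in> \<Omega> \<and> h \<in> nash_functions T W \<and>
     (\<exists>U\<^sub>3\<in>\<Omega>. U\<^sub>3 \<subseteq> U \<inter> W \<and> (\<forall>x\<in>U\<^sub>3. h x = f x))}"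

definition nash_field :: "'v set \<Rightarrow> ('v \<Rightarrow> real) set set \<Rightarrow> 'v germ ring" where
  "nash_field T \<Omega> = \<lparr>
     carrier = {nash_class T \<Omega> U f |U f. U \<in> \<Omega> \<and> f \<in> nash_functions T U},
     monoid.mult = (\<lambda>A B. \<Union>(U, f)\<in>A. \<Union>(V, g)\<in>B. nash_class T \<Omega> (U \<inter> V) (\<lambda>x. f x * g x)),
     one = nash_class T \<Omega> (topspace (powertop_real T)) (\<lambda>_. 1),
     ring.zero = nash_class T \<Omega> (topspace (powertop_real T)) (\<lambda>_. 0),
     add = (\<lambda>A B. \<Union>(U, f)\<in>A. \<Union>(V, g)\<in>B. nash_class T \<Omega> (U \<inter> V) (\<lambda>x. f x + g x)) \<rparr>"

definition nash_less :: "('v \<Rightarrow> real) set set \<Rightarrow> 'v germ \<Rightarrow> 'v germ \<Rightarrow> bool" where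
  "nash_less \<Omega> A B \<longleftrightarrow>
     (\<exists>(U, f)\<in>A. \<exists>(V, g)\<in>B. \<exists>W\<in>\<Omega>. W \<subseteq> U \<inter> V \<and> (\<forall>x\<in>W. f x < g x))"

definition nash_partial :: "'v set \<Rightarrow> ('v \<Rightarrow> real) set set \<Rightarrow> 'v \<Rightarrow> 'v germ \<Rightarrow> 'v germ" where
  "nash_partial T \<Omega> t A =
     (\<Union>(U, f)\<in>A. nash_class T \<Omega> U (\<lambda>x. deriv (\<lambda>s. f (x(t := s))) (x t)))"

text \<open>Only finitely many partial derivatives of a Nash function are nonzero; the sum over \<open>T\<close>
  is taken over these.\<close>

definition nash_deriv ::
    "'v set \<Rightarrow> ('v \<Rightarrow> real) set set \<Rightarrow> ('v \<Rightarrow> 'v germ) \<Rightarrow> 'v germ \<Rightarrow> 'v germ" where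
  "nash_deriv T \<Omega> g A =
     (\<Oplus>\<^bsub>nash_field T \<Omega>\<^esub> t \<in> {t \<in> T. nash_partial T \<Omega> t A \<noteq> \<zero>\<^bsub>nash_field T \<Omega>\<^esub>}.
        g t \<otimes>\<^bsub>nash_field T \<Omega>\<^esub> nash_partial T \<Omega> t A)"

end

(* The variables are elements of K itself: T is a transcendence base of K over Q, and the inclusion
   of T in K is a point tau of K^T that satisfies no rational polynomial equation. A differentially
   closed field contains solutions of z' = 1 and y_i' = z^i y_i, and the y_i are algebraically
   independent, like exponentials; hence T is infinite.

   The members of Omega are the contractible sets {x | P(x) > 0 for all P in S}, where S is a finite
   set of rational polynomials that are positive at tau. They exist below every such cell: add to S
   all derivatives with respect to one variable after the other. By Thom's lemma and the transfer
   principle the fibres become open intervals over a smaller cell that contains tau, with a continuous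
   selection of a point in each interval, so the cell retracts to the one over the remaining variables.
   The transfer principle between the real closed fields K and R is obtained from sign diagrams of
   finite families of polynomials (Cohen, Hoermander).

   An element a of K is a root of a polynomial over Q(T), picked out by the signs of the derivatives
   of that polynomial. Near tau the root of the same sign type over R is, by the implicit function
   theorem, a Nash function val a, and all polynomial relations and inequalities between elements of K
   persist for the functions val a. So a |-> val a is an ordered embedding. It is onto because a Nash
   function on a connected cell agrees everywhere with one of the finitely many root functions of its
   equation, and it respects the derivations by implicit differentiation: delta is determined by its
   values on T. *)

theory Submission
  imports Defs
begin

text \<open>\<open>K\<close> need not be archimedean, so it may have no ordered embedding into the
  reals; its elements can be compared with real functions only through signs of rational
  polynomials. Finitely many sign conditions at the generic point hold on a whole cell around it,
  and \<open>ev\<close> records exactly this. Every statement about \<open>K\<close> is therefore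
  reduced to finitely many sign conditions. A member of a c-filter must be connected and
  semialgebraic, with simply connected sets below it. Passing to connected components would raise
  the question whether components and projections are semialgebraic. Cells given by strict
  inequalities, refined until they are contractible, need only the elimination of one variable at a
  time. The definition of \<open>real_closed\<close> speaks of square roots and odd degrees only.
  The intermediate value property is drawn from it by Laplace's argument that polynomials acquire a
  root once a square root of -1 is adjoined. Coefficients stay in the ring of rational polynomials;
  pseudo-division avoids denominators.\<close>

hide_const (open) Polynomials.degree Polynomials.lead_coeff up_ring.coeff up_ring.monom Coset.order module.smult


section \<open>Polynomials over real closed fields\<close>

locale cring_hom =
  fixes h :: "'a::comm_ring_1 \<Rightarrow> 'b::comm_ring_1"
  assumes add: "h (x + y) = h x + h y" and mult: "h (x * y) = h x * h y" and one: "h 1 = 1"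
begin

lemma zero [simp]: "h 0 = 0"
  using add[of 0 0] by simp

lemma minus: "h (- x) = - h x"
  using add[of x "- x"] by (simp add: eq_neg_iff_add_eq_0 add.commute)

lemma diff: "h (x - y) = h x - h y"
  using add[of x "- y"] by (simp add: minus)

lemma power: "h (x ^ n) = h x ^ n"
  by (induction n) (simp_all add: one mult)

lemma of_nat: "h (of_nat n) = of_nat n"
  by (induction n) (simp_all add: one add)

lemma sum: "h (sum f A) = (\<Sum>x\<in>A. h (f x))"
  by (induction A rule: infinite_finite_induct) (simp_all add: add)

lemma prod: "h (prod f A) = (\<Prod>x\<in>A. h (f x))"
  by (induction A rule: infinite_finite_induct) (simp_all add: one mult)

lemma coeff_map [simp]: "coeff (map_poly h p) n = h (coeff p n)"
  by (simp add: coeff_map_poly)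

lemma map_poly_pCons: "map_poly h (pCons a p) = pCons (h a) (map_poly h p)"
  by (rule poly_eqI) (simp add: coeff_pCons split: nat.splits)

lemma map_poly_add: "map_poly h (p + q) = map_poly h p + map_poly h q"
  by (rule poly_eqI) (simp add: add)

lemma map_poly_smult: "map_poly h (smult a p) = smult (h a) (map_poly h p)"
  by (rule poly_eqI) (simp add: mult)

lemma map_poly_mult: "map_poly h (p * q) = map_poly h p * map_poly h q"
  by (rule poly_eqI) (simp add: mult coeff_mult sum)

lemma map_poly_hom: "cring_hom (map_poly h)"
  by unfold_locales (simp_all add: map_poly_add map_poly_mult one)

lemma poly_map_poly: "poly (map_poly h p) (h x) = h (poly p x)"
  by (induction p) (simp_all add: map_poly_pCons add mult)

lemma degree_map_le: "degree (map_poly h p) \<le> degree p"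
  by (rule degree_le) (simp add: coeff_eq_0)

end

lemma cring_hom_comp: "cring_hom f \<Longrightarrow> cring_hom g \<Longrightarrow> cring_hom (\<lambda>x. f (g x))"
  by (simp add: cring_hom_def)

lemma cring_hom_pderiv:
  fixes h :: "'a::idom \<Rightarrow> 'b::idom"
  assumes "cring_hom h"
  shows "map_poly h (pderiv p) = pderiv (map_poly h p)"
proof -
  interpret cring_hom h by fact
  have "h (of_nat n) = of_nat n" for n
    by (rule of_nat)
  then show ?thesis
    by (intro poly_eqI) (simp add: coeff_pderiv mult add one)
qed

subsection \<open>Power sums\<close>

text \<open>Newton's identities in generating form: for Q the product of the factors 1 - \<beta>_j
  X, the logarithmic derivative -Q'/Q is the sum of the geometric series \<beta>_j / (1 - \<beta>_j
  X). Without the division it is an induction with the product rule.\<close>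

lemma newton_fps:
  fixes \<beta> :: "'i \<Rightarrow> 'l::field_char_0"
  assumes "finite J"
  shows "(\<Prod>j\<in>J. 1 - fps_const (\<beta> j) * fps_X) * Abs_fps (\<lambda>n. \<Sum>j\<in>J. \<beta> j ^ Suc n) =
    - fps_deriv (\<Prod>j\<in>J. 1 - fps_const (\<beta> j) * fps_X)"
  using assms
proof (induction J)
  case empty
  then show ?case by (simp add: fps_eq_iff)
next
  case (insert b J)
  let ?r = "\<Prod>j\<in>J. 1 - fps_const (\<beta> j) * fps_X"
  let ?b = "1 - fps_const (\<beta> b) * fps_X"
  let ?g = "Abs_fps (\<lambda>n. \<beta> b ^ Suc n)"
  have g: "?b * ?g = fps_const (\<beta> b)"
  proof (rule fps_ext)
    fix n
    show "fps_nth (?b * ?g) n = fps_nth (fps_const (\<beta> b)) n"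
      by (cases n) (simp_all add: algebra_simps mult.assoc fps_X_mult_nth)
  qed
  have s: "Abs_fps (\<lambda>n. \<Sum>j\<in>insert b J. \<beta> j ^ Suc n) = ?g + Abs_fps (\<lambda>n. \<Sum>j\<in>J. \<beta> j ^ Suc n)"
    using insert.hyps by (intro fps_ext) simp
  have "?b * ?r * (?g + Abs_fps (\<lambda>n. \<Sum>j\<in>J. \<beta> j ^ Suc n)) =
      (?b * ?g) * ?r + ?b * (?r * Abs_fps (\<lambda>n. \<Sum>j\<in>J. \<beta> j ^ Suc n))"
    by (simp add: algebra_simps)
  also have "\<dots> = fps_const (\<beta> b) * ?r - ?b * fps_deriv ?r"
    by (simp only: g insert.IH) simp
  also have "\<dots> = - fps_deriv (?b * ?r)"
    by (simp add: algebra_simps)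
  finally show ?case
    unfolding s using insert.hyps by simp
qed

context
  fixes S :: "'l::field_char_0 set"
  assumes S1: "1 \<in> S" and S_diff: "x \<in> S \<Longrightarrow> y \<in> S \<Longrightarrow> x - y \<in> S"
    and S_mult: "x \<in> S \<Longrightarrow> y \<in> S \<Longrightarrow> x * y \<in> S" and S_inv: "x \<in> S \<Longrightarrow> inverse x \<in> S"
begin

lemma subfield_closed:
  shows "0 \<in> S" "x \<in> S \<Longrightarrow> - x \<in> S" "x \<in> S \<Longrightarrow> y \<in> S \<Longrightarrow> x + y \<in> S" "of_nat n \<in> S"
    "(\<And>i. i \<in> I \<Longrightarrow> f i \<in> S) \<Longrightarrow> sum f I \<in> S"
proof -
  show 0: "0 \<in> S" using S_diff[OF S1 S1] by simp
  show m: "- x \<in> S" if "x \<in> S" for x using S_diff[OF 0 that] by simp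
  show a: "x + y \<in> S" if "x \<in> S" "y \<in> S" for x y using S_diff[OF that(1) m[OF that(2)]] by simp
  show "of_nat n \<in> S" for n by (induction n) (auto simp: 0 S1 a)
  show "(\<And>i. i \<in> I \<Longrightarrow> f i \<in> S) \<Longrightarrow> sum f I \<in> S"
    by (induction I rule: infinite_finite_induct) (auto simp: 0 a)
qed

text \<open>Newton's identities can be solved for the coefficients as well as for the power sums;
  the first divides by n, hence characteristic zero. In this form they stand in for the fundamental
  theorem on symmetric polynomials.\<close>

lemma coeffs_iff_power_sums:
  assumes J: "finite (J :: 'i set)"
  shows "(\<forall>n. coeff (\<Prod>j\<in>J. [:- \<beta> j, 1:]) n \<in> S) \<longleftrightarrow> (\<forall>n. (\<Sum>j\<in>J. \<beta> j ^ n) \<in> S)"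
proof -
  define Q where "Q = (\<Prod>j\<in>J. 1 - fps_const (\<beta> j) * fps_X)"
  define q where "q = fps_nth Q"
  define s where "s = (\<lambda>n. \<Sum>j\<in>J. \<beta> j ^ n)"
  \<comment> \<open>The identities are for the factors 1 - \<beta>_j X, whose product is the
    reflection of that of the X - \<beta>_j; \<open>qc\<close> undoes the reversal of the
    coefficients.\<close>
  have refl: "reflect_poly (\<Prod>j\<in>J. [:- \<beta> j, 1:]) = (\<Prod>j\<in>J. [:1, - \<beta> j:])"
    by (simp add: reflect_poly_prod) (simp add: reflect_poly_def)
  have Q: "fps_of_poly (\<Prod>j\<in>J. [:1, - \<beta> j:]) = Q"
    unfolding Q_def by (simp add: fps_of_poly_prod fps_of_poly_pCons algebra_simps
        flip: fps_const_neg)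
  have deg: "degree (\<Prod>j\<in>J. [:- \<beta> j, 1:]) = card J"
    by (subst degree_prod_eq_sum_degree) auto
  have qc: "q n = (if n \<le> card J then coeff (\<Prod>j\<in>J. [:- \<beta> j, 1:]) (card J - n) else 0)" for n
    unfolding q_def Q[symmetric] refl[symmetric] by (simp add: coeff_reflect_poly deg)
  have 1: "(\<forall>n. coeff (\<Prod>j\<in>J. [:- \<beta> j, 1:]) n \<in> S) \<longleftrightarrow> (\<forall>n. q n \<in> S)"
  proof
    assume "\<forall>n. coeff (\<Prod>j\<in>J. [:- \<beta> j, 1:]) n \<in> S"
    then show "\<forall>n. q n \<in> S" by (simp add: qc subfield_closed)
  next
    assume *: "\<forall>n. q n \<in> S"
    have "coeff (\<Prod>j\<in>J. [:- \<beta> j, 1:]) n \<in> S" for n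
    proof (cases "n \<le> card J")
      case True
      then show ?thesis using *[rule_format, of "card J - n"] by (simp add: qc)
    next
      case False
      then show ?thesis using deg by (simp add: coeff_eq_0 subfield_closed)
    qed
    then show "\<forall>n. coeff (\<Prod>j\<in>J. [:- \<beta> j, 1:]) n \<in> S" by blast
  qed
  have q0: "q 0 = 1"
    unfolding q_def Q_def using J by (induction J) auto
  have rec: "(\<Sum>k=0..n. q k * s (Suc (n - k))) = - (of_nat (Suc n) * q (Suc n))" for n
    using arg_cong[OF newton_fps[OF J, of \<beta>], of "\<lambda>f. fps_nth f n"]
    by (simp add: fps_mult_nth q_def s_def Q_def)
  have recq: "q (Suc n) = - (inverse (of_nat (Suc n)) * (\<Sum>k=0..n. q k * s (Suc (n - k))))" for n
  proof -
    have "of_nat (Suc n) \<noteq> (0::'l)" by (rule of_nat_neq_0)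
    then show ?thesis by (simp only: rec) (simp del: of_nat_Suc flip: mult.assoc)
  qed
  have recs: "s (Suc n) = - (of_nat (Suc n) * q (Suc n)) - (\<Sum>k=Suc 0..n. q k * s (Suc (n - k)))" for n
  proof -
    have "(\<Sum>k=0..n. q k * s (Suc (n - k))) = s (Suc n) + (\<Sum>k=Suc 0..n. q k * s (Suc (n - k)))"
      by (subst sum.atLeast_Suc_atMost) (simp_all add: q0)
    then show ?thesis using rec[of n] by (simp only: eq_diff_eq)
  qed
  have 2: "q n \<in> S" if s: "\<forall>n. s n \<in> S" for n
  proof (induction n rule: less_induct)
    case (less n)
    show ?case
    proof (cases n)
      case 0 then show ?thesis using q0 S1 by simp
    next
      case (Suc m)
      have "q k * s (Suc (m - k)) \<in> S" if "k \<in> {0..m}" for k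
        using less[of k] that Suc s by (intro S_mult) auto
      from S_mult[OF S_inv[OF subfield_closed(4)] subfield_closed(5)[OF this], THEN subfield_closed(2)]
      show ?thesis unfolding Suc recq[of m] .
    qed
  qed
  have 3: "s n \<in> S" if q: "\<forall>n. q n \<in> S" for n
  proof (induction n rule: less_induct)
    case (less n)
    show ?case
    proof (cases n)
      case 0
      then have "s n = of_nat (card J)" by (simp add: s_def)
      then show ?thesis using subfield_closed(4) by simp
    next
      case (Suc m)
      have "q k * s (Suc (m - k)) \<in> S" if "k \<in> {Suc 0..m}" for k
        using less[of "Suc (m - k)"] that Suc q by (intro S_mult) auto
      from S_diff[OF S_mult[OF subfield_closed(4) q[rule_format], THEN subfield_closed(2)]
          subfield_closed(5)[OF this]]
      show ?thesis unfolding Suc recs[of m] .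
    qed
  qed
  show ?thesis unfolding 1 using 2 3 by (auto simp: s_def)
qed

end

text \<open>The only consequence of real closedness that the later sections use. The reals share it,
  so that \<open>K\<close> and the reals can be treated symmetrically.\<close>

definition ivt :: "'k::linordered_field itself \<Rightarrow> bool" where
  "ivt _ \<longleftrightarrow> (\<forall>(p::'k poly) a b. a < b \<longrightarrow> poly p a * poly p b < 0 \<longrightarrow> (\<exists>c. a < c \<and> c < b \<and> poly p c = 0))"

interpretation to_ac: cring_hom to_ac
  by unfold_locales auto

lemma range_to_ac_closed:
  shows "1 \<in> range to_ac" "x \<in> range to_ac \<Longrightarrow> y \<in> range to_ac \<Longrightarrow> x - y \<in> range to_ac"
    "x \<in> range to_ac \<Longrightarrow> y \<in> range to_ac \<Longrightarrow> x * y \<in> range to_ac"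
    "x \<in> range to_ac \<Longrightarrow> inverse x \<in> range to_ac"
proof -
  show "1 \<in> range to_ac" by (rule range_eqI[of _ _ 1]) simp
  show "x \<in> range to_ac \<Longrightarrow> y \<in> range to_ac \<Longrightarrow> x - y \<in> range to_ac"
    by (auto simp flip: to_ac_diff)
  show "x \<in> range to_ac \<Longrightarrow> y \<in> range to_ac \<Longrightarrow> x * y \<in> range to_ac"
    by (auto simp flip: to_ac_mult)
  show "x \<in> range to_ac \<Longrightarrow> inverse x \<in> range to_ac"
    by (auto simp flip: to_ac_inverse)
qed

lemmas range_to_ac_add_closed = subfield_closed[of "range to_ac", OF range_to_ac_closed]

text \<open>By the binomial theorem the sum over all ordered pairs splits into products of sums over
  single roots. After removal of the diagonal, half of it is the sum over i < j, because the summand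
  is symmetric.\<close>

lemma symmetric_power_sum:
  fixes \<alpha> :: "nat \<Rightarrow> 'k::field_char_0 alg_closure"
  assumes p: "\<And>n. (\<Sum>i<d. \<alpha> i ^ n) \<in> range to_ac"
  shows "(\<Sum>(i,j)\<in>{(i,j). i < j \<and> j < d}. (\<alpha> i + \<alpha> j + of_nat c * \<alpha> i * \<alpha> j) ^ m) \<in> range to_ac"
proof -
  define f where "f i j = (\<alpha> i + \<alpha> j + of_nat c * \<alpha> i * \<alpha> j) ^ m" for i j
  have poly_sum: "(\<Sum>i<d. poly (map_poly to_ac q) (\<alpha> i)) \<in> range to_ac" for q :: "'k poly"
  proof -
    have "(\<Sum>i<d. poly (map_poly to_ac q) (\<alpha> i)) =
        (\<Sum>i<d. \<Sum>k\<le>degree (map_poly to_ac q). to_ac (coeff q k) * \<alpha> i ^ k)"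
      by (simp add: poly_altdef)
    also have "\<dots> = (\<Sum>k\<le>degree (map_poly to_ac q). to_ac (coeff q k) * (\<Sum>i<d. \<alpha> i ^ k))"
      by (subst sum.swap) (simp add: sum_distrib_left)
    also have "\<dots> \<in> range to_ac"
      by (intro range_to_ac_add_closed(5) range_to_ac_closed(3) p rangeI)
    finally show ?thesis .
  qed
  have all: "(\<Sum>i<d. \<Sum>j<d. f i j) \<in> range to_ac"
  proof -
    have "f i j = (\<Sum>k\<le>m. of_nat (m choose k) * \<alpha> i ^ k *
        poly (map_poly to_ac ([:1, of_nat c:] ^ k * monom 1 (m - k))) (\<alpha> j))" for i j
    proof -
      \<comment> \<open>This grouping makes the binomial expansion separate the powers of
        \<open>\<alpha> i\<close> from polynomials in \<open>\<alpha> j\<close>.\<close>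
      have "f i j = (\<alpha> i * (1 + of_nat c * \<alpha> j) + \<alpha> j) ^ m"
        unfolding f_def by (simp add: algebra_simps)
      also have "\<dots> = (\<Sum>k\<le>m. of_nat (m choose k) * (\<alpha> i * (1 + of_nat c * \<alpha> j)) ^ k * \<alpha> j ^ (m - k))"
        by (rule binomial_ring)
      finally show ?thesis
        by (simp add: to_ac.map_poly_mult cring_hom.power[OF to_ac.map_poly_hom] to_ac.map_poly_pCons
            map_poly_monom poly_monom power_mult_distrib mult_ac)
    qed
    then have "(\<Sum>i<d. \<Sum>j<d. f i j) = (\<Sum>i<d. \<Sum>j<d. \<Sum>k\<le>m. of_nat (m choose k) * \<alpha> i ^ k *
        poly (map_poly to_ac ([:1, of_nat c:] ^ k * monom 1 (m - k))) (\<alpha> j))" by simp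
    also have "\<dots> = (\<Sum>k\<le>m. of_nat (m choose k) * (\<Sum>i<d. \<alpha> i ^ k) *
        (\<Sum>j<d. poly (map_poly to_ac ([:1, of_nat c:] ^ k * monom 1 (m - k))) (\<alpha> j)))"
      apply (subst sum.swap) 
      apply (subst (2) sum.swap)
      apply (subst sum.swap)
      apply (rule sum.cong[OF refl])
      apply (simp add: sum_distrib_left sum_distrib_right mult.assoc)
      done
    also have "\<dots> \<in> range to_ac"
      by (intro range_to_ac_add_closed(5) range_to_ac_closed(3) range_to_ac_add_closed(4) p poly_sum)
    finally show ?thesis .
  qed
  have diag: "(\<Sum>i<d. f i i) \<in> range to_ac"
  proof -
    have "f i i = poly (map_poly to_ac ([:0, 2, of_nat c:] ^ m)) (\<alpha> i)" for i
      by (simp add: f_def to_ac.map_poly_mult cring_hom.power[OF to_ac.map_poly_hom]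
          to_ac.map_poly_pCons algebra_simps)
    then show ?thesis using poly_sum by simp
  qed
  let ?J = "{(i,j). i < j \<and> j < d}"
  have fin: "finite ?J" by (rule finite_subset[of _ "{..<d} \<times> {..<d}"]) auto
  have "(\<Sum>i<d. \<Sum>j<d. f i j) = (\<Sum>(i,j)\<in>{..<d} \<times> {..<d}. f i j)"
    by (simp add: sum.cartesian_product)
  also have "{..<d} \<times> {..<d} = ?J \<union> (\<lambda>(i,j). (j,i)) ` ?J \<union> (\<lambda>i. (i,i)) ` {..<d}"
  proof (intro Set.set_eqI iffI)
    fix x assume "x \<in> {..<d} \<times> {..<d}"
    then obtain i j where x: "x = (i, j)" "i < d" "j < d" by auto
    consider "i < j" | "j < i" | "i = j" by linarith
    then show "x \<in> ?J \<union> (\<lambda>(i,j). (j,i)) ` ?J \<union> (\<lambda>i. (i,i)) ` {..<d}"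
      using x by cases (auto simp: image_iff)
  qed auto
  also have "(\<Sum>(i,j)\<in>\<dots>. f i j) = (\<Sum>(i,j)\<in>?J. f i j) + (\<Sum>(i,j)\<in>(\<lambda>(i,j). (j,i)) ` ?J. f i j) +
      (\<Sum>(i,j)\<in>(\<lambda>i. (i,i)) ` {..<d}. f i j)"
    using fin by (subst sum.union_disjoint; (subst sum.union_disjoint)?) auto
  also have "(\<Sum>(i,j)\<in>(\<lambda>(i,j). (j,i)) ` ?J. f i j) = (\<Sum>(i,j)\<in>?J. f i j)"
    by (subst sum.reindex) (auto simp: inj_on_def f_def algebra_simps intro!: sum.cong)
  also have "(\<Sum>(i,j)\<in>(\<lambda>i. (i,i)) ` {..<d}. f i j) = (\<Sum>i<d. f i i)"
    by (subst sum.reindex) (auto simp: inj_on_def)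
  finally have "(\<Sum>(i,j)\<in>?J. f i j) = inverse (of_nat 2) * ((\<Sum>i<d. \<Sum>j<d. f i j) - (\<Sum>i<d. f i i))"
    by simp
  also have "\<dots> \<in> range to_ac"
    by (intro range_to_ac_closed(2-4) all diag range_to_ac_add_closed(4))
  finally show ?thesis by (simp add: f_def)
qed

subsection \<open>Algebraic closedness of the quadratic extension\<close>

context
  fixes \<iota> :: "'k::linordered_field alg_closure"
  assumes rc: "real_closed TYPE('k)" and ii: "\<iota> * \<iota> = - 1"
begin

definition Ki :: "'k alg_closure set" where
  "Ki = {to_ac a + to_ac b * \<iota> |a b. True}"

lemma KiI [intro]: "to_ac a + to_ac b * \<iota> \<in> Ki"
  by (auto simp: Ki_def)

lemma Ki_of [intro]: "to_ac a \<in> Ki"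
  using KiI[of a 0] by simp

lemma Ki_add: "x \<in> Ki \<Longrightarrow> y \<in> Ki \<Longrightarrow> x + y \<in> Ki"
proof -
  assume "x \<in> Ki" "y \<in> Ki"
  then obtain a b c d where "x = to_ac a + to_ac b * \<iota>" "y = to_ac c + to_ac d * \<iota>"
    by (auto simp: Ki_def)
  then have "x + y = to_ac (a + c) + to_ac (b + d) * \<iota>" by (simp add: algebra_simps)
  then show ?thesis by (metis KiI)
qed

lemma Ki_mult: "x \<in> Ki \<Longrightarrow> y \<in> Ki \<Longrightarrow> x * y \<in> Ki"
proof -
  assume "x \<in> Ki" "y \<in> Ki"
  then obtain a b c d where *: "x = to_ac a + to_ac b * \<iota>" "y = to_ac c + to_ac d * \<iota>"
    by (auto simp: Ki_def)
  have "x * y = to_ac a * to_ac c + to_ac b * to_ac d * (\<iota> * \<iota>) + (to_ac a * to_ac d + to_ac b * to_ac c) * \<iota>"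
    unfolding * by (simp add: algebra_simps)
  also have "\<dots> = to_ac (a * c - b * d) + to_ac (a * d + b * c) * \<iota>" by (simp add: ii)
  finally show ?thesis by (metis KiI)
qed

lemma Ki_diff: "x \<in> Ki \<Longrightarrow> y \<in> Ki \<Longrightarrow> x - y \<in> Ki"
  using Ki_add[of x "to_ac (-1) * y"] Ki_mult[of "to_ac (-1)" y] Ki_of[of "-1"] by simp

text \<open>With r the square root of a^2 + b^2, a square root of a + b\<iota> is u + v\<iota>,
  where u^2 = (r + a)/2 and v^2 = (r - a)/2; the sign of v is chosen so that 2uv = b.\<close>

lemma Ki_sqrt:
  assumes "x \<in> Ki"
  shows "\<exists>y\<in>Ki. y ^ 2 = x"
proof -
  obtain a b where x: "x = to_ac a + to_ac b * \<iota>" using assms by (auto simp: Ki_def)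
  have sq: "\<exists>s\<ge>0. s ^ 2 = c" if "c \<ge> 0" for c :: 'k
  proof -
    obtain s where "s ^ 2 = c" using rc \<open>c \<ge> 0\<close> by (auto simp: real_closed_def)
    then show ?thesis by (intro exI[of _ "\<bar>s\<bar>"]) simp
  qed
  obtain r where r: "r \<ge> 0" "r ^ 2 = a ^ 2 + b ^ 2" using sq[of "a ^ 2 + b ^ 2"] by auto
  have "\<bar>a\<bar> \<le> r" by (rule power2_le_imp_le) (use r in auto)
  then have "(r + a) / 2 \<ge> 0" "(r - a) / 2 \<ge> 0" by auto
  then obtain u v0 where u: "u \<ge> 0" "u ^ 2 = (r + a) / 2" and v0: "v0 \<ge> 0" "v0 ^ 2 = (r - a) / 2"
    using sq by meson
  have "(2 * u * v0) ^ 2 = \<bar>b\<bar> ^ 2"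
  proof -
    have "(2 * u * v0) ^ 2 = 4 * u ^ 2 * v0 ^ 2" by (simp add: power_mult_distrib)
    also have "\<dots> = (r + a) * (r - a)" by (simp add: u v0)
    also have "\<dots> = b ^ 2" using r by (simp add: algebra_simps power2_eq_square)
    finally show ?thesis by simp
  qed
  then have uv: "2 * u * v0 = \<bar>b\<bar>" by (rule power2_eq_imp_eq) (simp_all add: u(1) v0(1))
  define v where "v = (if b \<ge> 0 then v0 else - v0)"
  have v: "v ^ 2 = (r - a) / 2"
    by (simp add: v_def v0(2))
  have v': "2 * u * v = b"
  proof (cases "b \<ge> 0")
    case True
    then show ?thesis using uv by (simp only: v_def if_True abs_of_nonneg)
  next
    case False
    then have "2 * u * v = - (2 * u * v0)" by (simp add: v_def)
    then show ?thesis using False unfolding uv by simp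
  qed
  have "(to_ac u + to_ac v * \<iota>) ^ 2 = to_ac u ^ 2 + to_ac v ^ 2 * (\<iota> * \<iota>) + to_ac (2 * u * v) * \<iota>"
    by (simp add: power2_eq_square algebra_simps)
  also have "\<dots> = to_ac (u ^ 2 - v ^ 2) + to_ac b * \<iota>" by (simp only: v' ii) simp
  also have "u ^ 2 - v ^ 2 = a" by (simp add: u v field_simps)
  finally show ?thesis unfolding x by blast
qed

text \<open>The discriminant (x - y)^2 of the quadratic with roots x and y lies in
  \<open>Ki\<close>, and so does a square root of it, which is x - y up to sign.\<close>

lemma Ki_quadratic:
  assumes s: "x + y \<in> Ki" and p: "x * y \<in> Ki"
  shows "x \<in> Ki"
proof -
  have "(x - y) ^ 2 = (x + y) * (x + y) - to_ac 4 * (x * y)"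
    by (simp add: algebra_simps power2_eq_square)
  also have "\<dots> \<in> Ki" by (intro Ki_diff Ki_mult s p Ki_of)
  finally obtain w where w: "w \<in> Ki" "w ^ 2 = (x - y) ^ 2" using Ki_sqrt by blast
  then have "x - y \<in> Ki"
    by (metis power2_eq_iff Ki_diff Ki_of diff_0 minus_minus to_ac_0)
  then have "to_ac (1 / 2) * ((x + y) + (x - y)) \<in> Ki" by (intro Ki_mult Ki_add Ki_of s)
  then show ?thesis by simp
qed

text \<open>Laplace's induction on the exponent of 2 in the degree d. The numbers
  \<open>\<alpha> i + \<alpha> j + of_nat c * \<alpha> i * \<alpha> j\<close> with i < j are the
  roots of a polynomial over the base field of degree d(d - 1)/2, so for every c one of them lies in
  \<open>Ki\<close>. There are infinitely many c and finitely many pairs; two values of c that share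
  a pair give the sum and the product of two roots.\<close>

theorem poly_root_in_Ki:
  fixes p :: "'k poly"
  assumes "degree p = 2 ^ k * m" "odd m"
  shows "\<exists>x\<in>Ki. poly (map_poly to_ac p) x = 0"
  using assms
proof (induction k arbitrary: p m)
  case 0
  then obtain x where "poly p x = 0" using rc by (auto simp: real_closed_def)
  then have "poly (map_poly to_ac p) (to_ac x) = 0" by (simp add: to_ac.poly_map_poly)
  then show ?case by blast
next
  case (Suc k)
  let ?P = "map_poly to_ac p"
  define d where "d = degree p"
  have d0: "d > 0" using Suc.prems by (auto simp: d_def elim: oddE)
  have dP: "degree ?P = d" by (simp add: d_def degree_map_poly)
  have P0: "?P \<noteq> 0" using dP d0 by auto
  obtain A where A: "size A = d" "?P = smult (lead_coeff ?P) (\<Prod>x\<in>#A. [:- x, 1:])"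
    using alg_closed_imp_factorization[OF P0] dP by metis
  obtain xs where xs: "mset xs = A" using ex_mset by blast
  define \<alpha> where "\<alpha> i = xs ! i" for i
  have len: "length xs = d" using A xs by auto
  have prod: "(\<Prod>x\<in>#A. [:- x, 1:]) = (\<Prod>i<d. [:- \<alpha> i, 1:])"
    unfolding xs[symmetric] \<alpha>_def len[symmetric]
    by (simp only: mset_map[symmetric] prod_mset_prod_list prod.list_conv_set_nth) (simp add: atLeast0LessThan)
  define lc where "lc = lead_coeff p"
  have lc: "lc \<noteq> 0" "lead_coeff ?P = to_ac lc"
    using d0 dP by (auto simp: lc_def d_def)
  have P: "?P = smult (to_ac lc) (\<Prod>i<d. [:- \<alpha> i, 1:])"
    using A(2) unfolding prod lc(2) .
  have root: "poly ?P (\<alpha> i) = 0" if "i < d" for i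
    using that arg_cong[OF P, of "\<lambda>q. poly q (\<alpha> i)"] by (auto simp: poly_prod)
  have "coeff (\<Prod>i<d. [:- \<alpha> i, 1:]) n \<in> range to_ac" for n
  proof -
    have "to_ac (coeff p n) = to_ac lc * coeff (\<Prod>i<d. [:- \<alpha> i, 1:]) n"
      using arg_cong[OF P, of "\<lambda>q. coeff q n"] by simp
    then have "coeff (\<Prod>i<d. [:- \<alpha> i, 1:]) n = to_ac (coeff p n / lc)"
      using lc(1) by (simp add: field_simps)
    then show ?thesis by (simp only: rangeI)
  qed
  then have psum: "(\<Sum>i<d. \<alpha> i ^ n) \<in> range to_ac" for n
    using coeffs_iff_power_sums[OF range_to_ac_closed, of "{..<d}" \<alpha>] by auto
  let ?J = "{(i,j). i < j \<and> j < d}"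
  have fin: "finite ?J" by (rule finite_subset[of _ "{..<d} \<times> {..<d}"]) auto
  define \<gamma> where "\<gamma> c = (\<lambda>(i,j). \<alpha> i + \<alpha> j + of_nat c * \<alpha> i * \<alpha> j)" for c :: nat
  \<comment> \<open>One factor 2 of d is cancelled, and d - 1 is odd because d is even.\<close>
  have card: "card ?J = 2 ^ k * (m * (d - 1))"
  proof -
    have "?J = (SIGMA j:{..<d}. {..<j})\<inverse>" by auto
    then have "card ?J = (\<Sum>j<d. j)" by (simp add: card_inverse)
    moreover have "2 * (\<Sum>j<n. j) = n * (n - 1)" for n :: nat
    proof (induction n)
      case (Suc n)
      then show ?case by (cases n) auto
    qed simp
    ultimately have "2 * card ?J = d * (d - 1)" by simp
    then show ?thesis using Suc.prems by (simp add: d_def)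
  qed
  have "\<exists>ij\<in>?J. \<gamma> c ij \<in> Ki" for c
  proof -
    have "(\<Sum>ij\<in>?J. \<gamma> c ij ^ n) \<in> range to_ac" for n
      using symmetric_power_sum[OF psum, where c=c and m=n] by (simp add: \<gamma>_def case_prod_unfold)
    then have "\<forall>n. coeff (\<Prod>ij\<in>?J. [:- \<gamma> c ij, 1:]) n \<in> range to_ac"
      using coeffs_iff_power_sums[OF range_to_ac_closed fin] by blast
    then have "map_poly to_ac (map_poly of_ac (\<Prod>ij\<in>?J. [:- \<gamma> c ij, 1:])) = (\<Prod>ij\<in>?J. [:- \<gamma> c ij, 1:])"
      by (intro poly_eqI) (simp add: coeff_map_poly to_ac_of_ac)
    then obtain q where q: "map_poly to_ac q = (\<Prod>ij\<in>?J. [:- \<gamma> c ij, 1:])" by blast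
    have "degree q = degree (map_poly to_ac q)" by (simp add: degree_map_poly)
    also have "\<dots> = card ?J" unfolding q by (subst degree_prod_eq_sum_degree) auto
    finally have "degree q = 2 ^ k * (m * (d - 1))" by (simp add: card)
    moreover have "odd (m * (d - 1))" using Suc.prems d0 by (simp add: d_def)
    ultimately obtain x where "x \<in> Ki" "poly (map_poly to_ac q) x = 0" using Suc.IH by blast
    then show ?thesis unfolding q using fin by (auto simp: poly_prod)
  qed
  then obtain g where g: "g c \<in> ?J" "\<gamma> c (g c) \<in> Ki" for c by metis
  have "\<not> inj g"
  proof
    assume "inj g"
    then have "infinite (range g)" using finite_imageD by blast
    moreover have "range g \<subseteq> ?J" by (intro image_subsetI g(1))
    ultimately show False using fin finite_subset by blast
  qed
  then obtain c c' where cc: "c \<noteq> c'" "g c = g c'" by (auto simp: inj_def)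
  obtain i j where ij: "g c = (i, j)" by fastforce
  then have ij': "g c' = (i, j)" using cc by simp
  have 1: "\<alpha> i + \<alpha> j + of_nat c * \<alpha> i * \<alpha> j \<in> Ki" "\<alpha> i + \<alpha> j + of_nat c' * \<alpha> i * \<alpha> j \<in> Ki"
    using g(2)[of c] g(2)[of c'] unfolding ij ij' \<gamma>_def by simp_all
  let ?e = "to_ac (1 / (of_nat c - of_nat c')) :: 'k alg_closure"
  have gen: "e * ((a + b + x * a * b) - (a + b + y * a * b)) = (e * (x - y)) * (a * b)"
    for e a b x y :: "'k alg_closure" by (simp add: algebra_simps)
  have e: "?e * (of_nat c - of_nat c') = 1" using cc by simp
  have "?e * ((\<alpha> i + \<alpha> j + of_nat c * \<alpha> i * \<alpha> j) - (\<alpha> i + \<alpha> j + of_nat c' * \<alpha> i * \<alpha> j)) \<in> Ki"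
    by (intro Ki_mult Ki_diff 1 Ki_of)
  also have "?e * ((\<alpha> i + \<alpha> j + of_nat c * \<alpha> i * \<alpha> j) - (\<alpha> i + \<alpha> j + of_nat c' * \<alpha> i * \<alpha> j)) =
      (?e * (of_nat c - of_nat c')) * (\<alpha> i * \<alpha> j)" by (rule gen)
  finally have 2: "\<alpha> i * \<alpha> j \<in> Ki" unfolding e by simp
  have "(\<alpha> i + \<alpha> j + of_nat c * \<alpha> i * \<alpha> j) - to_ac (of_nat c) * (\<alpha> i * \<alpha> j) \<in> Ki"
    by (intro Ki_mult Ki_diff 1 2 Ki_of)
  then have "\<alpha> i + \<alpha> j \<in> Ki" by simp
  then have "\<alpha> i \<in> Ki" using 2 by (rule Ki_quadratic)
  moreover have "i < d" using g(1)[of c] ij by auto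
  ultimately show ?case using root by blast
qed

end

text \<open>The contrapositive, by induction on the degree: if p has no root on [a, b], then p(a)
  and p(b) have the same sign. A root u + v\<iota> of p gives either a linear factor whose root lies
  outside the interval (v = 0) or the factor (X - u)^2 + v^2, which is positive everywhere.\<close>

theorem real_closed_imp_ivt:
  assumes rc: "real_closed TYPE('k::linordered_field)"
  shows "ivt TYPE('k)"
proof -
  obtain \<iota> :: "'k alg_closure" where "\<iota> ^ 2 = - 1"
    using nth_root_exists[of 2 "- 1 :: 'k alg_closure"] by auto
  then have ii: "\<iota> * \<iota> = - 1" by (simp add: power2_eq_square)
  have "poly p a * poly p b > 0" if "a < b" "\<And>c. a \<le> c \<Longrightarrow> c \<le> b \<Longrightarrow> poly p c \<noteq> 0" for p :: "'k poly" and a b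
    using that(2)
  proof (induction "degree p" arbitrary: p rule: less_induct)
    case less
    show ?case
    proof (cases "degree p = 0")
      case True
      then obtain c where "p = [:c:]" by (auto elim: degree_eq_zeroE)
      then show ?thesis using less.prems[of a] \<open>a < b\<close> by (auto simp: zero_less_mult_iff)
    next
      case False
      obtain m where "degree p = 2 ^ multiplicity 2 (degree p) * m" "odd m"
        using multiplicity_decompose'[of "degree p" 2] False by auto
      then obtain x where x: "x \<in> Ki \<iota>" "poly (map_poly to_ac p) x = 0"
        using poly_root_in_Ki[OF rc ii] by blast
      obtain u v where uv: "x = to_ac u + to_ac v * \<iota>" using x unfolding Ki_def[OF rc ii] by auto
      show ?thesis
      proof (cases "v = 0")
        case True
        then have "poly p u = 0" using x uv by (simp add: to_ac.poly_map_poly)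
        then obtain q where q: "p = [:- u, 1:] * q" by (metis dvd_def poly_eq_0_iff_dvd)
        then have "q \<noteq> 0" using False by auto
        then have "degree q < degree p" unfolding q by (subst degree_mult_eq) auto
        moreover have "poly q c \<noteq> 0" if "a \<le> c" "c \<le> b" for c
          using less.prems[OF that] by (simp add: q)
        ultimately have "poly q a * poly q b > 0" using less.hyps by blast
        moreover have "(a - u) * (b - u) > 0"
        proof -
          have "\<not> (a \<le> u \<and> u \<le> b)" using less.prems[of u] by (auto simp: q)
          then show ?thesis using \<open>a < b\<close> by (auto simp: zero_less_mult_iff)
        qed
        ultimately have "((a - u) * (b - u)) * (poly q a * poly q b) > 0" by (rule mult_pos_pos[rotated])
        then show ?thesis by (simp add: q algebra_simps)
      next
        case v: False
        define s where "s = [:u ^ 2 + v ^ 2, - 2 * u, 1:]"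
        have sdeg: "degree s = 2" by (simp add: s_def)
        have spos: "poly s c > 0" for c
        proof -
          have "poly s c = (c - u) ^ 2 + v ^ 2" by (simp add: s_def power2_eq_square algebra_simps)
          then show ?thesis using v by (simp add: add_nonneg_pos)
        qed
        have sx: "poly (map_poly to_ac s) x = 0"
        proof -
          have "poly (map_poly to_ac s) x = to_ac v ^ 2 * (1 + \<iota> * \<iota>)"
            unfolding s_def uv by (simp add: to_ac.map_poly_pCons power2_eq_square algebra_simps)
          then show ?thesis by (simp add: ii)
        qed
        define r where "r = p mod s"
        have pr: "p = s * (p div s) + r" by (simp add: r_def)
        \<comment> \<open>The remainder is c0 + c1 X. If it vanishes at u + v\<iota> with v nonzero,
          then a sum of two squares is zero, and c0 = c1 = 0.\<close>
        have "r = 0"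
        proof (rule ccontr)
          assume "r \<noteq> 0"
          then have "degree r < 2" using degree_mod_less[of s p] sdeg by (auto simp: r_def s_def)
          then obtain c0 c1 where r: "r = [:c0, c1:]" 
            by (metis degree1_coeffs degree_eq_zeroE less_2_cases pCons_0_0 One_nat_def)
          have "poly (map_poly to_ac r) x = 0"
            using x sx arg_cong[OF pr, of "\<lambda>q. poly (map_poly to_ac q) x"]
            by (simp add: to_ac.map_poly_add to_ac.map_poly_mult)
          then have e: "to_ac (c0 + c1 * u) + to_ac (c1 * v) * \<iota> = 0"
            by (simp add: r to_ac.map_poly_pCons uv algebra_simps)
          then have "to_ac (c0 + c1 * u) = - (to_ac (c1 * v) * \<iota>)" by (simp only: eq_neg_iff_add_eq_0)
          then have "to_ac (c0 + c1 * u) ^ 2 = (to_ac (c1 * v) * \<iota>) ^ 2" by simp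
          also have "\<dots> = to_ac (c1 * v) ^ 2 * (\<iota> * \<iota>)" by (simp only: power2_eq_square mult_ac)
          finally have "to_ac ((c0 + c1 * u) ^ 2) = to_ac (- ((c1 * v) ^ 2))"
            by (simp only: ii to_ac_power to_ac_minus) simp
          then have "(c0 + c1 * u) ^ 2 + (c1 * v) ^ 2 = 0" by (simp only: to_ac_eq_iff)
          then have "c0 + c1 * u = 0 \<and> c1 * v = 0" by (simp only: sum_power2_eq_zero_iff)
          then have "c0 = 0 \<and> c1 = 0" using v by auto
          then show False using r \<open>r \<noteq> 0\<close> by simp
        qed
        then obtain q where q: "p = s * q" using pr by simp
        then have "q \<noteq> 0" using False by auto
        then have "degree q < degree p" unfolding q using sdeg by (subst degree_mult_eq) auto
        moreover have "poly q c \<noteq> 0" if "a \<le> c" "c \<le> b" for c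
          using less.prems[OF that] by (simp add: q)
        ultimately have "poly q a * poly q b > 0" using less.hyps by blast
        then have "(poly s a * poly s b) * (poly q a * poly q b) > 0"
          using mult_pos_pos[OF mult_pos_pos[OF spos spos]] by blast
        then show ?thesis by (simp add: q algebra_simps)
      qed
    qed
  qed
  then show ?thesis
    unfolding ivt_def by (metis less_asym less_le mult_eq_0_iff order.irrefl)
qed

section \<open>Sign diagrams and the transfer principle\<close>

lemma ivtD: "ivt TYPE('k::linordered_field) \<Longrightarrow> a < b \<Longrightarrow> poly (p::'k poly) a * poly p b < 0 \<Longrightarrow>
    \<exists>c. a < c \<and> c < b \<and> poly p c = 0"
  by (auto simp: ivt_def)

lemma neg_prod_aux:
  fixes m n a b u v :: "'k::linordered_field"
  shows "m * ((a - b) * u) * (n * ((b - a) * v)) = - (m * n * ((b - a) * (b - a)) * (u * v))"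
  by (simp add: algebra_simps)

text \<open>No completeness is at hand, so the argument is algebraic. Between consecutive roots a
  and b' write p as (X - a)^(m+1) (X - b')^(n+1) q. Then q has the same sign at a and b', and the
  cofactor G of (X - a)^m (X - b')^n in p' has opposite signs there.\<close>

lemma poly_rolle:
  fixes p :: "'k::linordered_field poly"
  assumes I: "ivt TYPE('k)" and p: "p \<noteq> 0" and "a < b" "poly p a = 0" "poly p b = 0"
  shows "\<exists>c. a < c \<and> c < b \<and> poly (pderiv p) c = 0"
proof -
  define Z where "Z = {x. poly p x = 0} \<inter> {a<..}"
  have Z: "finite Z" "b \<in> Z" using poly_roots_finite[OF p] assms by (auto simp: Z_def)
  define b' where "b' = Min Z"
  have b': "b' \<in> Z" "b' \<le> b" using Z by (auto simp: b'_def intro: Min_in)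
  have ab': "a < b'" "poly p b' = 0" using b' by (auto simp: Z_def)
  have nr: "poly p x \<noteq> 0" if "a < x" "x < b'" for x
  proof
    assume "poly p x = 0"
    then have "b' \<le> x" using Z that unfolding b'_def by (intro Min_le) (auto simp: Z_def)
    then show False using that by simp
  qed
  obtain r where r: "p = [:- a, 1:] ^ order a p * r" "\<not> [:- a, 1:] dvd r"
    using order_decomp[OF p] by blast
  have "order a p \<noteq> 0" using assms order_root by blast
  then obtain m where m: "order a p = Suc m" by (cases "order a p") auto
  have r0: "r \<noteq> 0" using r(2) by auto
  obtain q where q: "r = [:- b', 1:] ^ order b' r * q" "\<not> [:- b', 1:] dvd q"
    using order_decomp[OF r0] by blast
  have "poly r b' = 0" using ab' arg_cong[OF r(1), of "\<lambda>q. poly q b'"] by simp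
  then have "order b' r \<noteq> 0" using r0 order_root by blast
  then obtain n where n: "order b' r = Suc n" by (cases "order b' r") auto
  have pq: "p = [:- a, 1:] ^ Suc m * ([:- b', 1:] ^ Suc n * q)" using r(1) q(1) m n by metis
  have qb: "poly q b' \<noteq> 0" using q(2) by (simp add: poly_eq_0_iff_dvd)
  have "poly r a \<noteq> 0" using r(2) by (simp add: poly_eq_0_iff_dvd)
  then have qa: "poly q a \<noteq> 0" using arg_cong[OF q(1), of "\<lambda>q. poly q a"] by auto
  have "\<not> poly q a * poly q b' < 0"
  proof
    assume "poly q a * poly q b' < 0"
    then obtain c where "a < c" "c < b'" "poly q c = 0" using ivtD[OF I ab'(1)] by blast
    then show False using nr[of c] pq by simp
  qed
  then have qq: "poly q a * poly q b' > 0" using qa qb by (simp add: not_less less_le)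
  define G where "G = smult (of_nat (Suc m)) ([:- b', 1:] * q) + smult (of_nat (Suc n)) ([:- a, 1:] * q)
      + [:- a, 1:] * [:- b', 1:] * pderiv q"
  have pd: "pderiv [:- c, 1:] = (1 :: 'k poly)" for c by (simp add: pderiv_pCons)
  have G: "pderiv p = [:- a, 1:] ^ m * [:- b', 1:] ^ n * G"
    unfolding pq pderiv_mult pderiv_power_Suc pd G_def
    by (simp only: power_Suc smult_add_right mult_smult_left mult_smult_right distrib_left distrib_right
        mult_1_right mult_1_left mult_ac add_ac)
  have Ga: "poly G a = of_nat (Suc m) * ((a - b') * poly q a)"
    and Gb: "poly G b' = of_nat (Suc n) * ((b' - a) * poly q b')"
    by (simp_all only: G_def poly_add poly_smult poly_mult poly_pCons) (simp_all add: algebra_simps del: of_nat_Suc)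
  have "poly G a * poly G b' = - (of_nat (Suc m) * of_nat (Suc n) * (b' - a) ^ 2 * (poly q a * poly q b'))"
    unfolding Ga Gb power2_eq_square by (rule neg_prod_aux)
  also have "\<dots> < 0" using qq ab' by (simp add: mult_pos_pos del: of_nat_Suc)
  finally obtain c where "a < c" "c < b'" "poly G c = 0" using ivtD[OF I ab'(1)] by blast
  then show ?thesis using b'(2) G by (intro exI[of _ c]) auto
qed

lemma poly_mvt:
  fixes p :: "'k::linordered_field poly"
  assumes I: "ivt TYPE('k)" and ab: "a < b"
  shows "\<exists>c. a < c \<and> c < b \<and> poly p b - poly p a = (b - a) * poly (pderiv p) c"
proof -
  define s where "s = (poly p b - poly p a) / (b - a)"
  define g where "g = p - [:poly p a - s * a, s:]"
  have s: "s * (b - a) = poly p b - poly p a" using ab by (simp add: s_def)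
  have "\<exists>c. a < c \<and> c < b \<and> poly (pderiv g) c = 0"
  \<comment> \<open>\<open>g\<close> is zero when p is affine; then every intermediate point will
    do.\<close>
  proof (cases "g = 0")
    case True
    then show ?thesis using dense[OF ab] by auto
  next
    case False
    have "poly g a = 0" by (simp add: g_def)
    moreover have "poly g b = 0" using s by (simp add: g_def algebra_simps)
    ultimately show ?thesis using poly_rolle[OF I False ab] by blast
  qed
  then obtain c where c: "a < c" "c < b" "poly (pderiv g) c = 0" by blast
  then have "poly (pderiv p) c = s" by (simp add: g_def pderiv_diff pderiv_pCons)
  then show ?thesis using c s by (metis mult.commute)
qed

text \<open>The sign of the derivative is prescribed on the open interval only. This admits end
  points where it vanishes, such as nodes of a sign diagram.\<close>

lemma poly_mono_sgn:
  fixes p :: "'k::linordered_field poly"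
  assumes I: "ivt TYPE('k)" and ab: "a < b" and "\<And>c. a < c \<Longrightarrow> c < b \<Longrightarrow> sgn (poly (pderiv p) c) = e"
  shows "sgn (poly p b - poly p a) = e"
proof -
  obtain c where "a < c" "c < b" "poly p b - poly p a = (b - a) * poly (pderiv p) c"
    using poly_mvt[OF I ab] by blast
  then show ?thesis using assms(3)[of c] ab by (simp add: sgn_mult)
qed

lemma poly_const_sgn:
  fixes p :: "'k::linordered_field poly"
  assumes I: "ivt TYPE('k)" and "a \<le> b" and nr: "\<And>c. a \<le> c \<Longrightarrow> c \<le> b \<Longrightarrow> poly p c \<noteq> 0"
  shows "sgn (poly p a) = sgn (poly p b)"
proof (cases "a = b")
  case False
  then have ab: "a < b" using assms by simp
  have "\<not> poly p a * poly p b < 0" using ivtD[OF I ab] nr by (meson less_imp_le)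
  moreover have "poly p a \<noteq> 0" "poly p b \<noteq> 0" using nr ab by auto
  ultimately show ?thesis by (auto simp: sgn_if mult_less_0_iff)
qed simp

lemma poly_pos_at_top:
  fixes p :: "'k::linordered_field poly"
  assumes "lead_coeff p > 0"
  shows "\<exists>M. \<forall>x\<ge>M. poly p x > 0"
proof -
  \<comment> \<open>The induction needs a positive lower bound: if q \<ge> c > 0 beyond M, then a +
    x q(x) \<ge> c for x beyond M, 0 and (c - a)/c.\<close>
  have "\<exists>M c. c > 0 \<and> (\<forall>x\<ge>M. poly p x \<ge> c)"
    using assms
  proof (induction p)
    case (pCons a p)
    show ?case
    proof (cases "p = 0")
      case True
      then show ?thesis using pCons.prems by auto
    next
      case False
      then obtain M c where Mc: "c > 0" "\<And>x. x \<ge> M \<Longrightarrow> poly p x \<ge> c"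
        using pCons by auto
      have "poly (pCons a p) x \<ge> c" if x: "x \<ge> max (max M 0) ((c - a) / c)" for x
      proof -
        have "c - a \<le> x * c" using x Mc(1) by (simp add: divide_le_eq)
        also have "\<dots> \<le> x * poly p x" using x Mc(2)[of x] by (intro mult_left_mono) auto
        finally show ?thesis by simp
      qed
      then show ?thesis using Mc(1) by blast
    qed
  qed simp
  then show ?thesis using less_le_trans by blast
qed

lemma poly_sgn_at_top:
  fixes p :: "'k::linordered_field poly"
  shows "\<exists>M. \<forall>x\<ge>M. sgn (poly p x) = sgn (lead_coeff p)"
proof (cases "p = 0")
  case False
  then consider "lead_coeff p > 0" | "lead_coeff (- p) > 0" 
    by (metis coeff_minus degree_minus leading_coeff_0_iff linorder_neqE neg_0_less_iff_less)
  then show ?thesis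
  proof cases
    case 1
    then show ?thesis using poly_pos_at_top[OF 1] by (metis sgn_pos)
  next
    case 2
    then obtain M where "\<forall>x\<ge>M. poly (- p) x > 0" using poly_pos_at_top[OF 2] by blast
    then have "\<forall>x\<ge>M. sgn (poly p x) = - 1" by (auto simp: sgn_if)
    moreover have "sgn (lead_coeff p) = - 1" using 2 by (auto simp: sgn_if)
    ultimately show ?thesis by metis
  qed
qed simp

lemma poly_sgn_at_bot:
  fixes p :: "'k::linordered_field poly"
  shows "\<exists>M. \<forall>x\<le>M. sgn (poly p x) = sgn (lead_coeff p * (- 1) ^ degree p)"
proof -
  have "lead_coeff (pcompose p [:0, - 1:]) = lead_coeff p * (- 1) ^ degree p"
    by (subst lead_coeff_comp) auto
  then obtain M where M: "\<forall>x\<ge>M. sgn (poly (pcompose p [:0, - 1:]) x) = sgn (lead_coeff p * (- 1) ^ degree p)"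
    using poly_sgn_at_top[of "pcompose p [:0, - 1:]"] by metis
  have "sgn (poly p x) = sgn (lead_coeff p * (- 1) ^ degree p)" if "x \<le> - M" for x
    using M[rule_format, of "- x"] that by (simp add: poly_pcompose)
  then show ?thesis by blast
qed

section \<open>Signs in two ordered fields and sign diagrams\<close>

definition same_sgn :: "'k::linordered_field \<Rightarrow> 'r::linordered_field \<Rightarrow> bool" where
  "same_sgn a b \<longleftrightarrow> (0 < a \<longleftrightarrow> 0 < b) \<and> (a < 0 \<longleftrightarrow> b < 0)"

lemma same_sgn_zero: "same_sgn a b \<Longrightarrow> a = 0 \<longleftrightarrow> b = 0"
  by (auto simp: same_sgn_def)

lemma same_sgn_sym: "same_sgn a b \<Longrightarrow> same_sgn b a"
  by (auto simp: same_sgn_def)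

lemma same_sgn_0 [simp]: "same_sgn 0 0" and same_sgn_1 [simp]: "same_sgn 1 1"
  by (auto simp: same_sgn_def)

lemma same_sgn_minus: "same_sgn a b \<Longrightarrow> same_sgn (- a) (- b)"
  by (auto simp: same_sgn_def)

lemma same_sgn_mult: "same_sgn a a' \<Longrightarrow> same_sgn b b' \<Longrightarrow> same_sgn (a * b) (a' * b')"
  unfolding same_sgn_def by (auto simp: zero_less_mult_iff mult_less_0_iff)

lemma same_sgn_power: "same_sgn a a' \<Longrightarrow> same_sgn (a ^ n) (a' ^ n)"
  by (induction n) (auto intro: same_sgn_mult)

text \<open>Removes the power of a leading coefficient that pseudo-division introduces.\<close>

lemma same_sgn_mult_cancel:
  "same_sgn a a' \<Longrightarrow> a \<noteq> 0 \<Longrightarrow> same_sgn (a * b) (a' * b') \<Longrightarrow> same_sgn b b'"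
  unfolding same_sgn_def by (auto simp: zero_less_mult_iff mult_less_0_iff)

lemma same_sgn_cong: "same_sgn a b \<Longrightarrow> sgn a' = sgn a \<Longrightarrow> sgn b' = sgn b \<Longrightarrow> same_sgn a' b'"
  unfolding same_sgn_def by (metis sgn_less sgn_greater)

lemma same_sgn_trans1: "same_sgn a b \<Longrightarrow> same_sgn a' b \<Longrightarrow> sgn a = sgn a'"
  by (auto simp: same_sgn_def sgn_if)

text \<open>The nodes \<open>N\<close> cut the first line into points and open gaps, their images
  under a monotone \<open>f\<close> cut the second; z and w are matched when they lie in
  corresponding pieces.\<close>

definition matched :: "'k::linordered_field set \<Rightarrow> ('k \<Rightarrow> 'r::linordered_field) \<Rightarrow> 'k \<Rightarrow> 'r \<Rightarrow> bool" where
  "matched N f z w \<longleftrightarrow> (\<forall>x\<in>N. (z < x \<longleftrightarrow> w < f x) \<and> (x < z \<longleftrightarrow> f x < w))"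

text \<open>A sign table common to both fields. All points of a gap are matched with the same w, so
  every polynomial of the table has constant sign on each gap; a nonzero one can vanish only at
  nodes.\<close>

definition diagram ::
    "'k::linordered_field set \<Rightarrow> ('k \<Rightarrow> 'r::linordered_field) \<Rightarrow> ('k poly \<times> 'r poly) set \<Rightarrow> bool" where
  "diagram N f S \<longleftrightarrow> finite N \<and> strict_mono_on N f \<and>
     (\<forall>z w. matched N f z w \<longrightarrow> (\<forall>(p,q)\<in>S. same_sgn (poly p z) (poly q w)))"

lemma diagramD:
  "diagram N f S \<Longrightarrow> matched N f z w \<Longrightarrow> (p, q) \<in> S \<Longrightarrow> same_sgn (poly p z) (poly q w)"
  unfolding diagram_def by blast

lemma matched_self: "strict_mono_on N f \<Longrightarrow> x \<in> N \<Longrightarrow> matched N f x (f x)"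
  by (auto simp: matched_def strict_mono_on_less)

lemma matched_eqD: "matched N f z w \<Longrightarrow> z \<in> N \<Longrightarrow> w = f z"
  unfolding matched_def by (meson less_irrefl linorder_less_linear)

lemma matched_eqD': "matched N f z (f x) \<Longrightarrow> x \<in> N \<Longrightarrow> z = x"
  unfolding matched_def by (meson less_irrefl linorder_less_linear)

lemma finite_between:
  fixes A B :: "'k::linordered_field set"
  assumes "finite A" "finite B" "\<And>a b. a \<in> A \<Longrightarrow> b \<in> B \<Longrightarrow> a < b"
  shows "\<exists>w. (\<forall>a\<in>A. a < w) \<and> (\<forall>b\<in>B. w < b)"
proof -
  consider "A = {}" "B = {}" | "A = {}" "B \<noteq> {}" | "A \<noteq> {}" "B = {}" | "A \<noteq> {}" "B \<noteq> {}" by blast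
  then show ?thesis
  proof cases
    case 2
    then obtain w where "w < Min B" using lt_ex by blast
    then show ?thesis using 2 assms by (intro exI[of _ w]) auto
  next
    case 3
    then obtain w where "w > Max A" using gt_ex by blast
    then show ?thesis using 3 assms by (intro exI[of _ w]) auto
  next
    case 4
    then have "Max A < Min B" using assms by simp
    then obtain w where "Max A < w" "w < Min B" using dense by blast
    then show ?thesis using 4 assms by (intro exI[of _ w]) auto
  qed auto
qed

lemma matched_ex:
  fixes f :: "'k::linordered_field \<Rightarrow> 'r::linordered_field"
  assumes "finite N" "strict_mono_on N f"
  shows "\<exists>w. matched N f z w"
proof (cases "z \<in> N")
  case True
  then show ?thesis using matched_self assms by blast
next
  case False
  have "\<exists>w. (\<forall>a\<in>f ` {x\<in>N. x < z}. a < w) \<and> (\<forall>b\<in>f ` {x\<in>N. z < x}. w < b)"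
  proof (rule finite_between)
    fix a b assume "a \<in> f ` {x\<in>N. x < z}" "b \<in> f ` {x\<in>N. z < x}"
    then obtain x y where "x \<in> N" "y \<in> N" "x < z" "z < y" "a = f x" "b = f y" by blast
    then show "a < b" using strict_mono_onD[OF assms(2)] less_trans by metis
  qed (use assms(1) in simp_all)
  then obtain w where w: "\<forall>a\<in>f ` {x\<in>N. x < z}. a < w" "\<forall>b\<in>f ` {x\<in>N. z < x}. w < b"
    by (elim exE conjE)
  have "matched N f z w" unfolding matched_def
  proof
    fix x assume x: "x \<in> N"
    consider "x < z" | "z < x" using False x by (metis linorder_neqE)
    then show "(z < x \<longleftrightarrow> w < f x) \<and> (x < z \<longleftrightarrow> f x < w)"
    proof cases
      case 1
      then have "f x < w" using w x by blast
      then show ?thesis using 1 by auto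
    next
      case 2
      then have "w < f x" using w x by blast
      then show ?thesis using 2 by auto
    qed
  qed
  then show ?thesis by blast
qed

lemma strict_mono_on_inv_into:
  fixes f :: "'k::linorder \<Rightarrow> 'r::linorder"
  assumes "strict_mono_on N f"
  shows "strict_mono_on (f ` N) (inv_into N f)"
proof -
  have inj: "inj_on f N" using assms by (rule strict_mono_on_imp_inj_on)
  show ?thesis
    by (rule strict_mono_onI) (use assms inj in \<open>auto simp: strict_mono_on_less\<close>)
qed

lemma matched_inv:
  assumes "strict_mono_on N f"
  shows "matched (f ` N) (inv_into N f) w z \<longleftrightarrow> matched N f z w"
  using strict_mono_on_imp_inj_on[OF assms] by (auto simp: matched_def)

text \<open>The notion is symmetric in the two fields, which turns results on roots of the first
  polynomial into results on roots of the second.\<close>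

lemma diagram_inv:
  assumes "diagram N f S"
  shows "diagram (f ` N) (inv_into N f) (S\<inverse>)"
proof -
  have mono: "strict_mono_on N f" using assms by (simp add: diagram_def)
  have "same_sgn (poly p z) (poly q w)" if "matched (f ` N) (inv_into N f) z w" "(p, q) \<in> S\<inverse>" for z w p q
    using that diagramD[OF assms] unfolding matched_inv[OF mono] by (auto intro: same_sgn_sym)
  then show ?thesis
    using assms mono strict_mono_on_inv_into[OF mono] unfolding diagram_def by blast
qed

lemma diagram_sgn_const:
  assumes "diagram N f S" "(p, q) \<in> S" "matched N f z w" "matched N f z' w"
  shows "sgn (poly p z) = sgn (poly p z')"
  using same_sgn_trans1 diagramD[OF assms(1)] assms by metis

lemma matched_between:
  "matched N f x w \<Longrightarrow> matched N f y w \<Longrightarrow> x \<le> c \<Longrightarrow> c \<le> y \<Longrightarrow> matched N f c w"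
  unfolding matched_def by (meson le_less_trans less_le_trans)

text \<open>If the derivative vanished at x, it would vanish on an interval to the right of x, its
  sign being constant on the gap; it would be the zero polynomial, but p is not constant.\<close>

lemma gap_deriv_nonzero:
  fixes f :: "'k::linordered_field \<Rightarrow> 'r::linordered_field"
  assumes D: "diagram N f {(pderiv p, q')}" and deg: "degree p > 0" and w: "matched N f x w" and x: "x \<notin> N"
  shows "poly (pderiv p) x \<noteq> 0"
proof
  assume 0: "poly (pderiv p) x = 0"
  have "finite N" using D by (simp add: diagram_def)
  then have "\<exists>u. (\<forall>a\<in>{x}. a < u) \<and> (\<forall>b\<in>{y\<in>N. x < y}. u < b)"
    by (intro finite_between) auto
  then obtain u where "\<forall>a\<in>{x}. a < u" "\<forall>b\<in>{y\<in>N. x < y}. u < b" by (elim exE conjE)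
  then have u: "x < u" "\<And>y. y \<in> N \<Longrightarrow> x < y \<Longrightarrow> u < y"
    by simp_all
  have "poly (pderiv p) c = 0" if c: "c \<in> {x<..<u}" for c
  proof -
    have xc: "x < c" and cu: "c < u" using c by auto
    have "matched N f c w" unfolding matched_def
    proof
      fix y assume y: "y \<in> N"
      consider "x < y" | "y < x" using x y by (metis linorder_neqE)
      then show "(c < y \<longleftrightarrow> w < f y) \<and> (y < c \<longleftrightarrow> f y < w)"
      proof cases
        case 1
        have "c < y" by (rule less_trans[OF cu u(2)[OF y 1]])
        moreover have "w < f y" using w y 1 by (auto simp: matched_def)
        ultimately show ?thesis by (simp add: less_asym)
      next
        case 2
        then have "y < c" using xc by (rule less_trans)
        moreover have "f y < w" using w y 2 by (auto simp: matched_def)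
        ultimately show ?thesis by (simp add: less_asym)
      qed
    qed
    then show ?thesis using diagram_sgn_const[OF D _ _ w, of "pderiv p" q' c] 0 by (simp add: sgn_0_0)
  qed
  then have "{x<..<u} \<subseteq> {c. poly (pderiv p) c = 0}" by blast
  moreover have "infinite {x<..<u}" using u by (simp add: infinite_Ioo)
  ultimately have "pderiv p = 0" using poly_roots_finite finite_subset by blast
  then show False using deg by (simp add: pderiv_eq_0_iff)
qed

text \<open>On a gap the derivative has a constant nonzero sign, so p is strictly monotone
  there.\<close>

lemma gap_root_unique:
  fixes f :: "'k::linordered_field \<Rightarrow> 'r::linordered_field"
  assumes I: "ivt TYPE('k)" and D: "diagram N f {(pderiv p, q')}" and deg: "degree p > 0"
    and w: "matched N f x w" "matched N f y w" and x: "x \<notin> N" "y \<notin> N"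
    and 0: "poly p x = 0" "poly p y = 0"
  shows "x = y"
proof -
  have *: False if "x < y" "matched N f x w" "matched N f y w" "x \<notin> N" "poly p x = 0" "poly p y = 0" for x y
  proof -
    have "sgn (poly p y - poly p x) = sgn (poly (pderiv p) x)"
    proof (rule poly_mono_sgn[OF I that(1)])
      fix c assume "x < c" "c < y"
      then have "matched N f c w" using matched_between[OF that(2,3)] by simp
      then show "sgn (poly (pderiv p) c) = sgn (poly (pderiv p) x)"
        using diagram_sgn_const[OF D _ _ that(2)] by blast
    qed
    then show False using gap_deriv_nonzero[OF D deg that(2,4)] that by (simp add: sgn_0_0)
  qed
  show ?thesis using *[of x y] *[of y x] assms by (metis linorder_neqE)
qed

text \<open>Since p increases on the gap of x, it is negative at the left end of the gap and
  positive at the right end, or near infinity if the gap is unbounded. At nodes q shares these signs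
  by assumption, near infinity because of the leading coefficients. The intermediate value property
  puts a root of q into the corresponding gap.\<close>

lemma root_transfer_pos:
  fixes f :: "'k::linordered_field \<Rightarrow> 'r::linordered_field"
  assumes I: "ivt TYPE('k)" "ivt TYPE('r)"
    and D: "diagram N f {(pderiv p, pderiv q)}" and deg: "degree p = degree q"
    and lc: "same_sgn (lead_coeff p) (lead_coeff q)"
    and N: "\<And>x. x \<in> N \<Longrightarrow> same_sgn (poly p x) (poly q (f x))"
    and x: "poly p x = 0" "x \<notin> N" and pos: "poly (pderiv p) x > 0"
  shows "\<exists>s. matched N f x s \<and> poly q s = 0"
proof -
  have fin: "finite N" and mono: "strict_mono_on N f" using D by (auto simp: diagram_def)
  obtain w where w: "matched N f x w" using matched_ex[OF fin mono] by blast
  have same_side: "matched N f c w" if c: "\<And>z. z \<in> N \<Longrightarrow> z < x \<Longrightarrow> z < c" "\<And>z. z \<in> N \<Longrightarrow> x < z \<Longrightarrow> c < z" for c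
  proof -
    have "(c < z \<longleftrightarrow> x < z) \<and> (z < c \<longleftrightarrow> z < x)" if z: "z \<in> N" for z
    proof (cases z x rule: linorder_cases)
      case equal then show ?thesis using x(2) z by simp
    qed (use c[OF z] in \<open>auto dest: less_asym\<close>)
    then show ?thesis using w by (auto simp: matched_def)
  qed
  have gap: "sgn (poly (pderiv p) c) = 1" if "matched N f c w" for c
    using diagram_sgn_const[OF D _ w that] pos by (metis insertI1 sgn_pos)
  have below: "poly p y < 0" if "y < x" "\<And>c. y < c \<Longrightarrow> c < x \<Longrightarrow> matched N f c w" for y
  proof -
    have "sgn (poly p x - poly p y) = 1"
      by (rule poly_mono_sgn[OF I(1) that(1)]) (rule gap[OF that(2)])
    then show ?thesis using x(1) by (simp only: sgn_1_pos)
  qed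
  have above: "poly p y > 0" if "x < y" "\<And>c. x < c \<Longrightarrow> c < y \<Longrightarrow> matched N f c w" for y
  proof -
    have "sgn (poly p y - poly p x) = 1"
      by (rule poly_mono_sgn[OF I(1) that(1)]) (rule gap[OF that(2)])
    then show ?thesis using x(1) by (simp only: sgn_1_pos)
  qed
  \<comment> \<open>\<open>l\<close> is the image of the nearest node on the left or, if there is
    none, a point far out on the left.\<close>
  have lower: "\<exists>l<w. (\<forall>y\<in>N. y < x \<longrightarrow> f y \<le> l) \<and> poly q l < 0"
  proof (cases "{y\<in>N. y < x} = {}")
    case False
    define y where "y = Max {y\<in>N. y < x}"
    have y: "y \<in> N" "y < x" "\<And>y'. y' \<in> N \<Longrightarrow> y' < x \<Longrightarrow> y' \<le> y"
      using Max_in[OF _ False] fin by (auto simp: y_def)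
    have "matched N f c w" if c: "y < c" "c < x" for c
      by (rule same_side) (use y(3) c in \<open>auto intro: le_less_trans less_le_trans less_trans\<close>)
    then have "poly p y < 0" using below y by blast
    then have "poly q (f y) < 0" using N[OF y(1)] by (auto simp: same_sgn_def)
    moreover have "f y < w" using w y by (auto simp: matched_def)
    moreover have "f z \<le> f y" if "z \<in> N" "z < x" for z
      using y(3)[OF that] mono that y(1) by (metis le_less strict_mono_onD)
    ultimately show ?thesis by blast
  next
    case True
    have neg: "poly p y < 0" if "y < x" for y
    proof (rule below[OF that], rule same_side)
      fix c z assume "y < c" "c < x" "z \<in> N"
      then show "z < x \<Longrightarrow> z < c" "x < z \<Longrightarrow> c < z" using True by (auto intro: less_trans)
    qed
    obtain M where M: "\<And>y. y \<le> M \<Longrightarrow> sgn (poly p y) = sgn (lead_coeff p * (- 1) ^ degree p)"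
      using poly_sgn_at_bot by blast
    obtain y where "y < min M x" using lt_ex by blast
    then have "sgn (lead_coeff p * (- 1) ^ degree p) = -1" using M[of y] neg[of y] by simp
    moreover have "same_sgn (lead_coeff p * (- 1) ^ degree p) (lead_coeff q * (- 1) ^ degree q)"
      using same_sgn_mult[OF lc same_sgn_power[OF same_sgn_minus[OF same_sgn_1], of "degree p"]]
      by (simp only: deg)
    ultimately have "lead_coeff q * (- 1) ^ degree q < 0" by (auto simp: same_sgn_def sgn_1_neg)
    moreover obtain M' where M': "\<And>y. y \<le> M' \<Longrightarrow> sgn (poly q y) = sgn (lead_coeff q * (- 1) ^ degree q)"
      using poly_sgn_at_bot by blast
    moreover obtain l where "l < min M' w" using lt_ex by blast
    ultimately have "poly q l < 0" "l < w" by (metis less_imp_le min_less_iff_conj sgn_less)+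
    then show ?thesis using True by blast
  qed
  have upper: "\<exists>u>w. (\<forall>y\<in>N. x < y \<longrightarrow> u \<le> f y) \<and> poly q u > 0"
  proof (cases "{y\<in>N. x < y} = {}")
    case False
    define y where "y = Min {y\<in>N. x < y}"
    have y: "y \<in> N" "x < y" "\<And>y'. y' \<in> N \<Longrightarrow> x < y' \<Longrightarrow> y \<le> y'"
      using Min_in[OF _ False] fin by (auto simp: y_def)
    have "matched N f c w" if c: "x < c" "c < y" for c
      by (rule same_side) (use y(3) c in \<open>auto intro: le_less_trans less_le_trans less_trans\<close>)
    then have "poly p y > 0" using above y by blast
    then have "poly q (f y) > 0" using N[OF y(1)] by (auto simp: same_sgn_def)
    moreover have "w < f y" using w y by (auto simp: matched_def)
    moreover have "f y \<le> f z" if "z \<in> N" "x < z" for z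
      using y(3)[OF that] mono that y(1) by (metis le_less strict_mono_onD)
    ultimately show ?thesis by blast
  next
    case True
    have pos: "poly p y > 0" if "x < y" for y
    proof (rule above[OF that], rule same_side)
      fix c z assume "x < c" "c < y" "z \<in> N"
      then show "z < x \<Longrightarrow> z < c" "x < z \<Longrightarrow> c < z" using True by (auto intro: less_trans)
    qed
    obtain M where M: "\<And>y. y \<ge> M \<Longrightarrow> sgn (poly p y) = sgn (lead_coeff p)"
      using poly_sgn_at_top by blast
    obtain y where "y > max M x" using gt_ex by blast
    then have "sgn (lead_coeff p) = 1" using M[of y] pos[of y] by simp
    with lc have "lead_coeff q > 0" by (auto simp: same_sgn_def sgn_1_pos)
    moreover obtain M' where M': "\<And>y. y \<ge> M' \<Longrightarrow> sgn (poly q y) = sgn (lead_coeff q)"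
      using poly_sgn_at_top by blast
    moreover obtain u where "u > max M' w" using gt_ex by blast
    ultimately have "poly q u > 0" "u > w" by (metis less_imp_le max_less_iff_conj sgn_greater)+
    then show ?thesis using True by blast
  qed
  obtain l u where lu: "l < w" "\<forall>y\<in>N. y < x \<longrightarrow> f y \<le> l" "poly q l < 0"
      "w < u" "\<forall>y\<in>N. x < y \<longrightarrow> u \<le> f y" "poly q u > 0"
    using lower upper by blast
  then have "l < u" "poly q l * poly q u < 0" by (auto intro: mult_neg_pos)
  then obtain s where s: "l < s" "s < u" "poly q s = 0" using ivtD[OF I(2)] by blast
  have "matched N f x s" unfolding matched_def
  proof
    fix y assume y: "y \<in> N"
    consider "y < x" | "x < y" using x(2) y by (metis linorder_neqE)
    then show "(x < y \<longleftrightarrow> s < f y) \<and> (y < x \<longleftrightarrow> f y < s)"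
    proof cases
      case 1
      then have "f y < s" using lu(2) y s(1) by fastforce
      then show ?thesis using 1 by auto
    next
      case 2
      then have "s < f y" using lu(5) y s(2) by fastforce
      then show ?thesis using 2 by auto
    qed
  qed
  then show ?thesis using s by blast
qed

lemma root_transfer:
  fixes f :: "'k::linordered_field \<Rightarrow> 'r::linordered_field"
  assumes I: "ivt TYPE('k)" "ivt TYPE('r)"
    and D: "diagram N f {(pderiv p, pderiv q)}" and deg: "degree p = degree q" "degree p > 0"
    and lc: "same_sgn (lead_coeff p) (lead_coeff q)"
    and N: "\<And>x. x \<in> N \<Longrightarrow> same_sgn (poly p x) (poly q (f x))"
    and x: "poly p x = 0" "x \<notin> N"
  shows "\<exists>s. matched N f x s \<and> poly q s = 0"
proof -
  obtain w where "matched N f x w" using matched_ex D unfolding diagram_def by meson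
  then have "poly (pderiv p) x \<noteq> 0" using gap_deriv_nonzero[OF D deg(2)] x by blast
  then consider "poly (pderiv p) x > 0" | "poly (pderiv (- p)) x > 0"
    by (metis linorder_neqE neg_0_less_iff_less pderiv_minus poly_minus)
  then show ?thesis
  proof cases
    case 1
    show ?thesis by (rule root_transfer_pos[OF I D deg(1) lc N x 1])
  next
    case 2
    have D': "diagram N f {(pderiv (- p), pderiv (- q))}"
      using D by (auto simp: diagram_def pderiv_minus intro: same_sgn_minus)
    show ?thesis
      using root_transfer_pos[OF I D' _ _ _ _ x(2) 2] deg lc N x by (simp add: same_sgn_minus)
  qed
qed

lemma converse_singleton: "{(a, b)}\<inverse> = {(b, a)}"
  by auto

text \<open>\<open>root_transfer\<close> for the inverse diagram: no root of q is missed when new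
  nodes are made from the roots of p.\<close>

lemma roots_covered:
  fixes f :: "'k::linordered_field \<Rightarrow> 'r::linordered_field"
  assumes I: "ivt TYPE('k)" "ivt TYPE('r)"
    and D: "diagram N f {(pderiv p, pderiv q)}" and deg: "degree p = degree q" "degree p > 0"
    and lc: "same_sgn (lead_coeff p) (lead_coeff q)"
    and N: "\<And>x. x \<in> N \<Longrightarrow> same_sgn (poly p x) (poly q (f x))"
    and w: "poly q w = 0" "w \<notin> f ` N"
  shows "\<exists>x. matched N f x w \<and> poly p x = 0 \<and> x \<notin> N"
proof -
  have mono: "strict_mono_on N f" using D by (simp add: diagram_def)
  have inj: "inj_on f N" using mono by (rule strict_mono_on_imp_inj_on)
  have D': "diagram (f ` N) (inv_into N f) {(pderiv q, pderiv p)}"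
    using diagram_inv[OF D] by (simp only: converse_singleton)
  have "\<exists>x. matched (f ` N) (inv_into N f) w x \<and> poly p x = 0"
  proof (rule root_transfer[OF I(2,1) D'])
    show "degree q = degree p" "degree q > 0" using deg by simp_all
    show "same_sgn (lead_coeff q) (lead_coeff p)" using lc by (rule same_sgn_sym)
    show "same_sgn (poly q y) (poly p (inv_into N f y))" if "y \<in> f ` N" for y
      using that N inj by (auto intro: same_sgn_sym)
  qed (use w in simp_all)
  then obtain x where x: "matched N f x w" "poly p x = 0" unfolding matched_inv[OF mono] by blast
  moreover have "x \<notin> N" using matched_eqD[OF x(1)] w(2) by blast
  ultimately show ?thesis by blast
qed

text \<open>The roots of p become nodes. An old gap holds at most one root of p and one of q, and
  holds the one exactly when the corresponding gap holds the other, so the node map extends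
  monotonically. On a new gap p has the sign of its value at the left end or, if that is zero, the
  sign of p'; on the leftmost gap it has its sign near minus infinity.\<close>

lemma diagram_step:
  fixes f :: "'k::linordered_field \<Rightarrow> 'r::linordered_field"
  assumes I: "ivt TYPE('k)" "ivt TYPE('r)"
    and D: "diagram N f S" and der: "(pderiv p, pderiv q) \<in> S"
    and deg: "degree p = degree q" "degree p > 0"
    and lc: "same_sgn (lead_coeff p) (lead_coeff q)"
    and N: "\<And>x. x \<in> N \<Longrightarrow> same_sgn (poly p x) (poly q (f x))"
  shows "\<exists>f'. diagram (N \<union> {x. poly p x = 0}) f' (insert (p, q) S)"
proof -
  have fin: "finite N" and mono: "strict_mono_on N f" using D by (auto simp: diagram_def)
  have D1: "diagram N f {(pderiv p, pderiv q)}" using D der unfolding diagram_def by blast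
  have p0: "p \<noteq> 0" "q \<noteq> 0" using deg by auto
  define N' where "N' = N \<union> {x. poly p x = 0}"
  have fin': "finite N'" using fin poly_roots_finite[OF p0(1)] by (simp add: N'_def)
  have "\<exists>s. matched N f x s \<and> poly q s = 0" if "poly p x = 0" "x \<notin> N" for x
    by (rule root_transfer[OF I D1 deg lc N that])
  then obtain g where g: "\<And>x. poly p x = 0 \<Longrightarrow> x \<notin> N \<Longrightarrow> matched N f x (g x) \<and> poly q (g x) = 0"
    by metis
  define f' where "f' x = (if x \<in> N then f x else g x)" for x
  have f'N: "f' x = f x" if "x \<in> N" for x using that by (simp add: f'_def)
  have f'm: "matched N f x (f' x)" if "x \<in> N'" for x
    using that g matched_self[OF mono] by (auto simp: f'_def N'_def)
  have f'0: "poly q (f' x) = 0" if "poly p x = 0" for x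
    using that g N[of x] same_sgn_zero by (auto simp: f'_def)
  have gap_unique: "x = y" if "matched N f x w" "matched N f y w" "x \<notin> N" "y \<notin> N" "poly p x = 0" "poly p y = 0" for x y w
    using gap_root_unique[OF I(1) D1 deg(2) that] .
  have mono': "strict_mono_on N' f'"
  proof (rule strict_mono_onI)
    fix x y assume xy: "x \<in> N'" "y \<in> N'" "x < y"
    show "f' x < f' y"
    proof (cases "x \<in> N \<or> y \<in> N")
      case True
      then show ?thesis
      proof
        assume "x \<in> N"
        then show ?thesis using f'm[OF xy(2)] xy(3) f'N by (auto simp: matched_def)
      next
        assume "y \<in> N"
        then show ?thesis using f'm[OF xy(1)] xy(3) f'N by (auto simp: matched_def)
      qed
    next
      case False
      then have 0: "x \<notin> N" "y \<notin> N" "poly p x = 0" "poly p y = 0" using xy by (auto simp: N'_def)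
      \<comment> \<open>Two roots of p cannot share a gap, so an old node separates \<open>x\<close>
        and \<open>y\<close>, and its image separates their images.\<close>
      have "\<exists>c\<in>N. x < c \<and> c < y"
      proof (rule ccontr)
        assume none: "\<not> ?thesis"
        have "matched N f y (f' x)" unfolding matched_def
        proof
          fix c assume c: "c \<in> N"
          then have cc: "c < x \<or> y < c" using none 0 by (metis linorder_neqE)
          have m: "(x < c \<longleftrightarrow> f' x < f c) \<and> (c < x \<longleftrightarrow> f c < f' x)"
            using f'm[OF xy(1)] c unfolding matched_def by blast
          from cc show "(y < c \<longleftrightarrow> f' x < f c) \<and> (c < y \<longleftrightarrow> f c < f' x)"
          proof
            assume 1: "c < x"
            then have "c < y" using xy(3) by (rule less_trans)
            then show ?thesis using 1 m by (metis less_asym)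
          next
            assume 1: "y < c"
            with xy(3) have "x < c" by (rule less_trans)
            then show ?thesis using 1 m by (metis less_asym)
          qed
        qed
        then have "x = y" using gap_unique[OF f'm[OF xy(1)]] 0 by blast
        then show False using xy(3) by simp
      qed
      then obtain c where c: "c \<in> N" "x < c" "c < y" by blast
      then have "f' x < f c" "f c < f' y" using f'm xy unfolding matched_def by blast+
      then show ?thesis by (rule less_trans)
    qed
  qed
  \<comment> \<open>Every root of q is the image of a node, so q keeps its sign on the new
    gaps.\<close>
  have qroot: "w \<in> f' ` N'" if w: "poly q w = 0" for w
  proof (cases "w \<in> f ` N")
    case True
    then obtain x where "x \<in> N" "w = f' x" using f'N by auto
    then show ?thesis by (simp add: N'_def)
  next
    case False
    obtain x where x: "matched N f x w" "poly p x = 0" "x \<notin> N"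
      using roots_covered[OF I D1 deg lc N w False] by blast
    have xN': "x \<in> N'" using x by (simp add: N'_def)
    have D1': "diagram (f ` N) (inv_into N f) {(pderiv q, pderiv p)}"
      using diagram_inv[OF D1] by (simp only: converse_singleton)
    have "f' x \<notin> f ` N"
    proof
      assume "f' x \<in> f ` N"
      then obtain y where y: "y \<in> N" "f' x = f y" by auto
      then have "matched N f x (f y)" using f'm[OF xN'] by simp
      then show False using matched_eqD'[OF _ y(1)] y(1) x(3) by blast
    qed
    moreover have "matched (f ` N) (inv_into N f) w x" "matched (f ` N) (inv_into N f) (f' x) x"
      by (simp_all only: matched_inv[OF mono] x(1) f'm[OF xN'])
    ultimately have "w = f' x"
      using gap_root_unique[OF I(2) D1', of w x "f' x"] deg w False f'0[OF x(2)] by simp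
    then show ?thesis using xN' by blast
  qed
  have mm: "matched N f z w" if "matched N' f' z w" for z w
    using that f'N unfolding matched_def N'_def by auto
  have key: "same_sgn (poly p z) (poly q w)" if m: "matched N' f' z w" for z w
  proof (cases "z \<in> N'")
    case True
    then have w: "w = f' z" using matched_eqD[OF m] by blast
    show ?thesis
    proof (cases "z \<in> N")
      case True
      then show ?thesis using N[OF True] w f'N by simp
    next
      case False
      then have "poly p z = 0" using True by (simp add: N'_def)
      then show ?thesis using f'0 w by simp
    qed
  next
    case z: False
    have w: "w \<notin> f' ` N'"
    proof
      assume "w \<in> f' ` N'"
      then obtain y where y: "y \<in> N'" "w = f' y" by auto
      then have "matched N' f' z (f' y)" using m by simp
      then show False using matched_eqD'[OF _ y(1)] y(1) z by blast
    qed
    have der_sgn: "same_sgn (poly (pderiv p) c) (poly (pderiv q) d)" if "matched N' f' c d" for c d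
      using diagramD[OF D mm[OF that] der] .
    show ?thesis
    proof (cases "{x\<in>N'. x < z} = {}")
      case True
      have nz: "poly p y \<noteq> 0" if "y \<le> z" for y
        using True z that by (auto simp: N'_def)
      have nw: "poly q y \<noteq> 0" if "y \<le> w" for y
      proof
        assume "poly q y = 0"
        then obtain x where x: "x \<in> N'" "y = f' x" using qroot by blast
        then have "f' x < w" using that w by (metis image_eqI le_less)
        then have "x < z" using m x unfolding matched_def by blast
        then show False using True x by blast
      qed
      obtain M where M: "\<And>y. y \<le> M \<Longrightarrow> sgn (poly p y) = sgn (lead_coeff p * (- 1) ^ degree p)"
        using poly_sgn_at_bot by blast
      obtain M' where M': "\<And>y. y \<le> M' \<Longrightarrow> sgn (poly q y) = sgn (lead_coeff q * (- 1) ^ degree q)"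
        using poly_sgn_at_bot by blast
      have "sgn (poly p (min M z)) = sgn (poly p z)"
        by (rule poly_const_sgn[OF I(1)]) (use nz in auto)
      moreover have "sgn (poly q (min M' w)) = sgn (poly q w)"
        by (rule poly_const_sgn[OF I(2)]) (use nw in auto)
      moreover have "same_sgn (lead_coeff p * (- 1) ^ degree p) (lead_coeff q * (- 1) ^ degree q)"
        using same_sgn_mult[OF lc same_sgn_power[OF same_sgn_minus[OF same_sgn_1], of "degree p"]]
        by (simp only: deg)
      ultimately show ?thesis
        using M[of "min M z"] M'[of "min M' w"] by (metis same_sgn_cong min.cobounded1)
    next
      case False
      define x where "x = Max {x\<in>N'. x < z}"
      have x: "x \<in> N'" "x < z" "\<And>y. y \<in> N' \<Longrightarrow> y < z \<Longrightarrow> y \<le> x"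
        using Max_in[OF _ False] fin' by (auto simp: x_def)
      have fx: "f' x < w" using m x unfolding matched_def by blast
      have gapz: "matched N' f' c w" if c: "x < c" "c \<le> z" for c
        unfolding matched_def
      proof
        fix y assume y: "y \<in> N'"
        have my: "(z < y \<longleftrightarrow> w < f' y) \<and> (y < z \<longleftrightarrow> f' y < w)" using m y unfolding matched_def by blast
        consider "y < z" | "z < y" using z y by (metis linorder_neqE)
        then show "(c < y \<longleftrightarrow> w < f' y) \<and> (y < c \<longleftrightarrow> f' y < w)"
        proof cases
          case 1
          then have "y < c" using x(3)[OF y] c(1) by (metis le_less_trans)
          then show ?thesis using my 1 by (metis less_asym)
        next
          case 2
          then have "c < y" using c(2) by (metis le_less_trans)
          then show ?thesis using my 2 by (metis less_asym)
        qed
      qed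
      have gapw: "matched N' f' z d" if d: "f' x < d" "d \<le> w" for d
        unfolding matched_def
      proof
        fix y assume y: "y \<in> N'"
        have my: "(z < y \<longleftrightarrow> w < f' y) \<and> (y < z \<longleftrightarrow> f' y < w)" using m y unfolding matched_def by blast
        consider "y < z" | "z < y" using z y by (metis linorder_neqE)
        then show "(z < y \<longleftrightarrow> d < f' y) \<and> (y < z \<longleftrightarrow> f' y < d)"
        proof cases
          case 1
          then have "f' y \<le> f' x" using x(3)[OF y 1] x(1) y mono' by (metis le_less strict_mono_onD)
          then have "f' y < d" using d(1) by (metis le_less_trans)
          then show ?thesis using 1 by (metis less_asym)
        next
          case 2
          then have "d < f' y" using my d(2) by (metis le_less_trans)
          then show ?thesis using 2 by (metis less_asym)
        qed
      qed
      show ?thesis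
      \<comment> \<open>\<open>x\<close> is the left end of the gap of \<open>z\<close>. If p
        vanishes there, so does q at \<open>f' x\<close>, and both take the signs of their
        derivatives on the gap.\<close>
      proof (cases "poly p x = 0")
        case True
        have "sgn (poly p z - poly p x) = sgn (poly (pderiv p) z)"
        proof (rule poly_mono_sgn[OF I(1) x(2)])
          fix c assume "x < c" "c < z"
          then have "matched N' f' c w" by (intro gapz) auto
          then show "sgn (poly (pderiv p) c) = sgn (poly (pderiv p) z)"
            using same_sgn_trans1 der_sgn m by metis
        qed
        then have 1: "sgn (poly p z) = sgn (poly (pderiv p) z)" using True by simp
        have "sgn (poly q w - poly q (f' x)) = sgn (poly (pderiv q) w)"
        proof (rule poly_mono_sgn[OF I(2) fx])
          fix d assume "f' x < d" "d < w"
          then have "matched N' f' z d" by (intro gapw) auto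
          then show "sgn (poly (pderiv q) d) = sgn (poly (pderiv q) w)"
            using same_sgn_trans1 same_sgn_sym der_sgn m by metis
        qed
        then have 2: "sgn (poly q w) = sgn (poly (pderiv q) w)" using f'0[OF True] by simp
        show ?thesis by (rule same_sgn_cong[OF der_sgn[OF m] 1 2])
      next
        case False
        then have xN: "x \<in> N" using x(1) by (simp add: N'_def)
        have ss: "same_sgn (poly p x) (poly q (f' x))" using N[OF xN] f'N[OF xN] by simp
        have "sgn (poly p x) = sgn (poly p z)"
        proof (rule poly_const_sgn[OF I(1)])
          fix c assume c: "x \<le> c" "c \<le> z"
          show "poly p c \<noteq> 0"
          proof
            assume 0: "poly p c = 0"
            then have cN: "c \<in> N'" "c \<noteq> x" using False by (auto simp: N'_def)
            then have "c < z" using c(2) z by (metis le_less)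
            then have "c \<le> x" using x(3) cN by blast
            then show False using c(1) cN by simp
          qed
        qed (use x in simp)
        moreover have "sgn (poly q (f' x)) = sgn (poly q w)"
        proof (rule poly_const_sgn[OF I(2)])
          fix c assume c: "f' x \<le> c" "c \<le> w"
          show "poly q c \<noteq> 0"
          proof
            assume 0: "poly q c = 0"
            then obtain y where y: "y \<in> N'" "c = f' y" using qroot by blast
            have "c \<noteq> f' x" using 0 ss False same_sgn_zero by metis
            then have "f' x < f' y" using c(1) y by (metis le_less)
            then have "x < y" using y(1) x(1) mono' by (metis strict_mono_on_less)
            moreover have "f' y < w" using c(2) y w by (metis image_eqI le_less)
            then have "y < z" using m y(1) unfolding matched_def by blast
            ultimately show False using x(3)[OF y(1)] by (metis not_less)
          qed
        qed (use fx in simp)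
        ultimately show ?thesis using ss by (metis same_sgn_cong)
      qed
    qed
  qed
  have "diagram N' f' (insert (p, q) S)"
    unfolding diagram_def using fin' mono' key diagramD[OF D mm] by blast
  then show ?thesis unfolding N'_def by blast
qed

subsection \<open>Closed families of polynomials\<close>

text \<open>Takes the place of p when an evaluation sends the leading coefficient to zero.\<close>

definition trunc_poly :: "'a::comm_ring_1 poly \<Rightarrow> 'a poly" where
  "trunc_poly p = p - monom (lead_coeff p) (degree p)"

lemma degree_trunc_poly: "degree p > 0 \<Longrightarrow> degree (trunc_poly p) < degree p"
proof -
  assume d: "degree p > 0"
  have "degree (trunc_poly p) \<le> degree p - 1"
  proof (rule degree_le, intro allI impI)
    fix i assume i: "i > degree p - 1"
    then have "i = degree p \<or> i > degree p" using d by linarith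
    then show "coeff (trunc_poly p) i = 0"
      by (auto simp: trunc_poly_def coeff_eq_0 coeff_monom)
  qed
  then show ?thesis using d by simp
qed

text \<open>The polynomials on which a diagram for q and p relies: the derivative governs the growth
  of q on gaps, the truncation replaces q if its leading coefficient vanishes, and at a root of q
  the pseudo-remainder is p up to a power of the leading coefficient of q.\<close>

definition reducts :: "'a::idom poly \<Rightarrow> 'a poly \<Rightarrow> 'a poly set" where
  "reducts p q = {pderiv q, trunc_poly q, pseudo_mod p q}"

definition reduct_closed :: "'a::idom poly set \<Rightarrow> bool" where
  "reduct_closed C \<longleftrightarrow> (\<forall>p\<in>C. \<forall>q\<in>C. 0 < degree q \<and> degree q \<le> degree p \<longrightarrow> reducts p q \<subseteq> C)"

lemma degree_reducts:
  fixes p q :: "'a::{idom,ring_char_0} poly"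
  assumes "r \<in> reducts p q" "0 < degree q"
  shows "degree r < degree q"
proof -
  have "degree (pderiv q) < degree q" using assms(2) by (simp add: degree_pderiv)
  moreover have "degree (pseudo_mod p q) < degree q"
    using pseudo_mod(2)[of q p] assms(2) by (metis degree_0 not_gr_zero)
  ultimately show ?thesis using assms degree_trunc_poly[of q] by (auto simp: reducts_def)
qed

text \<open>All reducts have smaller degree than the divisor q. If the divisors are treated in order
  of decreasing degree, no new divisor of a settled degree appears, and the condition degree q \<le>
  degree p keeps new polynomials from becoming dividends of earlier divisors. With degrees up to n,
  n + 1 rounds suffice.\<close>

lemma reduct_closure:
  fixes P :: "'a::{idom,ring_char_0} poly set"
  assumes "finite P"
  shows "\<exists>C. finite C \<and> P \<subseteq> C \<and> reduct_closed C"
proof -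
  obtain n where n: "\<And>p. p \<in> P \<Longrightarrow> degree p \<le> n"
    using assms finite_nat_set_iff_bounded_le[of "degree ` P"] by auto
  \<comment> \<open>After k rounds the divisors of degree above n - k are settled; the sum form
    avoids truncated subtraction.\<close>
  have "\<exists>C. finite C \<and> P \<subseteq> C \<and> (\<forall>p\<in>C. degree p \<le> n) \<and> (\<forall>p\<in>C. \<forall>q\<in>C. n < degree q + k \<and> 0 < degree q \<and> degree q \<le> degree p \<longrightarrow> reducts p q \<subseteq> C)" for k
  proof (induction k)
    case 0
    have "\<forall>p\<in>P. \<forall>q\<in>P. n < degree q + 0 \<and> 0 < degree q \<and> degree q \<le> degree p \<longrightarrow> reducts p q \<subseteq> P"
      using n by (metis add_0_right not_less)
    then show ?case using assms n by blast
  next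
    case (Suc k)
    then obtain C where C: "finite C" "P \<subseteq> C" "\<And>p. p \<in> C \<Longrightarrow> degree p \<le> n"
      "\<And>p q. p \<in> C \<Longrightarrow> q \<in> C \<Longrightarrow> n < degree q + k \<Longrightarrow> 0 < degree q \<Longrightarrow> degree q \<le> degree p \<Longrightarrow> reducts p q \<subseteq> C"
      by blast
    define E where "E = {(p,q) \<in> C \<times> C. degree q + k = n \<and> 0 < degree q \<and> degree q \<le> degree p}"
    define C' where "C' = C \<union> (\<Union>(p,q)\<in>E. reducts p q)"
    have finE: "finite E" unfolding E_def using C(1) by (auto intro: finite_subset[of _ "C \<times> C"])
    have new: "degree r + k < n" if r: "r \<in> C'" "r \<notin> C" for r
    proof -
      obtain p q where "(p, q) \<in> E" "r \<in> reducts p q" using r by (auto simp: C'_def)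
      then show ?thesis using degree_reducts[of r p q] by (auto simp: E_def)
    qed
    have "finite C'" unfolding C'_def using C(1) finE by (auto simp: reducts_def)
    moreover have "P \<subseteq> C'" using C by (auto simp: C'_def)
    moreover have "degree p \<le> n" if "p \<in> C'" for p using new[OF that] C(3)[of p] by (cases "p \<in> C") auto
    moreover have "reducts p q \<subseteq> C'"
      if pq: "p \<in> C'" "q \<in> C'" "n < degree q + Suc k" "0 < degree q" "degree q \<le> degree p" for p q
    proof -
      have "q \<in> C" using new[OF pq(2)] pq(3) by (cases "q \<in> C") auto
      moreover have "p \<in> C" using new[OF pq(1)] pq(3,5) by (cases "p \<in> C") auto
      ultimately show ?thesis
        using C(4)[of p q] pq unfolding C'_def E_def by (cases "n < degree q + k") auto
    qed
    ultimately show ?case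
      by (intro exI[of _ C'] conjI ballI impI) (assumption | (elim conjE, blast) | blast)+
  qed
  from this[of "Suc n"] obtain C where "finite C" "P \<subseteq> C"
    "\<forall>p\<in>C. \<forall>q\<in>C. n < degree q + Suc n \<and> 0 < degree q \<and> degree q \<le> degree p \<longrightarrow> reducts p q \<subseteq> C"
    by blast
  moreover from this(3) have "reduct_closed C" unfolding reduct_closed_def by simp
  ultimately show ?thesis by blast
qed

text \<open>Two evaluations of the coefficients, typically at a point over \<open>K\<close> and at a
  real point, that give the leading coefficients of a closed family the same signs.\<close>

locale hom_pair =
  fixes h :: "'a::{idom,ring_char_0} \<Rightarrow> 'k::linordered_field" and h' :: "'a \<Rightarrow> 'r::linordered_field"
    and C :: "'a poly set"
  assumes hom: "cring_hom h" "cring_hom h'"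
    and I: "ivt TYPE('k)" "ivt TYPE('r)"
    and fin: "finite C" and closed: "reduct_closed C"
    and lc: "p \<in> C \<Longrightarrow> same_sgn (h (lead_coeff p)) (h' (lead_coeff p))"
begin

sublocale h: cring_hom h by (rule hom)
sublocale h': cring_hom h' by (rule hom)

abbreviation im where "im p \<equiv> (map_poly h p, map_poly h' p)"

text \<open>For these polynomials degree and leading coefficient survive both evaluations.\<close>

definition regular :: "'a poly set" where
  "regular = {p \<in> C. h (lead_coeff p) \<noteq> 0}"

lemma regularD:
  assumes "p \<in> regular"
  shows "degree (map_poly h p) = degree p" "degree (map_poly h' p) = degree p"
    "lead_coeff (map_poly h p) = h (lead_coeff p)" "lead_coeff (map_poly h' p) = h' (lead_coeff p)"
proof -
  have "h (lead_coeff p) \<noteq> 0" using assms by (simp add: regular_def)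
  moreover have "h' (lead_coeff p) \<noteq> 0"
    using assms same_sgn_zero[OF lc[of p]] by (simp add: regular_def)
  ultimately show "degree (map_poly h p) = degree p" "degree (map_poly h' p) = degree p"
    using h.degree_map_le[of p] h'.degree_map_le[of p] by (metis h.coeff_map h'.coeff_map le_degree le_antisym)+
  then show "lead_coeff (map_poly h p) = h (lead_coeff p)" "lead_coeff (map_poly h' p) = h' (lead_coeff p)"
    by simp_all
qed

text \<open>Truncation leaves the evaluated polynomials unchanged as long as the leading coefficient
  evaluates to zero, which happens on both sides at once.\<close>

lemma regular_or_const:
  "p \<in> C \<Longrightarrow> \<exists>r\<in>C. im p = im r \<and> degree r \<le> degree p \<and> (r \<in> regular \<or> degree r = 0)"
proof (induction "degree p" arbitrary: p rule: less_induct)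
  case less
  show ?case
  proof (cases "p \<in> regular \<or> degree p = 0")
    case True
    then show ?thesis using less.prems by auto
  next
    case False
    then have 0: "h (lead_coeff p) = 0" "h' (lead_coeff p) = 0" "degree p > 0"
      using less.prems same_sgn_zero[OF lc[OF less.prems]] by (auto simp: regular_def)
    have t: "trunc_poly p \<in> C" using closed less.prems 0 by (auto simp: reduct_closed_def reducts_def)
    have "im (trunc_poly p) = im p"
      using 0 by (auto simp: poly_eq_iff trunc_poly_def coeff_monom h.diff h'.diff)
    then show ?thesis using less.hyps[OF degree_trunc_poly[OF 0(3)] t] degree_trunc_poly[OF 0(3)]
      by (metis le_trans less_imp_le)
  qed
qed

lemma const_same_sgn:
  assumes "p \<in> C" "degree p = 0"
  shows "same_sgn (poly (map_poly h p) z) (poly (map_poly h' p) w)"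
proof -
  obtain c where "p = [:c:]" using assms(2) by (auto elim: degree_eq_zeroE)
  then show ?thesis using lc[OF assms(1)] by (simp add: h.map_poly_pCons h'.map_poly_pCons)
qed

text \<open>A node x is a root of some q in the table whose degree is at most that of p.
  Pseudo-division by q turns p(x), times a power of the leading coefficient of q, into the value at
  x of a polynomial of lower degree, whose sign is already known on both sides.\<close>

lemma diagram_insert:
  assumes D: "diagram N f (im ` A)" and A: "A \<subseteq> regular" and d: "\<And>q. q \<in> regular \<Longrightarrow> degree q < degree p \<Longrightarrow> q \<in> A"
    and deg: "\<And>q. q \<in> A \<Longrightarrow> degree q \<le> degree p"
    and N: "\<And>x. x \<in> N \<Longrightarrow> \<exists>q\<in>A. 0 < degree q \<and> poly (map_poly h q) x = 0"
    and p: "p \<in> regular" "degree p > 0"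
  shows "\<exists>N f. diagram N f (im ` insert p A) \<and> (\<forall>x\<in>N. \<exists>q\<in>insert p A. 0 < degree q \<and> poly (map_poly h q) x = 0)"
proof -
  have mono: "strict_mono_on N f" using D by (simp add: diagram_def)
  have pC: "p \<in> C" "h (lead_coeff p) \<noteq> 0" using p by (auto simp: regular_def)
  have dp: "pderiv p \<in> C" using closed pC p(2) by (auto simp: reduct_closed_def reducts_def)
  have "lead_coeff (pderiv p) = of_nat (degree p) * lead_coeff p"
    using p(2) by (simp add: coeff_pderiv degree_pderiv)
  then have "h (lead_coeff (pderiv p)) = of_nat (degree p) * h (lead_coeff p)"
    by (simp only: h.mult h.of_nat)
  then have "pderiv p \<in> regular" using dp pC(2) p(2) by (simp add: regular_def)
  then have dA: "pderiv p \<in> A" using d p(2) by (simp add: degree_pderiv)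
  have low: "same_sgn (poly (map_poly h r) x) (poly (map_poly h' r) (f x))"
    if "r \<in> C" "degree r < degree p" "x \<in> N" for r x
  proof -
    obtain s where s: "s \<in> C" "im r = im s" "degree s \<le> degree r" "s \<in> regular \<or> degree s = 0"
      using regular_or_const[OF \<open>r \<in> C\<close>] by blast
    have "same_sgn (poly (map_poly h s) x) (poly (map_poly h' s) (f x))"
    proof (cases "degree s = 0")
      case True
      then show ?thesis using const_same_sgn s(1) by blast
    next
      case False
      then have "s \<in> A" using d s that by auto
      then show ?thesis using diagramD[OF D matched_self[OF mono that(3)]] by blast
    qed
    then show ?thesis using s(2) by simp
  qed
  have at_nodes: "same_sgn (poly (map_poly h p) x) (poly (map_poly h' p) (f x))" if x: "x \<in> N" for x
  proof -
    obtain q where q: "q \<in> A" "0 < degree q" "poly (map_poly h q) x = 0" using N[OF x] by blast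
    have qC: "q \<in> C" "h (lead_coeff q) \<noteq> 0" using q A by (auto simp: regular_def)
    have q': "poly (map_poly h' q) (f x) = 0"
      using same_sgn_zero[OF diagramD[OF D matched_self[OF mono x]], of "map_poly h q" "map_poly h' q"] q by blast
    define r where "r = pseudo_mod p q"
    define e where "e = Suc (degree p) - degree q"
    have q0: "q \<noteq> 0" using q(2) by auto
    obtain s where s: "smult (coeff q (degree q) ^ e) p = q * s + r"
      using pseudo_divmod(1)[OF q0, of p "fst (pseudo_divmod p q)" r]
      by (auto simp: r_def e_def pseudo_mod_def)
    have rC: "r \<in> C" using closed qC pC deg[OF q(1)] q(2) unfolding r_def reduct_closed_def reducts_def by blast
    have "degree r < degree q"
      using degree_reducts[of r p q] q(2) by (simp add: reducts_def r_def)
    then have rs: "same_sgn (poly (map_poly h r) x) (poly (map_poly h' r) (f x))"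
      using low[OF rC _ x] deg[OF q(1)] by simp
    have "h (lead_coeff q) ^ e * poly (map_poly h p) x = poly (map_poly h r) x"
      using arg_cong[OF s, of "\<lambda>u. poly (map_poly h u) x"] q(3)
      by (simp add: h.map_poly_smult h.map_poly_add h.map_poly_mult h.power)
    moreover have "h' (lead_coeff q) ^ e * poly (map_poly h' p) (f x) = poly (map_poly h' r) (f x)"
      using arg_cong[OF s, of "\<lambda>u. poly (map_poly h' u) (f x)"] q'
      by (simp add: h'.map_poly_smult h'.map_poly_add h'.map_poly_mult h'.power)
    ultimately have "same_sgn (h (lead_coeff q) ^ e * poly (map_poly h p) x)
        (h' (lead_coeff q) ^ e * poly (map_poly h' p) (f x))" using rs by simp
    then show ?thesis
      by (rule same_sgn_mult_cancel[OF same_sgn_power[OF lc[OF qC(1)]], rotated]) (use qC in simp)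
  qed
  have "\<exists>f'. diagram (N \<union> {x. poly (map_poly h p) x = 0}) f' (insert (im p) (im ` A))"
  proof (rule diagram_step[OF I D _ _ _ _ at_nodes])
    show "(pderiv (map_poly h p), pderiv (map_poly h' p)) \<in> im ` A"
      using dA by (auto simp: cring_hom_pderiv[OF hom(1), symmetric] cring_hom_pderiv[OF hom(2), symmetric])
  qed (use regularD[OF p(1)] p(2) lc[OF pC(1)] in simp_all)
  then obtain f' where "diagram (N \<union> {x. poly (map_poly h p) x = 0}) f' (im ` insert p A)" by auto
  moreover have "\<forall>x\<in>N \<union> {x. poly (map_poly h p) x = 0}. \<exists>q\<in>insert p A. 0 < degree q \<and> poly (map_poly h q) x = 0"
    using N p(2) by blast
  ultimately show ?thesis by blast
qed

text \<open>The degree grows in the outer induction, and polynomials of equal degree enter one by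
  one. That every node is a root of a nonconstant member of the table is carried along, because
  pseudo-division needs a divisor at each node.\<close>

lemma diagram_regular_upto:
  "\<exists>N f. diagram N f (im ` {p\<in>regular. degree p \<le> d}) \<and>
     (\<forall>x\<in>N. \<exists>q\<in>{p\<in>regular. degree p \<le> d}. 0 < degree q \<and> poly (map_poly h q) x = 0)"
proof (induction d)
  case 0
  have "diagram {} (\<lambda>_. 0) (im ` {p\<in>regular. degree p \<le> 0})"
    unfolding diagram_def using const_same_sgn by (auto simp: regular_def strict_mono_on_def)
  then show ?case by blast
next
  case (Suc d)
  let ?L = "{p\<in>regular. degree p \<le> d}" and ?E = "{p\<in>regular. degree p = Suc d}"
  have "finite ?E" using fin by (auto simp: regular_def)
  have "\<exists>N f. diagram N f (im ` (?L \<union> B)) \<and> (\<forall>x\<in>N. \<exists>q\<in>?L \<union> B. 0 < degree q \<and> poly (map_poly h q) x = 0)"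
    if "finite B" "B \<subseteq> ?E" for B
    using that
  proof (induction B)
    case empty
    then show ?case using Suc by simp
  next
    case (insert p B)
    then obtain N f where Nf: "diagram N f (im ` (?L \<union> B))"
        "\<forall>x\<in>N. \<exists>q\<in>?L \<union> B. 0 < degree q \<and> poly (map_poly h q) x = 0" by auto
    have "\<exists>N f. diagram N f (im ` insert p (?L \<union> B)) \<and>
        (\<forall>x\<in>N. \<exists>q\<in>insert p (?L \<union> B). 0 < degree q \<and> poly (map_poly h q) x = 0)"
      by (rule diagram_insert[OF Nf(1)]) (use insert.prems Nf(2) in auto)
    then show ?case by simp
  qed
  from this[OF \<open>finite ?E\<close> order.refl] show ?case
  proof -
    have "?L \<union> ?E = {p\<in>regular. degree p \<le> Suc d}" by auto
    then show ?thesis using \<open>\<exists>N f. diagram N f (im ` (?L \<union> ?E)) \<and> _\<close> by simp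
  qed
qed

theorem diagram_ex: "\<exists>N f. diagram N f (im ` C)"
proof -
  obtain d where d: "\<And>p. p \<in> C \<Longrightarrow> degree p \<le> d"
    using fin finite_nat_set_iff_bounded_le[of "degree ` C"] by auto
  obtain N f where Nf: "diagram N f (im ` {p\<in>regular. degree p \<le> d})"
    using diagram_regular_upto by blast
  have "same_sgn (poly (map_poly h p) z) (poly (map_poly h' p) w)" if "p \<in> C" "matched N f z w" for p z w
  proof -
    obtain r where r: "r \<in> C" "im p = im r" "r \<in> regular \<or> degree r = 0"
      using regular_or_const[OF \<open>p \<in> C\<close>] by blast
    have "same_sgn (poly (map_poly h r) z) (poly (map_poly h' r) w)"
      using r const_same_sgn diagramD[OF Nf that(2)] d by blast
    then show ?thesis using r(2) by simp
  qed
  then have "diagram N f (im ` C)" using Nf unfolding diagram_def by blast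
  then show ?thesis by blast
qed

end

text \<open>The elimination of one quantifier in semantic form. \<open>Q\<close>, the leading
  coefficients of a reduct-closed family around \<open>P\<close>, depends neither on the evaluations
  nor on z; w is any point matched with z.\<close>

theorem poly_transfer:
  fixes P :: "'a::{idom,ring_char_0} poly set"
  assumes I: "ivt TYPE('k::linordered_field)" "ivt TYPE('r::linordered_field)" and P: "finite P"
  shows "\<exists>Q. finite Q \<and> (\<forall>(h :: 'a \<Rightarrow> 'k) (h' :: 'a \<Rightarrow> 'r). cring_hom h \<and> cring_hom h' \<and> (\<forall>c\<in>Q. same_sgn (h c) (h' c)) \<longrightarrow>
    (\<forall>z. \<exists>w. \<forall>p\<in>P. same_sgn (poly (map_poly h p) z) (poly (map_poly h' p) w)))"
proof -
  obtain C where C: "finite C" "P \<subseteq> C" "reduct_closed C" using reduct_closure[OF P] by blast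
  have "\<exists>w. \<forall>p\<in>P. same_sgn (poly (map_poly h p) z) (poly (map_poly h' p) w)"
    if "cring_hom h" "cring_hom h'" "\<forall>c\<in>lead_coeff ` C. same_sgn (h c) (h' c)"
    for h :: "'a \<Rightarrow> 'k" and h' :: "'a \<Rightarrow> 'r" and z
  proof -
    interpret hom_pair h h' C
    proof (rule hom_pair.intro)
      show "same_sgn (h (lead_coeff p)) (h' (lead_coeff p))" if "p \<in> C" for p
        using that \<open>\<forall>c\<in>lead_coeff ` C. _\<close> by blast
    qed (fact that I C)+
    obtain N f where D: "diagram N f (im ` C)" using diagram_ex by blast
    obtain w where w: "matched N f z w" using matched_ex D unfolding diagram_def by meson
    show ?thesis using diagramD[OF D w] C(2) by blast
  qed
  then show ?thesis using C(1) by (intro exI[of _ "lead_coeff ` C"]) blast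
qed

section \<open>Evaluation of multivariate polynomials\<close>

abbreviation lookup where "lookup \<equiv> Poly_Mapping.lookup"
abbreviation keys where "keys \<equiv> Poly_Mapping.keys"
abbreviation single where "single \<equiv> Poly_Mapping.single"

definition mconst :: "'a::zero \<Rightarrow> ('v, 'a) mpoly" where
  "mconst a = single 0 a"

definition mvar :: "'v \<Rightarrow> ('v, 'a::zero_neq_one) mpoly" where
  "mvar v = single (single v 1) 1"

definition monom_eval :: "('v \<Rightarrow> 'b::comm_semiring_1) \<Rightarrow> ('v \<Rightarrow>\<^sub>0 nat) \<Rightarrow> 'b" where
  "monom_eval x m = (\<Prod>v\<in>keys m. x v ^ lookup m v)"

lemma monom_eval_superset:
  assumes "finite A" "keys m \<subseteq> A"
  shows "monom_eval x m = (\<Prod>v\<in>A. x v ^ lookup m v)"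
  unfolding monom_eval_def by (rule prod.mono_neutral_left) (use assms in \<open>auto simp: in_keys_iff\<close>)

lemma monom_eval_add: "monom_eval x (m + n) = monom_eval x m * monom_eval x n"
proof -
  let ?A = "keys m \<union> keys n"
  have "keys (m + n) \<subseteq> ?A" by (rule keys_add)
  then show ?thesis
    by (simp add: monom_eval_superset[of ?A] lookup_add power_add prod.distrib)
qed

lemma monom_eval_0 [simp]: "monom_eval x 0 = 1"
  by (simp add: monom_eval_def)

lemma monom_eval_single [simp]: "monom_eval x (single v k) = x v ^ k"
  by (cases "k = 0") (simp_all add: monom_eval_def)

lemma mpoly_eval_altdef: "mpoly_eval c x p = (\<Sum>m\<in>keys p. c (lookup p m) * monom_eval x m)"
  by (simp add: mpoly_eval_def monom_eval_def)

lemma mpoly_eval_superset: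
  assumes "c 0 = 0" "finite A" "keys p \<subseteq> A"
  shows "mpoly_eval c x p = (\<Sum>m\<in>A. c (lookup p m) * monom_eval x m)"
  unfolding mpoly_eval_altdef by (rule sum.mono_neutral_left) (use assms in \<open>auto simp: in_keys_iff\<close>)

lemma poly_mapping_eq_sum_single: "p = (\<Sum>m\<in>keys p. single m (lookup p m))"
proof (rule poly_mapping_eqI)
  fix k
  have "lookup (\<Sum>m\<in>keys p. single m (lookup p m)) k = (\<Sum>m\<in>keys p. if m = k then lookup p m else 0)"
    by (simp add: lookup_sum lookup_single when_def)
  also have "\<dots> = lookup p k" by (simp add: in_keys_iff)
  finally show "lookup p k = lookup (\<Sum>m\<in>keys p. single m (lookup p m)) k" ..
qed

context
  fixes c :: "'a::comm_ring_1 \<Rightarrow> 'b::comm_ring_1"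
  assumes c: "cring_hom c"
begin

interpretation c: cring_hom c by (rule c)

lemma mpoly_eval_single [simp]: "mpoly_eval c x (single m a) = c a * monom_eval x m"
  by (cases "a = 0") (simp_all add: mpoly_eval_altdef)

lemma mpoly_eval_add: "mpoly_eval c x (p + q) = mpoly_eval c x p + mpoly_eval c x q"
proof -
  let ?A = "keys p \<union> keys q"
  have "keys (p + q) \<subseteq> ?A" by (rule keys_add)
  then show ?thesis
    by (simp add: mpoly_eval_superset[of c ?A] lookup_add c.add distrib_right sum.distrib)
qed

lemma mpoly_eval_sum: "mpoly_eval c x (sum f A) = (\<Sum>i\<in>A. mpoly_eval c x (f i))"
proof -
  have "mpoly_eval c x 0 = 0" by (simp add: mpoly_eval_altdef)
  then show ?thesis by (induction A rule: infinite_finite_induct) (simp_all add: mpoly_eval_add)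
qed

lemma mpoly_eval_mult: "mpoly_eval c x (p * q) = mpoly_eval c x p * mpoly_eval c x q"
proof -
  have "p * q = (\<Sum>m\<in>keys p. single m (lookup p m)) * (\<Sum>n\<in>keys q. single n (lookup q n))"
    using poly_mapping_eq_sum_single[of p] poly_mapping_eq_sum_single[of q] by simp
  also have "\<dots> = (\<Sum>m\<in>keys p. \<Sum>n\<in>keys q. single (m + n) (lookup p m * lookup q n))"
    by (simp add: sum_product mult_single)
  also have "mpoly_eval c x \<dots> = (\<Sum>m\<in>keys p. \<Sum>n\<in>keys q. (c (lookup p m) * monom_eval x m) * (c (lookup q n) * monom_eval x n))"
    by (simp add: mpoly_eval_sum c.mult monom_eval_add mult_ac)
  also have "\<dots> = mpoly_eval c x p * mpoly_eval c x q"
    by (simp add: mpoly_eval_altdef sum_product)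
  finally show ?thesis .
qed

lemma mpoly_eval_hom: "cring_hom (mpoly_eval c x)"
proof
  show "mpoly_eval c x 1 = 1"
    using mpoly_eval_single[of x 0 1] by (simp add: c.one)
qed (simp_all add: mpoly_eval_add mpoly_eval_mult)

lemma mpoly_eval_mconst [simp]: "mpoly_eval c x (mconst a) = c a"
  by (simp add: mconst_def)

lemma mpoly_eval_mvar [simp]: "mpoly_eval c x (mvar v) = x v"
  by (simp add: mvar_def c.one)

end

lemma cring_hom_mconst: "cring_hom (mconst :: 'a::comm_ring_1 \<Rightarrow> ('v, 'a) mpoly)"
  by unfold_locales (simp_all add: mconst_def single_add mult_single)

lemma cring_hom_of_rat: "cring_hom (of_rat :: rat \<Rightarrow> 'b::field_char_0)"
  by unfold_locales (simp_all add: of_rat_add of_rat_mult)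

lemma cring_hom_pCons0: "cring_hom (\<lambda>x::'a::comm_ring_1. [:x:])"
  by unfold_locales simp_all

lemma cring_hom_poly_map: "cring_hom h \<Longrightarrow> cring_hom (\<lambda>p. poly (map_poly h p) z)"
proof -
  assume "cring_hom h"
  then interpret cring_hom h .
  show ?thesis by unfold_locales (simp_all add: map_poly_add map_poly_mult one)
qed

lemma mpoly_eval_comp:
  assumes "cring_hom H"
  shows "H (mpoly_eval c y p) = mpoly_eval (\<lambda>a. H (c a)) (\<lambda>v. H (y v)) p"
proof -
  interpret cring_hom H by fact
  show ?thesis by (simp add: mpoly_eval_def sum mult prod power)
qed

lemma mpoly_eval_cong:
  assumes "\<And>v. v \<in> mpoly_vars p \<Longrightarrow> x v = y v"
  shows "mpoly_eval c x p = mpoly_eval c y p"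
proof -
  have "x v = y v" if "m \<in> keys p" "v \<in> keys m" for m v
    using assms that by (auto simp: mpoly_vars_def)
  then show ?thesis
    unfolding mpoly_eval_def by (intro sum.cong refl arg_cong2[where f="(*)"] prod.cong) simp_all
qed

text \<open>Together with \<open>mpoly_eval_comp\<close> this expresses that polynomials form the
  free algebra, and it identifies the results of successive substitutions.\<close>

lemma mpoly_eval_self: "mpoly_eval mconst mvar p = (p :: ('v, 'a::comm_ring_1) mpoly)"
proof -
  have pow: "single (single v 1) 1 ^ k = (single (single v k) 1 :: ('v, 'a) mpoly)" for v k
    by (induction k) (simp_all add: mult_single single_add[symmetric])
  have sum_keys: "(\<Sum>v\<in>keys m. single v (lookup m v)) = m" for m :: "'v \<Rightarrow>\<^sub>0 nat"
    using poly_mapping_eq_sum_single[of m] by simp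
  have prd: "(\<Prod>v\<in>A. single (g v) 1) = (single (\<Sum>v\<in>A. g v) 1 :: ('v, 'a) mpoly)" if "finite A" for A :: "'v set" and g
    using that by (induction A) (simp_all add: mult_single)
  have "monom_eval mvar m = (single m 1 :: ('v, 'a) mpoly)" for m
    by (simp add: monom_eval_def mvar_def pow prd sum_keys del: One_nat_def)
  then have "mpoly_eval mconst mvar p = (\<Sum>m\<in>keys p. single m (lookup p m))"
    by (simp add: mpoly_eval_altdef mconst_def mult_single)
  then show ?thesis using poly_mapping_eq_sum_single[of p] by simp
qed

text \<open>\<open>mpoly_eval_self\<close> displays p as built by sums and products from constants
  and variables.\<close>

lemma mpoly_induct [consumes 1, case_names const var add mult]:
  fixes p :: "('v, 'a::comm_ring_1) mpoly"
  assumes vars: "mpoly_vars p \<subseteq> V" and const: "\<And>a. Q (mconst a)" and var: "\<And>v. v \<in> V \<Longrightarrow> Q (mvar v)"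
    and add: "\<And>p q. Q p \<Longrightarrow> Q q \<Longrightarrow> Q (p + q)" and mult: "\<And>p q. Q p \<Longrightarrow> Q q \<Longrightarrow> Q (p * q)"
  shows "Q p"
proof -
  have 0: "Q 0" and 1: "Q 1" using const[of 0] const[of 1] by (simp_all add: mconst_def)
  have pow: "Q (q ^ n)" if "Q q" for q n using that by (induction n) (auto intro: 1 mult)
  have prd: "Q (prod f A)" if "\<And>i. i \<in> A \<Longrightarrow> Q (f i)" for f and A :: "'v set"
    using that by (induction A rule: infinite_finite_induct) (auto intro: 1 mult)
  have sm: "Q (sum f A)" if "\<And>i. i \<in> A \<Longrightarrow> Q (f i)" for f and A :: "('v \<Rightarrow>\<^sub>0 nat) set"
    using that by (induction A rule: infinite_finite_induct) (auto intro: 0 add)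
  have "Q (mpoly_eval mconst mvar p)"
    unfolding mpoly_eval_def
    by (intro sm mult const prd pow var) (use vars in \<open>auto simp: mpoly_vars_def\<close>)
  then show ?thesis by (simp add: mpoly_eval_self)
qed

section \<open>The variables that occur in a polynomial\<close>

lemma mpoly_vars_mconst [simp]: "mpoly_vars (mconst a) = {}"
  by (cases "a = 0") (auto simp: mpoly_vars_def mconst_def)

lemma mpoly_vars_mvar [simp]: "mpoly_vars (mvar v :: ('v, 'a::zero_neq_one) mpoly) = {v}"
  by (auto simp: mpoly_vars_def mvar_def)

lemma mpoly_vars_zero [simp]: "mpoly_vars 0 = {}"
  by (auto simp: mpoly_vars_def)

lemma mpoly_vars_one [simp]: "mpoly_vars (1 :: ('v, 'a::comm_ring_1) mpoly) = {}"
  by (simp add: mpoly_vars_def)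

lemma mpoly_vars_add: "mpoly_vars (p + q) \<subseteq> mpoly_vars p \<union> mpoly_vars q"
  using keys_add[of p q] by (auto simp: mpoly_vars_def)

lemma mpoly_vars_uminus [simp]: "mpoly_vars (- p) = mpoly_vars (p :: ('v, 'a::comm_ring_1) mpoly)"
  by (simp add: mpoly_vars_def in_keys_iff set_eq_iff)

lemma mpoly_vars_mult: "mpoly_vars (p * q) \<subseteq> mpoly_vars p \<union> mpoly_vars (q :: ('v, 'a::comm_ring_1) mpoly)"
proof
  fix v assume "v \<in> mpoly_vars (p * q)"
  then obtain m where m: "m \<in> keys (p * q)" "v \<in> keys m" by (auto simp: mpoly_vars_def)
  then obtain a b where "m = a + b" "a \<in> keys p" "b \<in> keys q" using keys_mult[of p q] by blast
  then show "v \<in> mpoly_vars p \<union> mpoly_vars q"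
    using m(2) keys_add[of a b] by (auto simp: mpoly_vars_def)
qed

lemma mpoly_vars_finite [simp]: "finite (mpoly_vars p)"
  by (simp add: mpoly_vars_def)

lemma mpoly_vars_eval:
  fixes p :: "('w, 'b::comm_ring_1) mpoly" and y :: "'w \<Rightarrow> ('v, 'a::comm_ring_1) mpoly"
  assumes c: "cring_hom c" and "\<And>a. mpoly_vars (c a) \<subseteq> V" "\<And>w. w \<in> mpoly_vars p \<Longrightarrow> mpoly_vars (y w) \<subseteq> V"
  shows "mpoly_vars (mpoly_eval c y p) \<subseteq> V"
proof -
  have "mpoly_vars p \<subseteq> mpoly_vars p" ..
  then show ?thesis
  proof (induction p rule: mpoly_induct)
    case (add p q)
    then show ?case using mpoly_vars_add[of "mpoly_eval c y p" "mpoly_eval c y q"]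
      by (auto simp: mpoly_eval_add[OF c])
  next
    case (mult p q)
    then show ?case using mpoly_vars_mult[of "mpoly_eval c y p" "mpoly_eval c y q"]
      by (auto simp: mpoly_eval_mult[OF c])
  qed (use assms in \<open>auto simp: mpoly_eval_mconst[OF c] mpoly_eval_mvar[OF c]\<close>)
qed

abbreviation reval :: "('v \<Rightarrow> 'b::field_char_0) \<Rightarrow> ('v, rat) mpoly \<Rightarrow> 'b" where
  "reval \<equiv> mpoly_eval of_rat"

lemmas reval_hom = mpoly_eval_hom[OF cring_hom_of_rat]
lemmas reval_simps = mpoly_eval_add[OF cring_hom_of_rat] mpoly_eval_mult[OF cring_hom_of_rat]
  mpoly_eval_mconst[OF cring_hom_of_rat] mpoly_eval_mvar[OF cring_hom_of_rat]
  cring_hom.minus[OF reval_hom] cring_hom.diff[OF reval_hom] cring_hom.one[OF reval_hom] cring_hom.zero[OF reval_hom]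
  cring_hom.power[OF reval_hom]

subsection \<open>Change of variables\<close>

text \<open>The retraction that sets the variables outside V to zero. The polynomials returned by
  \<open>poly_transfer\<close> may contain any variables; composing evaluations with
  \<open>mret V\<close> confines them to V.\<close>

definition mret :: "'v set \<Rightarrow> ('v, rat) mpoly \<Rightarrow> ('v, rat) mpoly" where
  "mret V = mpoly_eval mconst (\<lambda>v. if v \<in> V then mvar v else 0)"

lemma mret_hom: "cring_hom (mret V)"
  unfolding mret_def by (rule mpoly_eval_hom[OF cring_hom_mconst])

lemma mpoly_vars_mret: "mpoly_vars (mret V p) \<subseteq> V"
  unfolding mret_def by (rule mpoly_vars_eval[OF cring_hom_mconst]) auto

lemma reval_mret: "reval x (mret V p) = reval (\<lambda>v. if v \<in> V then x v else 0) p"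
  unfolding mret_def mpoly_eval_comp[OF reval_hom]
  by (simp add: reval_simps if_distrib[of "reval x"] cong: if_cong)

text \<open>Substitution into univariate polynomials over a polynomial ring. Sending one variable to
  X and the others to constants orders a polynomial by powers of that variable; shifting one
  variable by X gives access to partial derivatives.\<close>

definition uni :: "('w \<Rightarrow> ('v, rat) mpoly poly) \<Rightarrow> ('w, rat) mpoly \<Rightarrow> ('v, rat) mpoly poly" where
  "uni = mpoly_eval (\<lambda>r. [:mconst r:])"

lemma cring_hom_pCons_mconst: "cring_hom (\<lambda>r::rat. [:mconst r :: ('v, rat) mpoly:])"
  using cring_hom_comp[OF cring_hom_pCons0 cring_hom_mconst] .

lemma uni_hom: "cring_hom (uni \<sigma>)"
  unfolding uni_def by (rule mpoly_eval_hom[OF cring_hom_pCons_mconst])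

lemma poly_uni:
  assumes h: "cring_hom h" and hc: "\<And>r. h (mconst r) = of_rat r"
  shows "poly (map_poly h (uni \<sigma> p)) z = reval (\<lambda>w. poly (map_poly h (\<sigma> w)) z) p"
proof -
  interpret cring_hom h by (rule h)
  show ?thesis
    unfolding uni_def by (subst mpoly_eval_comp[OF cring_hom_poly_map[OF h]]) (simp add: map_poly_pCons hc)
qed

lemma coeff_vars_mult:
  fixes p q :: "('v, 'a::comm_ring_1) mpoly poly"
  assumes "\<And>n. mpoly_vars (coeff p n) \<subseteq> F" "\<And>n. mpoly_vars (coeff q n) \<subseteq> F"
  shows "mpoly_vars (coeff (p * q) n) \<subseteq> F"
proof -
  have *: "mpoly_vars (sum f A) \<subseteq> F" if "\<And>i. i \<in> A \<Longrightarrow> mpoly_vars (f i) \<subseteq> F" for f :: "nat \<Rightarrow> ('v, 'a) mpoly" and A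
    using that
  proof (induction A rule: infinite_finite_induct)
    case (insert x A)
    then show ?case using mpoly_vars_add[of "f x" "sum f A"] by auto
  qed auto
  show ?thesis unfolding coeff_mult
    by (rule *, rule subset_trans[OF mpoly_vars_mult]) (simp add: assms)
qed

lemma coeff_uni_vars:
  fixes \<sigma> :: "'w \<Rightarrow> ('v, rat) mpoly poly"
  assumes "mpoly_vars p \<subseteq> W" "\<And>w n. w \<in> W \<Longrightarrow> mpoly_vars (coeff (\<sigma> w) n) \<subseteq> V"
  shows "mpoly_vars (coeff (uni \<sigma> p) n) \<subseteq> V"
  using assms(1)
proof (induction p arbitrary: n rule: mpoly_induct)
  case (const a)
  then show ?case unfolding uni_def mpoly_eval_mconst[OF cring_hom_pCons_mconst]
    by (auto simp: coeff_pCons split: nat.splits)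
next
  case (var v)
  then show ?case unfolding uni_def mpoly_eval_mvar[OF cring_hom_pCons_mconst] using assms(2) by blast
next
  case (add p q)
  show ?case unfolding uni_def mpoly_eval_add[OF cring_hom_pCons_mconst] coeff_add
    by (rule order.trans[OF mpoly_vars_add]) (use add[unfolded uni_def] in simp)
next
  case (mult p q)
  show ?case unfolding uni_def mpoly_eval_mult[OF cring_hom_pCons_mconst]
    by (rule coeff_vars_mult) (use mult[unfolded uni_def] in simp_all)
qed

lemma poly_uni_var:
  fixes x :: "'v \<Rightarrow> 'f::field_char_0"
  assumes "mpoly_vars p \<subseteq> insert v V" "v \<notin> V"
  shows "poly (map_poly (\<lambda>p. reval x (mret V p)) (uni (\<lambda>u. if u = v then [:0, 1:] else [:mvar u:]) p)) z = reval (x(v := z)) p"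
proof -
  let ?h = "\<lambda>p. reval x (mret V p)"
  have h: "cring_hom ?h" by (rule cring_hom_comp[OF reval_hom mret_hom])
  interpret cring_hom ?h by (rule h)
  have "poly (map_poly ?h (uni (\<lambda>u. if u = v then [:0, 1:] else [:mvar u:]) p)) z = reval (\<lambda>u. poly (map_poly ?h (if u = v then [:0, 1:] else [:mvar u:])) z) p"
    by (rule poly_uni[OF h]) (simp add: reval_mret reval_simps)
  also have "(\<lambda>u. poly (map_poly ?h (if u = v then [:0, 1:] else [:mvar u:])) z) =
      (\<lambda>u. if u = v then z else if u \<in> V then x u else 0)"
    by (rule ext, rename_tac u, case_tac "u = v")
      (simp_all only: simp_thms if_True if_False map_poly_pCons map_poly_0 poly_pCons poly_0,
       simp_all add: reval_mret reval_simps)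
  also have "reval \<dots> p = reval (x(v := z)) p"
    by (rule mpoly_eval_cong) (use assms in auto)
  finally show ?thesis .
qed

text \<open>The elimination of v: \<open>poly_transfer\<close> for the members of \<open>P\<close>
  ordered by powers of v, the coefficient homomorphisms being evaluation at x and at y after the
  retraction to V.\<close>

theorem mpoly_transfer:
  fixes P :: "('v::linorder, rat) mpoly set"
  assumes I: "ivt TYPE('k::linordered_field)" "ivt TYPE('r::linordered_field)"
    and P: "finite P" "\<And>p. p \<in> P \<Longrightarrow> mpoly_vars p \<subseteq> insert v V" and v: "v \<notin> V"
  shows "\<exists>Q. finite Q \<and> (\<forall>q\<in>Q. mpoly_vars q \<subseteq> V) \<and>
    (\<forall>(x :: 'v \<Rightarrow> 'k) (y :: 'v \<Rightarrow> 'r). (\<forall>q\<in>Q. same_sgn (reval x q) (reval y q)) \<longrightarrow>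
      (\<forall>z. \<exists>w. \<forall>p\<in>P. same_sgn (reval (x(v := z)) p) (reval (y(v := w)) p)))"
proof -
  define \<kappa> :: "('v, rat) mpoly \<Rightarrow> ('v, rat) mpoly poly"
    where "\<kappa> = uni (\<lambda>u. if u = v then [:0, 1:] else [:mvar u:])"
  note \<kappa> = poly_uni_var[OF P(2) v, folded \<kappa>_def]
  obtain Q where Q: "finite Q" "\<And>(h :: ('v, rat) mpoly \<Rightarrow> 'k) (h' :: ('v, rat) mpoly \<Rightarrow> 'r) z.
      cring_hom h \<Longrightarrow> cring_hom h' \<Longrightarrow> (\<forall>c\<in>Q. same_sgn (h c) (h' c)) \<Longrightarrow>
      \<exists>w. \<forall>p\<in>\<kappa> ` P. same_sgn (poly (map_poly h p) z) (poly (map_poly h' p) w)"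
    using poly_transfer[OF I, of "\<kappa> ` P"] P(1) by blast
  have "\<exists>w. \<forall>p\<in>P. same_sgn (reval (x(v := z)) p) (reval (y(v := w)) p)"
    if "\<forall>q\<in>mret V ` Q. same_sgn (reval x q) (reval y q)" for x :: "'v \<Rightarrow> 'k" and y :: "'v \<Rightarrow> 'r" and z
    using Q(2)[OF cring_hom_comp[OF reval_hom mret_hom] cring_hom_comp[OF reval_hom mret_hom], of x V y V z] that
    by (auto simp: \<kappa>)
  note transfer = this
  show ?thesis
  proof (intro exI[of _ "mret V ` Q"] conjI allI impI ballI)
    show "finite (mret V ` Q)" using Q(1) by simp
    show "mpoly_vars q \<subseteq> V" if q: "q \<in> mret V ` Q" for q
    proof -
      obtain r where "q = mret V r" using q by blast
      then show ?thesis by (simp only: mpoly_vars_mret)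
    qed
  qed (rule transfer)
qed

definition to_uni :: "('v option, rat) mpoly \<Rightarrow> ('v, rat) mpoly poly" where
  "to_uni = uni (case_option [:0, 1:] (\<lambda>t. [:mvar t:]))"

definition of_uni :: "('v, rat) mpoly poly \<Rightarrow> ('v option, rat) mpoly" where
  "of_uni p = poly (map_poly (mpoly_eval mconst (\<lambda>t. mvar (Some t))) p) (mvar None)"

lemma poly_to_uni: "poly (map_poly (reval x) (to_uni p)) z = reval (case_option z x) p"
proof -
  have "poly (map_poly (reval x) (to_uni p)) z =
      reval (\<lambda>w. poly (map_poly (reval x) (case_option [:0, 1:] (\<lambda>t. [:mvar t:]) w)) z) p"
    unfolding to_uni_def by (rule poly_uni[OF reval_hom]) (simp add: reval_simps)
  also have "(\<lambda>w. poly (map_poly (reval x) (case_option [:0, 1:] (\<lambda>t. [:mvar t:]) w)) z) = case_option z x"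
    by (rule ext) (auto simp: cring_hom.map_poly_pCons[OF reval_hom] reval_simps split: option.splits)
  finally show ?thesis .
qed

lemma of_uni_hom: "cring_hom of_uni"
  unfolding of_uni_def by (rule cring_hom_poly_map[OF mpoly_eval_hom[OF cring_hom_mconst]])

lemma of_uni_to_uni: "of_uni (to_uni p) = p"
proof -
  have "of_uni (to_uni p) = mpoly_eval (\<lambda>r. of_uni [:mconst r:]) (\<lambda>w. of_uni (case_option [:0, 1:] (\<lambda>t. [:mvar t:]) w)) p"
    unfolding to_uni_def uni_def by (rule mpoly_eval_comp[OF of_uni_hom])
  also have "(\<lambda>r. of_uni [:mconst r:]) = mconst"
    by (rule ext) (simp add: of_uni_def cring_hom.map_poly_pCons[OF mpoly_eval_hom[OF cring_hom_mconst]]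
        mpoly_eval_mconst[OF cring_hom_mconst] cring_hom.zero[OF mpoly_eval_hom[OF cring_hom_mconst]])
  also have "(\<lambda>w. of_uni (case_option [:0, 1:] (\<lambda>t. [:mvar t:]) w)) = mvar"
    by (rule ext) (auto simp: of_uni_def cring_hom.map_poly_pCons[OF mpoly_eval_hom[OF cring_hom_mconst]]
        mpoly_eval_mvar[OF cring_hom_mconst] cring_hom.zero[OF mpoly_eval_hom[OF cring_hom_mconst]]
        cring_hom.one[OF mpoly_eval_hom[OF cring_hom_mconst]] split: option.splits)
  finally show ?thesis by (simp add: mpoly_eval_self)
qed

lemma reval_of_uni:
  fixes p :: "('v, rat) mpoly poly"
  shows "reval (case_option z x) (of_uni p) = poly (map_poly (reval x) p) z"
proof (induction p)
  case 0
  then show ?case by (simp add: of_uni_def reval_simps)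
next
  case (pCons a p)
  let ?i = "mpoly_eval mconst (\<lambda>t. mvar (Some t)) :: ('v, rat) mpoly \<Rightarrow> ('v option, rat) mpoly"
  have "of_uni (pCons a p) = ?i a + mvar None * of_uni p"
    by (simp add: of_uni_def cring_hom.map_poly_pCons[OF mpoly_eval_hom[OF cring_hom_mconst]])
  moreover have "reval (case_option z x) (?i a) = reval x a"
    by (subst mpoly_eval_comp[OF reval_hom]) (simp add: reval_simps)
  ultimately show ?case
    using pCons by (simp add: reval_simps cring_hom.map_poly_pCons[OF reval_hom])
qed

lemma mpoly_vars_of_uni:
  fixes p :: "('v, rat) mpoly poly"
  assumes "\<And>n. mpoly_vars (coeff p n) \<subseteq> V"
  shows "mpoly_vars (of_uni p) \<subseteq> insert None (Some ` V)"
  using assms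
proof (induction p)
  case 0
  then show ?case by (simp add: of_uni_def)
next
  case (pCons a p)
  let ?i = "mpoly_eval mconst (\<lambda>t. mvar (Some t)) :: ('v, rat) mpoly \<Rightarrow> ('v option, rat) mpoly"
  have eq: "of_uni (pCons a p) = ?i a + mvar None * of_uni p"
    by (simp add: of_uni_def cring_hom.map_poly_pCons[OF mpoly_eval_hom[OF cring_hom_mconst]])
  have "mpoly_vars a \<subseteq> V" using pCons.prems[of 0] by simp
  then have 1: "mpoly_vars (?i a) \<subseteq> insert None (Some ` V)"
    by (intro mpoly_vars_eval[OF cring_hom_mconst]) auto
  have "mpoly_vars (coeff p n) \<subseteq> V" for n using pCons.prems[of "Suc n"] by simp
  then have "mpoly_vars (of_uni p) \<subseteq> insert None (Some ` V)" by (rule pCons.IH)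
  then have 2: "mpoly_vars (mvar None * of_uni p) \<subseteq> insert None (Some ` V)"
    using mpoly_vars_mult[of "mvar None" "of_uni p"] by auto
  show ?case unfolding eq using 1 2 mpoly_vars_add[of "?i a" "mvar None * of_uni p"] by blast
qed

lemma mpoly_vars_coeff_to_uni:
  assumes "mpoly_vars p \<subseteq> insert None (Some ` V)"
  shows "mpoly_vars (coeff (to_uni p) n) \<subseteq> V"
  unfolding to_uni_def by (rule coeff_uni_vars[OF assms]) (auto simp: coeff_pCons split: nat.splits if_splits)

subsection \<open>Partial derivatives\<close>

text \<open>The coefficient of \<open>\<epsilon>\<close> in \<open>p(\<Lambda> + \<epsilon> e\<^sub>t)\<close>.\<close>

definition mdiff :: "'v \<Rightarrow> ('v, rat) mpoly \<Rightarrow> ('v, rat) mpoly" where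
  "mdiff t p = coeff (uni (\<lambda>v. [:mvar v, if v = t then 1 else 0:]) p) 1"

lemma coeff_0_uni_diff: "coeff (uni (\<lambda>v. [:mvar v, if v = t then 1 else 0:]) p) 0 = p"
proof -
  have "cring_hom (\<lambda>q :: ('a, rat) mpoly poly. coeff q 0)" by unfold_locales (simp_all add: coeff_mult)
  then show ?thesis unfolding uni_def by (subst mpoly_eval_comp) (simp_all add: mpoly_eval_self)
qed

lemma mdiff_mconst [simp]: "mdiff t (mconst a) = 0"
  by (simp add: mdiff_def uni_def mpoly_eval_mconst[OF cring_hom_pCons_mconst])

lemma mdiff_mvar: "mdiff t (mvar v) = (if v = t then 1 else 0)"
  by (simp add: mdiff_def uni_def mpoly_eval_mvar[OF cring_hom_pCons_mconst])

lemma mdiff_add: "mdiff t (p + q) = mdiff t p + mdiff t q"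
  by (simp add: mdiff_def uni_def mpoly_eval_add[OF cring_hom_pCons_mconst])

lemma mdiff_mult: "mdiff t (p * q) = mdiff t p * q + p * mdiff t q"
proof -
  have "mdiff t (p * q) = coeff (uni (\<lambda>v. [:mvar v, if v = t then 1 else 0:]) p *
      uni (\<lambda>v. [:mvar v, if v = t then 1 else 0:]) q) 1"
    unfolding mdiff_def cring_hom.mult[OF uni_hom] ..
  also have "\<dots> = p * mdiff t q + mdiff t p * q"
    by (simp add: coeff_mult coeff_0_uni_diff[unfolded One_nat_def] mdiff_def)
  finally show ?thesis by (simp add: add.commute)
qed

lemma mpoly_vars_mdiff: "mpoly_vars p \<subseteq> V \<Longrightarrow> mpoly_vars (mdiff t p) \<subseteq> V"
  unfolding mdiff_def by (rule coeff_uni_vars) (auto simp: coeff_pCons split: nat.splits)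

lemma mdiff_notin_vars: "t \<notin> mpoly_vars p \<Longrightarrow> mdiff t p = 0"
proof -
  assume "t \<notin> mpoly_vars p"
  then have "mpoly_vars p \<subseteq> - {t}" by auto
  then show ?thesis by (induction p rule: mpoly_induct) (auto simp: mdiff_mvar mdiff_add mdiff_mult)
qed

text \<open>The chain rule: a derivation along an evaluation is fixed by its values on the
  variables. It serves for the derivation of \<open>K\<close> composed with evaluation.\<close>

lemma derivation_along_eval:
  fixes d :: "('v, rat) mpoly \<Rightarrow> 'b::field_char_0"
  assumes "mpoly_vars p \<subseteq> V" "finite V"
    and "\<And>a. d (mconst a) = 0" "\<And>p q. d (p + q) = d p + d q"
    and "\<And>p q. d (p * q) = d p * reval x q + reval x p * d q"
  shows "d p = (\<Sum>t\<in>V. reval x (mdiff t p) * d (mvar t))"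
  using assms(1)
proof (induction p rule: mpoly_induct)
  case (var v)
  have "(\<Sum>t\<in>V. reval x (mdiff t (mvar v)) * d (mvar t)) = (\<Sum>t\<in>V. if v = t then d (mvar t) else 0)"
    by (intro sum.cong) (auto simp: mdiff_mvar reval_simps)
  also have "\<dots> = d (mvar v)" using var assms(2) by simp
  finally show ?case ..
qed (simp_all add: assms(3-) reval_simps mdiff_add mdiff_mult sum.distrib algebra_simps sum_distrib_left)

lemma reval_has_derivative:
  "((\<lambda>s. reval (x(t := s)) p) has_real_derivative reval (x(t := s)) (mdiff t p)) (at s)"
proof -
  have "mpoly_vars p \<subseteq> UNIV" by simp
  then show ?thesis
  proof (induction p rule: mpoly_induct)
    case (mult p q)
    then show ?case unfolding mdiff_mult reval_simps
      by (rule DERIV_cong[OF DERIV_mult]) (simp add: algebra_simps fun_upd_def)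
  qed (auto simp: reval_simps mdiff_mvar mdiff_add intro!: derivative_eq_intros)
qed

section \<open>Transcendence bases\<close>

text \<open>Elements of the field are their own variables, so evaluation is at the identity function
  and T carries no separate indexing.\<close>

definition alg_indep :: "'k::field_char_0 set \<Rightarrow> bool" where
  "alg_indep T \<longleftrightarrow> (\<forall>p :: ('k, rat) mpoly. mpoly_vars p \<subseteq> T \<longrightarrow> reval (\<lambda>a. a) p = 0 \<longrightarrow> p = 0)"

lemma alg_indepD: "alg_indep T \<Longrightarrow> mpoly_vars p \<subseteq> T \<Longrightarrow> reval (\<lambda>a. a) p = 0 \<Longrightarrow> p = 0"
  by (auto simp: alg_indep_def)

text \<open>Zorn's lemma; a polynomial relation involves finitely many elements and so lies in one
  member of a chain.\<close>

lemma alg_indep_extend: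
  assumes "alg_indep E"
  shows "\<exists>T. E \<subseteq> T \<and> alg_indep T \<and> (\<forall>S. T \<subseteq> S \<longrightarrow> alg_indep S \<longrightarrow> S = T)"
proof -
  define A where "A = {S. E \<subseteq> S \<and> alg_indep S}"
  have "\<exists>M\<in>A. \<forall>S\<in>A. M \<subseteq> S \<longrightarrow> S = M"
  proof (rule subset_Zorn_nonempty)
    show "A \<noteq> {}" using assms by (auto simp: A_def)
    fix C assume C: "C \<noteq> {}" "subset.chain A C"
    have CA: "C \<subseteq> A" using C(2) by (auto simp: subset.chain_def)
    have "alg_indep (\<Union>C)" unfolding alg_indep_def
    proof (intro allI impI)
      fix p :: "('a, rat) mpoly" assume p: "mpoly_vars p \<subseteq> \<Union>C" "reval (\<lambda>a. a) p = 0"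
      obtain S where S: "S \<in> C" "mpoly_vars p \<subseteq> S"
        using finite_subset_Union_chain[OF mpoly_vars_finite p(1) C] by blast
      then show "p = 0" using alg_indepD[of S p] p(2) CA by (auto simp: A_def)
    qed
    moreover have "E \<subseteq> \<Union>C" using C(1) CA by (auto simp: A_def)
    ultimately show "\<Union>C \<in> A" by (simp add: A_def)
  qed
  then obtain T where T: "T \<in> A" "\<And>S. S \<in> A \<Longrightarrow> T \<subseteq> S \<Longrightarrow> S = T" by blast
  have "S = T" if "T \<subseteq> S" "alg_indep S" for S
    using T(1) that by (intro T(2)) (auto simp: A_def)
  then show ?thesis using T(1) by (auto simp: A_def)
qed

text \<open>By maximality \<open>a\<close> satisfies a relation together with T, which is read as a
  polynomial in \<open>a\<close> over the ring Q[T] and not over its fraction field. Independence of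
  T keeps it nonzero after evaluation.\<close>

lemma algebraic_over_base:
  fixes T :: "'k::field_char_0 set"
  assumes T: "alg_indep T" "\<And>S. T \<subseteq> S \<Longrightarrow> alg_indep S \<Longrightarrow> S = T"
  shows "\<exists>q. (\<forall>n. mpoly_vars (coeff q n) \<subseteq> T) \<and> map_poly (reval (\<lambda>a. a)) q \<noteq> 0 \<and>
    poly (map_poly (reval (\<lambda>a. a)) q) a = 0"
proof (cases "a \<in> T")
  case True
  let ?q = "[:- mvar a, 1:] :: ('k, rat) mpoly poly"
  have m: "map_poly (reval (\<lambda>a. a)) ?q = [:- a, 1:]"
    by (simp add: cring_hom.map_poly_pCons[OF reval_hom] reval_simps)
  show ?thesis
    by (intro exI[of _ ?q] conjI) (use True m in \<open>auto simp: coeff_pCons split: nat.splits\<close>)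
next
  case False
  then have "\<not> alg_indep (insert a T)" using T(2)[of "insert a T"] by blast
  then obtain p where p: "mpoly_vars p \<subseteq> insert a T" "reval (\<lambda>a. a) p = 0" "p \<noteq> 0"
    by (auto simp: alg_indep_def)
  let ?s = "\<lambda>u. if u = a then [:0, 1:] else [:mvar u:] :: ('k, rat) mpoly poly"
  define q where "q = uni ?s p"
  have vars: "mpoly_vars (coeff q n) \<subseteq> T" for n
    unfolding q_def by (rule coeff_uni_vars[OF p(1)]) (auto simp: coeff_pCons split: nat.splits)
  \<comment> \<open>Recovers p from q, so that q is nonzero.\<close>
  have back_subst: "poly q (mvar a) = p"
  proof -
    have hom: "cring_hom (\<lambda>q :: ('k, rat) mpoly poly. poly q (mvar a))"
      by unfold_locales simp_all
    have "poly q (mvar a) = mpoly_eval (\<lambda>r. poly [:mconst r:] (mvar a)) (\<lambda>u. poly (?s u) (mvar a)) p"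
      unfolding q_def uni_def by (rule mpoly_eval_comp[OF hom])
    also have "(\<lambda>u. poly (?s u) (mvar a)) = mvar" by (rule ext) simp
    finally show ?thesis by (simp add: mpoly_eval_self)
  qed
  have "map_poly (reval (\<lambda>a. a)) q \<noteq> 0"
  proof
    assume "map_poly (reval (\<lambda>a. a)) q = 0"
    then have "reval (\<lambda>a. a) (coeff q n) = 0" for n
      using cring_hom.coeff_map[OF reval_hom, of "\<lambda>a. a" q n] by simp
    then have "coeff q n = 0" for n using alg_indepD[OF T(1) vars] by blast
    then have "q = 0" by (simp add: poly_eq_iff)
    then show False using back_subst p(3) by simp
  qed
  moreover have "poly (map_poly (reval (\<lambda>a. a)) q) a = reval (\<lambda>a. a) (poly q (mvar a))"
    using cring_hom.poly_map_poly[OF reval_hom, of "\<lambda>a. a" q "mvar a"] by (simp add: reval_simps)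
  ultimately show ?thesis using vars back_subst p(2) by auto
qed

subsection \<open>Differential equations of order one\<close>

context
  fixes \<delta> :: "'k::field_char_0 \<Rightarrow> 'k"
  assumes der: "derivation \<delta>"
begin

lemma derivation_add: "\<delta> (x + y) = \<delta> x + \<delta> y" and derivation_mult: "\<delta> (x * y) = \<delta> x * y + x * \<delta> y"
  using der by (auto simp: derivation_def)

lemma derivation_0 [simp]: "\<delta> 0 = 0"
  using derivation_add[of 0 0] by simp

lemma derivation_1 [simp]: "\<delta> 1 = 0"
  using derivation_mult[of 1 1] by simp

lemma derivation_sum: "\<delta> (sum f A) = (\<Sum>i\<in>A. \<delta> (f i))"
  by (induction A rule: infinite_finite_induct) (simp_all add: derivation_add)

lemma derivation_uminus: "\<delta> (- x) = - \<delta> x"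
  using derivation_add[of x "- x"] by (simp add: eq_neg_iff_add_eq_0 add.commute)

lemma derivation_diff: "\<delta> (x - y) = \<delta> x - \<delta> y"
  using derivation_add[of "x - y" y] by simp

lemma derivation_of_nat: "\<delta> (of_nat n) = 0"
  by (induction n) (simp_all add: derivation_add)

lemma derivation_of_int: "\<delta> (of_int i) = 0"
  by (cases i) (simp_all add: derivation_of_nat derivation_uminus derivation_diff)

lemma derivation_of_rat: "\<delta> (of_rat r) = 0"
proof -
  obtain a b where ab: "quotient_of r = (a, b)" by fastforce
  then have b: "b > 0" "r = of_int a / of_int b" by (auto intro: quotient_of_denom_pos quotient_of_div)
  have "of_rat r * of_int b = (of_int a :: 'k)" using b by (simp add: of_rat_divide)
  then have "\<delta> (of_rat r * of_int b) = 0" by (simp add: derivation_of_int)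
  then show ?thesis using b(1) by (simp add: derivation_mult derivation_of_int)
qed

lemma derivation_poly:
  "\<delta> (poly (map_poly of_rat r) z) = poly (map_poly of_rat (pderiv r)) z * \<delta> z"
proof (induction r)
  case (pCons a p)
  then show ?case
    by (simp add: cring_hom.map_poly_pCons[OF cring_hom_of_rat] cring_hom.map_poly_add[OF cring_hom_of_rat]
        pderiv_pCons derivation_add derivation_mult derivation_of_rat algebra_simps)
qed simp

lemma derivation_power: "\<delta> (x ^ n) = of_nat n * x ^ (n - 1) * \<delta> x"
proof (induction n)
  case (Suc n)
  then show ?case by (cases n) (simp_all add: derivation_mult algebra_simps)
qed simp

lemma derivation_prod:
  assumes "finite A" "\<And>v. v \<in> A \<Longrightarrow> \<delta> (f v) = g v * f v"
  shows "\<delta> (prod f A) = (\<Sum>v\<in>A. g v) * prod f A"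
  using assms by (induction A) (simp_all add: derivation_mult algebra_simps)

text \<open>Applying \<delta> to r(z) = 0 gives r'(z) = 0; repetition ends at a nonzero
  constant.\<close>

lemma transcendental_of_derivative_1:
  assumes z: "\<delta> z = 1" and "r \<noteq> 0"
  shows "poly (map_poly of_rat r) z \<noteq> 0"
  using assms(2)
proof (induction "degree r" arbitrary: r rule: less_induct)
  case less
  show ?case
  proof (cases "degree r = 0")
    case True
    then obtain c where "r = [:c:]" by (auto elim: degree_eq_zeroE)
    then show ?thesis using less.prems by (simp add: cring_hom.map_poly_pCons[OF cring_hom_of_rat])
  next
    case False
    then have "pderiv r \<noteq> 0" "degree (pderiv r) < degree r"
      by (simp_all add: pderiv_eq_0_iff degree_pderiv)
    then have "poly (map_poly of_rat (pderiv r)) z \<noteq> 0" using less.hyps by blast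
    then show ?thesis using derivation_poly[of r z] z by auto
  qed
qed

text \<open>Applying \<open>\<delta> - q\<^sub>m(z)\<close> lowers the degree of the coefficient of \<open>u\<^sub>m\<close> and keeps the other
  coefficients nonzero.\<close>

lemma exponentials_independent:
  fixes u :: "'i \<Rightarrow> 'k" and q c :: "'i \<Rightarrow> rat poly"
  assumes z: "\<delta> z = 1"
  defines "ev \<equiv> \<lambda>r. poly (map_poly of_rat r) z"
  assumes "finite M" "\<And>m. m \<in> M \<Longrightarrow> u m \<noteq> 0" "\<And>m. m \<in> M \<Longrightarrow> \<delta> (u m) = ev (q m) * u m" "inj_on q M"
    and "(\<Sum>m\<in>M. ev (c m) * u m) = 0"
  shows "\<forall>m\<in>M. c m = 0"
  using assms(3-)
proof (induction M arbitrary: c)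
  case (insert m\<^sub>0 M)
  have ev: "cring_hom ev" unfolding ev_def by (rule cring_hom_poly_map[OF cring_hom_of_rat])
  have \<delta>ev: "\<delta> (ev r) = ev (pderiv r)" for r by (simp add: ev_def derivation_poly z)
  have ev0: "ev r = 0 \<longleftrightarrow> r = 0" for r
    using transcendental_of_derivative_1[OF z, of r] cring_hom.zero[OF ev] by (auto simp: ev_def)
  have outer: "\<forall>m\<in>M. c m = 0" if "(\<Sum>m\<in>M. ev (c m) * u m) = 0" for c
    using insert.IH[OF _ _ _ that] insert.prems by simp
  \<comment> \<open>A comparison of degrees: a' has smaller degree than a, whereas a d has at least
    the degree of a.\<close>
  have nz: "a = 0" if "pderiv a + a * d = 0" "d \<noteq> 0" for a d :: "rat poly"
  proof (rule ccontr)
    assume a: "a \<noteq> 0"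
    have "pderiv a = - (a * d)" using that(1) by (simp add: eq_neg_iff_add_eq_0)
    then have "degree (pderiv a) = degree a + degree d" "pderiv a \<noteq> 0"
      using a that(2) by (simp_all add: degree_mult_eq)
    then show False by (simp add: degree_pderiv pderiv_eq_0_iff)
  qed
  have "\<forall>m\<in>insert m\<^sub>0 M. c m = 0" if "(\<Sum>m\<in>insert m\<^sub>0 M. ev (c m) * u m) = 0" for c
    using that
  proof (induction "degree (c m\<^sub>0)" arbitrary: c rule: less_induct)
    case (less c)
    \<comment> \<open>The coefficients of the transformed relation. At \<open>m\<^sub>0\<close> the
      factor \<open>q m - q m\<^sub>0\<close> is zero and only the derivative of the coefficient
      remains.\<close>
    define c' where "c' m = pderiv (c m) + c m * (q m - q m\<^sub>0)" for m
    have "(\<Sum>m\<in>insert m\<^sub>0 M. ev (c' m) * u m) =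
        \<delta> (\<Sum>m\<in>insert m\<^sub>0 M. ev (c m) * u m) - ev (q m\<^sub>0) * (\<Sum>m\<in>insert m\<^sub>0 M. ev (c m) * u m)"
      unfolding derivation_sum sum_distrib_left sum_subtractf[symmetric]
    proof (rule sum.cong[OF refl])
      fix m assume "m \<in> insert m\<^sub>0 M"
      then have "\<delta> (u m) = ev (q m) * u m" using insert.prems by blast
      then show "ev (c' m) * u m = \<delta> (ev (c m) * u m) - ev (q m\<^sub>0) * (ev (c m) * u m)"
        by (simp add: c'_def derivation_mult \<delta>ev cring_hom.add[OF ev] cring_hom.mult[OF ev]
            cring_hom.diff[OF ev] algebra_simps)
    qed
    then have sum0: "(\<Sum>m\<in>insert m\<^sub>0 M. ev (c' m) * u m) = 0" using less.prems by simp
    have c'0: "c' m\<^sub>0 = pderiv (c m\<^sub>0)" by (simp add: c'_def)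
    have c0: "c m\<^sub>0 = 0"
    proof (cases "degree (c m\<^sub>0) = 0")
      case True
      then have "c' m\<^sub>0 = 0" by (simp add: c'0 pderiv_eq_0_iff)
      \<comment> \<open>The term of \<open>m\<^sub>0\<close> has dropped out, so the outer induction
        hypothesis applies to the new relation; by \<open>nz\<close> the old coefficients on
        \<open>M\<close> vanish as well.\<close>
      then have "(\<Sum>m\<in>M. ev (c' m) * u m) = 0"
        using sum0 insert.hyps by (simp add: ev0[THEN iffD2])
      then have 0: "\<forall>m\<in>M. c' m = 0" by (rule outer)
      have "c m = 0" if "m \<in> M" for m
      proof (rule nz)
        show "pderiv (c m) + c m * (q m - q m\<^sub>0) = 0" using 0 that by (simp add: c'_def)
        show "q m - q m\<^sub>0 \<noteq> 0" using insert.prems(3) insert.hyps(2) that by (auto simp: inj_on_def)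
      qed
      then have "ev (c m\<^sub>0) * u m\<^sub>0 = 0" using less.prems insert.hyps by (simp add: ev0[THEN iffD2])
      then show ?thesis using insert.prems(1) ev0 by simp
    next
      case False
      then have "degree (c' m\<^sub>0) < degree (c m\<^sub>0)" by (simp add: c'0 degree_pderiv)
      then have "c' m\<^sub>0 = 0" using less.hyps[OF _ sum0] by simp
      then show ?thesis using False by (simp add: c'0 pderiv_eq_0_iff)
    qed
    then have "(\<Sum>m\<in>M. ev (c m) * u m) = 0"
      using less.prems insert.hyps by (simp add: ev0[THEN iffD2])
    then show ?case using outer c0 by simp
  qed
  then show ?case using insert.prems(4) by blast
qed simp

end

text \<open>The closedness condition for the polynomial y' - \<alpha> y - \<beta>, whose separant is
  1, with the single inequality y > 0.\<close>

lemma diff_closed_linear_solution: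
  fixes \<delta> :: "'k::linordered_field \<Rightarrow> 'k"
  assumes "ordered_diff_closed \<delta>"
  shows "\<exists>b>0. \<delta> b = \<alpha> * b + \<beta>"
proof -
  define y0 y1 :: "nat \<Rightarrow>\<^sub>0 nat" where "y0 = single 0 1" and "y1 = single 1 1"
  have "lookup y1 1 = 1" "lookup y0 1 = 0" "lookup y0 0 = 1" by (simp_all add: y0_def y1_def lookup_single)
  then have ne: "y1 \<noteq> y0" "y1 \<noteq> 0" "y0 \<noteq> 0" by auto
  define p :: "'k dpoly" where "p = single y1 1 + (single y0 (- \<alpha>) + single 0 (- \<beta>))"
  define q :: "'k dpoly" where "q = single y0 1"
  have lp: "lookup p m = (if m = y1 then 1 else if m = y0 then - \<alpha> else if m = 0 then - \<beta> else 0)" for m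
    using ne by (auto simp: p_def lookup_add lookup_single)
  have y1k: "y1 \<in> keys p" using lp[of y1] by (simp add: in_keys_iff)
  have kp: "keys p \<subseteq> {y1, y0, 0}" by (auto simp: in_keys_iff lp split: if_splits)
  have id: "cring_hom (id :: 'k \<Rightarrow> 'k)" by unfold_locales simp_all
  have ev: "mpoly_eval id x p = x 1 - \<alpha> * x 0 - \<beta>" for x
    unfolding p_def mpoly_eval_add[OF id] mpoly_eval_single[OF id] by (simp add: y0_def y1_def)
  have evq: "mpoly_eval id x q = x 0" for x
    unfolding q_def mpoly_eval_single[OF id] by (simp add: y0_def)
  have "1 \<in> keys y1" by (simp add: y1_def)
  then have "1 \<in> mpoly_vars p" unfolding mpoly_vars_def using y1k by blast
  moreover have "mpoly_vars p \<subseteq> {0, 1}" using kp by (auto simp: mpoly_vars_def y0_def y1_def)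
  ultimately have "Max (mpoly_vars p) = 1" by (intro Max_eqI) auto
  then have op: "dpoly_ord p = 1" using \<open>1 \<in> mpoly_vars p\<close> by (auto simp: dpoly_ord_def)
  have oq: "dpoly_ord q \<le> 1"
    by (simp add: dpoly_ord_def mpoly_vars_def q_def y0_def)
  have "mpoly_pderiv 1 p = (\<Sum>m\<in>keys p. if m = y1 then single 0 1 else 0)"
    unfolding mpoly_pderiv_def
  proof (rule sum.cong[OF refl])
    fix m assume "m \<in> keys p"
    then consider "m = y1" | "m = y0" | "m = 0" using kp by blast
    then show "single (m - single 1 1) (of_nat (lookup m 1) * lookup p m) = (if m = y1 then single 0 1 else 0)"
      by cases (use ne in \<open>simp_all add: lp y0_def y1_def lookup_single\<close>)
  qed
  also have "\<dots> = single 0 1" using y1k by simp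
  finally have sep: "mpoly_eval id x (mpoly_pderiv 1 p) = 1" for x
    by (simp add: cring_hom.one[OF mpoly_eval_hom[OF id]])
  \<comment> \<open>The point (1, \<alpha> + \<beta>) satisfies the algebraic equation and has
    positive first coordinate.\<close>
  have "\<exists>b. dpoly_eval \<delta> p b = 0 \<and> (\<forall>q\<in>{q}. dpoly_eval \<delta> q b > 0)"
    using assms[unfolded ordered_diff_closed_def, THEN conjunct2, THEN conjunct2, rule_format,
        of "{q}" p 1 "\<lambda>i. if i = 0 then 1 else \<alpha> + \<beta>"]
    by (simp add: op oq ev evq sep del: One_nat_def)
  then obtain b where "dpoly_eval \<delta> p b = 0" "dpoly_eval \<delta> q b > 0" by blast
  then show ?thesis by (intro exI[of _ b]) (simp add: dpoly_eval_def ev evq algebra_simps)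
qed

text \<open>A monomial in the y_i has logarithmic derivative q_m(z), where the coefficient of q_m at
  i is the exponent of y_i. Distinct monomials thus have distinct q_m, and
  \<open>exponentials_independent\<close> with constant coefficients excludes every
  relation.\<close>

theorem infinite_alg_indep:
  fixes \<delta> :: "'k::linordered_field \<Rightarrow> 'k"
  assumes "ordered_diff_closed \<delta>"
  shows "\<exists>E :: 'k set. infinite E \<and> alg_indep E"
proof -
  have der: "derivation \<delta>" using assms by (simp add: ordered_diff_closed_def)
  obtain z where z: "\<delta> z = 1" using diff_closed_linear_solution[OF assms, of 0 1] by auto
  have "\<exists>b>0. \<delta> b = z ^ i * b" for i using diff_closed_linear_solution[OF assms, of "z ^ i" 0] by simp
  then obtain y where y: "\<And>i. y i > 0" "\<And>i. \<delta> (y i) = z ^ i * y i" by metis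
  define ev where "ev = (\<lambda>r::rat poly. poly (map_poly of_rat r) z)"
  have ev: "cring_hom ev" unfolding ev_def by (rule cring_hom_poly_map[OF cring_hom_of_rat])
  have evm: "ev (monom a i) = of_rat a * z ^ i" for a i by (simp add: ev_def map_poly_monom poly_monom)
  have inj: "inj y"
  proof (rule injI)
    fix i j assume "y i = y j"
    then have "z ^ i * y i = z ^ j * y i" using y(2)[of i] y(2)[of j] by metis
    moreover have "y i \<noteq> 0" using y(1)[of i] by simp
    ultimately have "z ^ i = z ^ j" by (metis mult_right_cancel)
    then have "ev (monom 1 i - monom 1 j) = 0" by (simp add: evm cring_hom.diff[OF ev])
    then have "monom 1 i - monom 1 j = (0 :: rat poly)"
      using transcendental_of_derivative_1[OF der z] unfolding ev_def by blast
    then show "i = j" by (simp add: monom_eq_iff')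
  qed
  have "alg_indep (range y)" unfolding alg_indep_def
  proof (intro allI impI)
    fix p :: "('k, rat) mpoly" assume p: "mpoly_vars p \<subseteq> range y" "reval (\<lambda>a. a) p = 0"
    define u where "u = monom_eval (\<lambda>a::'k. a)"
    define q where "q m = (\<Sum>v\<in>keys m. monom (of_nat (lookup m v)) (inv_into UNIV y v) :: rat poly)" for m
    have km: "keys m \<subseteq> range y" if "m \<in> keys p" for m using p(1) that by (auto simp: mpoly_vars_def)
    have "\<forall>m\<in>keys p. [:lookup p m:] = 0"
    proof (rule exponentials_independent[OF der z finite_keys, of p u q])
      fix m assume m: "m \<in> keys p"
      \<comment> \<open>The y_i were chosen positive, so no monomial in them vanishes.\<close>
      have pos: "v > 0" if "v \<in> keys m" for v using km[OF m] that y(1) by auto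
      then show "u m \<noteq> 0" by (simp add: u_def monom_eval_def) (metis less_irrefl)
      have "\<delta> (u m) = (\<Sum>v\<in>keys m. of_nat (lookup m v) * z ^ inv_into UNIV y v) * u m"
        unfolding u_def monom_eval_def
      proof (rule derivation_prod[OF der finite_keys])
        fix v assume v: "v \<in> keys m"
        then obtain i where i: "v = y i" using km[OF m] by blast
        have "lookup m v \<noteq> 0" using v by (simp add: in_keys_iff)
        then obtain k where k: "lookup m v = Suc k" by (cases "lookup m v") auto
        show "\<delta> (v ^ lookup m v) = of_nat (lookup m v) * z ^ inv_into UNIV y v * v ^ lookup m v"
          unfolding k derivation_power[OF der] by (simp add: i y(2) inj algebra_simps)
      qed
      also have "(\<Sum>v\<in>keys m. of_nat (lookup m v) * z ^ inv_into UNIV y v) = ev (q m)"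
        by (simp add: q_def cring_hom.sum[OF ev] evm)
      finally show "\<delta> (u m) = poly (map_poly of_rat (q m)) z * u m" by (simp add: ev_def)
    next
      have qc: "coeff (q m) i = of_nat (lookup m (y i))" if mp: "m \<in> keys p" for m i
      proof -
        have "coeff (q m) i = (\<Sum>v\<in>keys m. if v = y i then of_nat (lookup m v) else 0)"
          unfolding q_def coeff_sum
        proof (rule sum.cong[OF refl])
          fix v assume "v \<in> keys m"
          then obtain j where "v = y j" using km[OF mp] by blast
          then show "coeff (monom (of_nat (lookup m v)) (inv_into UNIV y v)) i = (if v = y i then of_nat (lookup m v) else 0 :: rat)"
            using inj by (auto simp: inj_eq)
        qed
        also have "\<dots> = of_nat (lookup m (y i))" by (simp add: in_keys_iff)
        finally show ?thesis .
      qed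
      show "inj_on q (keys p)"
      proof (rule inj_onI)
        fix m n assume mn: "m \<in> keys p" "n \<in> keys p" "q m = q n"
        show "m = n"
        proof (rule poly_mapping_eqI)
          fix v
          show "lookup m v = lookup n v"
          proof (cases "v \<in> range y")
            case True
            then obtain i where "v = y i" by blast
            then show ?thesis using qc[OF mn(1), of i] qc[OF mn(2), of i] mn(3) by simp
          next
            case False
            then have "v \<notin> keys m" "v \<notin> keys n" using km mn by blast+
            then show ?thesis by (simp add: in_keys_iff)
          qed
        qed
      qed
      show "(\<Sum>m\<in>keys p. poly (map_poly of_rat [:lookup p m:]) z * u m) = 0"
        using p(2) by (simp add: mpoly_eval_altdef u_def cring_hom.map_poly_pCons[OF cring_hom_of_rat])
    qed
    then have "lookup p m = 0" for m by (cases "m \<in> keys p") (auto simp: in_keys_iff)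
    then show "p = 0" by (intro poly_mapping_eqI) simp
  qed
  moreover have "infinite (range y)" using inj finite_imageD by blast
  ultimately show ?thesis by blast
qed

section \<open>Analytic solutions of polynomial equations\<close>

text \<open>The weighted l1-norm, the sum of |p_m| \<rho>^|m|. It is submultiplicative and bounds p
  on the polydisc of radius \<rho>, so that convergence in this norm leads to an absolutely
  convergent power series there.\<close>

definition wnorm :: "real \<Rightarrow> ('v, real) mpoly \<Rightarrow> real" where
  "wnorm \<rho> p = mpoly_eval abs (\<lambda>_. \<rho>) p"

lemma cring_hom_real_id: "cring_hom (id :: real \<Rightarrow> real)"
  by unfold_locales simp_all

lemmas ieval_hom = mpoly_eval_hom[OF cring_hom_real_id]

lemma wnorm_superset:
  "finite A \<Longrightarrow> keys p \<subseteq> A \<Longrightarrow> wnorm \<rho> p = (\<Sum>m\<in>A. \<bar>lookup p m\<bar> * monom_eval (\<lambda>_. \<rho>) m)"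
  unfolding wnorm_def by (rule mpoly_eval_superset) auto

lemma monom_eval_nonneg: "\<rho> \<ge> 0 \<Longrightarrow> monom_eval (\<lambda>_. \<rho> :: real) m \<ge> 0"
  unfolding monom_eval_def by (intro prod_nonneg) auto

lemma monom_eval_pos: "\<rho> > 0 \<Longrightarrow> monom_eval (\<lambda>_. \<rho> :: real) m > 0"
  unfolding monom_eval_def by (intro prod_pos) auto

lemma wnorm_0 [simp]: "wnorm \<rho> 0 = 0"
  by (simp add: wnorm_def mpoly_eval_def)

lemma wnorm_single: "wnorm \<rho> (single m a) = \<bar>a\<bar> * monom_eval (\<lambda>_. \<rho>) m"
  by (cases "a = 0") (simp_all add: wnorm_def mpoly_eval_altdef)

context
  fixes \<rho> :: real
  assumes \<rho>: "\<rho> \<ge> 0"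
begin

lemma wnorm_nonneg: "wnorm \<rho> p \<ge> 0"
  unfolding wnorm_def mpoly_eval_altdef by (intro sum_nonneg mult_nonneg_nonneg monom_eval_nonneg \<rho>) auto

lemma wnorm_add: "wnorm \<rho> (p + q) \<le> wnorm \<rho> p + wnorm \<rho> q"
proof -
  let ?A = "keys p \<union> keys q"
  have k: "keys (p + q) \<subseteq> ?A" by (rule keys_add)
  have "wnorm \<rho> (p + q) = (\<Sum>m\<in>?A. \<bar>lookup p m + lookup q m\<bar> * monom_eval (\<lambda>_. \<rho>) m)"
    using wnorm_superset[OF _ k] by (simp add: lookup_add)
  also have "\<dots> \<le> (\<Sum>m\<in>?A. (\<bar>lookup p m\<bar> + \<bar>lookup q m\<bar>) * monom_eval (\<lambda>_. \<rho>) m)"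
    by (intro sum_mono mult_right_mono abs_triangle_ineq monom_eval_nonneg \<rho>)
  also have "\<dots> = wnorm \<rho> p + wnorm \<rho> q"
    by (simp add: wnorm_superset[of ?A] distrib_right sum.distrib)
  finally show ?thesis .
qed

lemma wnorm_sum: "wnorm \<rho> (sum f A) \<le> (\<Sum>i\<in>A. wnorm \<rho> (f i))"
proof (induction A rule: infinite_finite_induct)
  case (insert i A)
  then show ?case using wnorm_add[of "f i" "sum f A"] by simp
qed simp_all

lemma wnorm_mult: "wnorm \<rho> (p * q) \<le> wnorm \<rho> p * wnorm \<rho> q"
proof -
  have "p * q = (\<Sum>m\<in>keys p. single m (lookup p m)) * (\<Sum>n\<in>keys q. single n (lookup q n))"
    using poly_mapping_eq_sum_single[of p] poly_mapping_eq_sum_single[of q] by simp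
  also have "\<dots> = (\<Sum>m\<in>keys p. \<Sum>n\<in>keys q. single (m + n) (lookup p m * lookup q n))"
    by (simp add: sum_product mult_single)
  also have "wnorm \<rho> \<dots> \<le> (\<Sum>m\<in>keys p. \<Sum>n\<in>keys q. wnorm \<rho> (single (m + n) (lookup p m * lookup q n)))"
    by (rule order_trans[OF wnorm_sum sum_mono[OF wnorm_sum]])
  also have "\<dots> = wnorm \<rho> p * wnorm \<rho> q"
    unfolding wnorm_def[of \<rho> p] wnorm_def[of \<rho> q] mpoly_eval_altdef sum_product
    by (simp add: wnorm_single monom_eval_add abs_mult mult_ac)
  finally show ?thesis .
qed

lemma wnorm_eval: "(\<And>t. t \<in> mpoly_vars p \<Longrightarrow> \<bar>x t\<bar> \<le> \<rho>) \<Longrightarrow> \<bar>mpoly_eval id x p\<bar> \<le> wnorm \<rho> p"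
  unfolding wnorm_def mpoly_eval_def
proof (rule order_trans[OF sum_abs], rule sum_mono)
  fix m assume x: "\<And>t. t \<in> mpoly_vars p \<Longrightarrow> \<bar>x t\<bar> \<le> \<rho>" and m: "m \<in> keys p"
  have "(\<Prod>v\<in>keys m. \<bar>x v\<bar> ^ lookup m v) \<le> (\<Prod>v\<in>keys m. \<rho> ^ lookup m v)"
    using x m by (intro prod_mono conjI power_mono) (auto simp: mpoly_vars_def)
  then show "\<bar>id (lookup p m) * (\<Prod>v\<in>keys m. x v ^ lookup m v)\<bar> \<le> \<bar>lookup p m\<bar> * (\<Prod>v\<in>keys m. \<rho> ^ lookup m v)"
    by (simp add: abs_mult abs_prod power_abs mult_left_mono)
qed

lemma wnorm_power_diff:
  assumes "wnorm \<rho> w \<le> B" "wnorm \<rho> w' \<le> B"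
  shows "wnorm \<rho> (w ^ Suc j - w' ^ Suc j) \<le> real (Suc j) * B ^ j * wnorm \<rho> (w - w')"
proof -
  have B: "B \<ge> 0" using assms wnorm_nonneg order_trans by blast
  have pow: "wnorm \<rho> (w' ^ Suc j) \<le> B ^ Suc j" for j
  proof (induction j)
    case (Suc j)
    have "wnorm \<rho> (w' ^ Suc (Suc j)) \<le> wnorm \<rho> w' * wnorm \<rho> (w' ^ Suc j)" using wnorm_mult by simp
    also have "\<dots> \<le> B * B ^ Suc j" using Suc assms B by (intro mult_mono wnorm_nonneg) auto
    finally show ?case by simp
  qed (use assms in simp)
  show ?thesis
  proof (induction j)
    case (Suc j)
    have "w ^ Suc (Suc j) - w' ^ Suc (Suc j) = w * (w ^ Suc j - w' ^ Suc j) + (w - w') * w' ^ Suc j"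
      by (simp add: algebra_simps)
    then have "wnorm \<rho> (w ^ Suc (Suc j) - w' ^ Suc (Suc j)) \<le>
        wnorm \<rho> (w * (w ^ Suc j - w' ^ Suc j)) + wnorm \<rho> ((w - w') * w' ^ Suc j)"
      using wnorm_add by metis
    also have "\<dots> \<le> wnorm \<rho> w * wnorm \<rho> (w ^ Suc j - w' ^ Suc j) + wnorm \<rho> (w - w') * wnorm \<rho> (w' ^ Suc j)"
      by (intro add_mono wnorm_mult)
    also have "\<dots> \<le> B * (real (Suc j) * B ^ j * wnorm \<rho> (w - w')) + wnorm \<rho> (w - w') * B ^ Suc j"
      using Suc assms B pow by (intro add_mono mult_mono wnorm_nonneg) auto
    also have "\<dots> = real (Suc (Suc j)) * B ^ Suc j * wnorm \<rho> (w - w')" by (simp add: algebra_simps)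
    finally show ?case .
  qed simp
qed

end

text \<open>Without a constant term every monomial contributes at least one factor \<rho>.\<close>

lemma wnorm_small:
  assumes "lookup p 0 = 0" "0 \<le> \<rho>" "\<rho> \<le> 1"
  shows "wnorm \<rho> p \<le> \<rho> * wnorm 1 p"
proof -
  have "monom_eval (\<lambda>_. \<rho>) m \<le> \<rho>" if m: "m \<in> keys p" for m :: "'a \<Rightarrow>\<^sub>0 nat"
  proof -
    have "m \<noteq> 0" using m assms(1) by (auto simp: in_keys_iff)
    then obtain v where v: "v \<in> keys m" by (metis keys_eq_empty all_not_in_conv)
    have "monom_eval (\<lambda>_. \<rho>) m = \<rho> ^ lookup m v * (\<Prod>u\<in>keys m - {v}. \<rho> ^ lookup m u)"
      unfolding monom_eval_def using v by (simp add: prod.remove)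
    also have "\<dots> \<le> \<rho> ^ 1 * 1"
      using v assms(2,3)
      by (intro mult_mono prod_le_1 power_decreasing prod_nonneg) (auto simp: in_keys_iff power_le_one)
    finally show ?thesis by simp
  qed
  then have "wnorm \<rho> p \<le> (\<Sum>m\<in>keys p. \<bar>lookup p m\<bar> * \<rho>)"
    unfolding wnorm_def mpoly_eval_altdef by (intro sum_mono mult_left_mono) auto
  also have "\<dots> = \<rho> * wnorm 1 p"
    by (simp add: wnorm_def mpoly_eval_def sum_distrib_left mult.commute)
  finally show ?thesis .
qed

lemma wnorm_mono: "0 \<le> \<rho> \<Longrightarrow> \<rho> \<le> 1 \<Longrightarrow> wnorm \<rho> p \<le> wnorm 1 p"
  unfolding wnorm_def mpoly_eval_altdef monom_eval_def
  by (intro sum_mono mult_left_mono prod_mono) (auto simp: power_le_one)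

text \<open>The coefficients form Cauchy sequences. Finite partial sums inherit the geometric bound
  in the limit (\<open>ctail\<close>), and this bound controls the distance of partial sums of the
  limit series from the values of \<open>w k\<close>.\<close>

lemma wnorm_limit:
  fixes w :: "nat \<Rightarrow> ('v, real) mpoly"
  assumes \<rho>: "\<rho> > 0" and F: "finite F" "\<And>k. mpoly_vars (w k) \<subseteq> F" and C: "C \<ge> 0"
    and step: "\<And>k. wnorm \<rho> (w (Suc k) - w k) \<le> C * (1 / 2) ^ k"
  shows "\<exists>c. \<forall>x. (\<forall>t\<in>F. \<bar>x t\<bar> \<le> \<rho>) \<longrightarrow> (\<exists>s. (\<lambda>k. mpoly_eval id x (w k)) \<longlonglongrightarrow> s \<and>
    ((\<lambda>m. c m * (\<Prod>t\<in>F. x t ^ lookup m t)) has_sum s) {m. keys m \<subseteq> F})"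
proof -
  let ?\<mu> = "monom_eval (\<lambda>_. \<rho>)"
  \<comment> \<open>The factor 1 - 2^(-l) comes from the exact geometric sum and lets the induction
    close.\<close>
  have tail: "wnorm \<rho> (w (k + l) - w k) \<le> 2 * C * (1 / 2) ^ k * (1 - (1 / 2) ^ l)" for k l
  proof (induction l)
    case (Suc l)
    have "w (k + Suc l) - w k = (w (Suc (k + l)) - w (k + l)) + (w (k + l) - w k)" by simp
    then have "wnorm \<rho> (w (k + Suc l) - w k) \<le> wnorm \<rho> (w (Suc (k + l)) - w (k + l)) + wnorm \<rho> (w (k + l) - w k)"
      using wnorm_add \<rho> less_imp_le by metis
    also have "\<dots> \<le> C * (1 / 2) ^ (k + l) + 2 * C * (1 / 2) ^ k * (1 - (1 / 2) ^ l)"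
      by (intro add_mono step Suc)
    also have "\<dots> = 2 * C * (1 / 2) ^ k * (1 - (1 / 2) ^ Suc l)" by (simp add: power_add algebra_simps)
    finally show ?case .
  qed simp
  have tail': "wnorm \<rho> (w (k + l) - w k) \<le> 2 * C * (1 / 2) ^ k" for k l
    by (rule order_trans[OF tail]) (use C in \<open>simp add: mult_left_le\<close>)
  have geo: "(\<lambda>k. 2 * C * (1 / 2) ^ k) \<longlonglongrightarrow> 0"
    by (intro tendsto_mult_right_zero LIMSEQ_power_zero) simp
  have cauchy: "convergent a" if a: "\<And>k l. \<bar>a (k + l) - a k\<bar> \<le> M * (2 * C * (1 / 2) ^ k)" for a :: "nat \<Rightarrow> real" and M
  proof (rule Cauchy_convergent, rule CauchyI)
    fix e :: real assume "e > 0"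
    have "(\<lambda>k. M * (2 * C * (1 / 2) ^ k)) \<longlonglongrightarrow> 0" using tendsto_mult_right_zero[OF geo] .
    then have "\<forall>\<^sub>F k in sequentially. M * (2 * C * (1 / 2) ^ k) < e / 2"
      using \<open>e > 0\<close> by (intro order_tendstoD) auto
    then obtain k where k: "M * (2 * C * (1 / 2) ^ k) < e / 2" by (auto simp: eventually_sequentially)
    have "norm (a m - a n) < e" if "m \<ge> k" "n \<ge> k" for m n
    proof -
      have "\<bar>a m - a k\<bar> < e / 2" "\<bar>a n - a k\<bar> < e / 2"
        using a[of k "m - k"] a[of k "n - k"] that k by auto
      then show ?thesis unfolding real_norm_def by linarith
    qed
    then show "\<exists>M. \<forall>m\<ge>M. \<forall>n\<ge>M. norm (a m - a n) < e" by blast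
  qed
  have wpart: "(\<Sum>m\<in>A. \<bar>lookup p m\<bar> * ?\<mu> m) \<le> wnorm \<rho> p" if "finite A" for A and p :: "('v, real) mpoly"
  proof -
    have "(\<Sum>m\<in>A. \<bar>lookup p m\<bar> * ?\<mu> m) \<le> (\<Sum>m\<in>A \<union> keys p. \<bar>lookup p m\<bar> * ?\<mu> m)"
      using that \<rho> by (intro sum_mono2) (auto intro!: mult_nonneg_nonneg monom_eval_nonneg)
    also have "\<dots> = wnorm \<rho> p" using that by (intro wnorm_superset[symmetric]) auto
    finally show ?thesis .
  qed
  have "convergent (\<lambda>k. lookup (w k) m)" for m
  proof (rule cauchy)
    fix k l
    have "\<bar>lookup (w (k + l) - w k) m\<bar> * ?\<mu> m \<le> 2 * C * (1 / 2) ^ k"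
      using order_trans[OF wpart[of "{m}" "w (k + l) - w k"] tail'] by simp
    then show "\<bar>lookup (w (k + l)) m - lookup (w k) m\<bar> \<le> (1 / ?\<mu> m) * (2 * C * (1 / 2) ^ k)"
      using monom_eval_pos[OF \<rho>, of m] by (simp add: lookup_minus field_simps)
  qed
  then obtain c where c: "\<And>m. (\<lambda>k. lookup (w k) m) \<longlonglongrightarrow> c m" unfolding convergent_def by metis
  have ctail: "(\<Sum>m\<in>A. \<bar>c m - lookup (w k) m\<bar> * ?\<mu> m) \<le> 2 * C * (1 / 2) ^ k" if A: "finite A" for A k
  proof (rule LIMSEQ_le_const2)
    show "(\<lambda>l. \<Sum>m\<in>A. \<bar>lookup (w (k + l)) m - lookup (w k) m\<bar> * ?\<mu> m) \<longlonglongrightarrow>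
        (\<Sum>m\<in>A. \<bar>c m - lookup (w k) m\<bar> * ?\<mu> m)"
      using LIMSEQ_ignore_initial_segment[OF c, where k=k]
      by (intro tendsto_intros) (simp add: add.commute)
    show "\<exists>N. \<forall>l\<ge>N. (\<Sum>m\<in>A. \<bar>lookup (w (k + l)) m - lookup (w k) m\<bar> * ?\<mu> m) \<le> 2 * C * (1 / 2) ^ k"
      using order_trans[OF wpart[OF A] tail'] by (simp add: lookup_minus)
  qed
  show ?thesis
  proof (intro exI[of _ c] allI impI)
    fix x :: "'v \<Rightarrow> real" assume x: "\<forall>t\<in>F. \<bar>x t\<bar> \<le> \<rho>"
    let ?e = "\<lambda>k. mpoly_eval id x (w k)"
    let ?\<xi> = "\<lambda>m. \<Prod>t\<in>F. x t ^ lookup m t"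
    have xi: "\<bar>?\<xi> m\<bar> \<le> ?\<mu> m" if "keys m \<subseteq> F" for m
    proof -
      have "\<bar>?\<xi> m\<bar> = (\<Prod>t\<in>F. \<bar>x t\<bar> ^ lookup m t)" by (simp add: abs_prod power_abs)
      also have "\<dots> \<le> (\<Prod>t\<in>F. \<rho> ^ lookup m t)" using x by (intro prod_mono conjI power_mono) auto
      also have "\<dots> = ?\<mu> m" using monom_eval_superset[OF F(1) that, of "\<lambda>_. \<rho>"] by simp
      finally show ?thesis .
    qed
    have ediff: "\<bar>?e (k + l) - ?e k\<bar> \<le> 2 * C * (1 / 2) ^ k" for k l
    proof -
      have "?e (k + l) - ?e k = mpoly_eval id x (w (k + l) - w k)"
        by (simp add: cring_hom.diff[OF ieval_hom])
      also have "\<bar>\<dots>\<bar> \<le> wnorm \<rho> (w (k + l) - w k)"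
      proof (rule wnorm_eval)
        fix t assume "t \<in> mpoly_vars (w (k + l) - w k)"
        then have "t \<in> F" using mpoly_vars_add[of "w (k + l)" "- w k"] F(2) by auto
        then show "\<bar>x t\<bar> \<le> \<rho>" using x by blast
      qed (use \<rho> in simp)
      finally show ?thesis using tail' order_trans by blast
    qed
    have "convergent ?e" using cauchy[of ?e 1] ediff by simp
    then obtain s where s: "?e \<longlonglongrightarrow> s" unfolding convergent_def by blast
    have stail: "\<bar>s - ?e k\<bar> \<le> 2 * C * (1 / 2) ^ k" for k
    proof (rule LIMSEQ_le_const2)
      show "(\<lambda>l. \<bar>?e (k + l) - ?e k\<bar>) \<longlonglongrightarrow> \<bar>s - ?e k\<bar>"
        using LIMSEQ_ignore_initial_segment[OF s, where k=k] by (intro tendsto_intros) (simp add: add.commute)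
    qed (use ediff in blast)
    have ksub: "keys m \<subseteq> F" if "m \<in> keys (w k)" for m k
      using F(2)[of k] that by (auto simp: mpoly_vars_def)
    have "((\<lambda>m. c m * ?\<xi> m) has_sum s) {m. keys m \<subseteq> F}"
      unfolding has_sum_def
    proof (rule tendstoI)
      fix e :: real assume "e > 0"
      have "\<forall>\<^sub>F k in sequentially. 2 * C * (1 / 2) ^ k < e / 2"
        using geo \<open>e > 0\<close> by (intro order_tendstoD) auto
      then obtain k where k: "2 * C * (1 / 2) ^ k < e / 2" by (auto simp: eventually_sequentially)
      show "\<forall>\<^sub>F A in finite_subsets_at_top {m. keys m \<subseteq> F}. dist (\<Sum>m\<in>A. c m * ?\<xi> m) s < e"
        unfolding eventually_finite_subsets_at_top
      proof (intro exI[of _ "keys (w k)"] conjI allI impI)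
        fix A assume A: "finite A \<and> keys (w k) \<subseteq> A \<and> A \<subseteq> {m. keys m \<subseteq> F}"
        have "?e k = (\<Sum>m\<in>A. lookup (w k) m * monom_eval x m)"
          using A mpoly_eval_superset[of id A "w k" x] by simp
        also have "\<dots> = (\<Sum>m\<in>A. lookup (w k) m * ?\<xi> m)"
        proof (rule sum.cong[OF refl])
          fix m assume "m \<in> A"
          then have "keys m \<subseteq> F" using A by blast
          then show "lookup (w k) m * monom_eval x m = lookup (w k) m * ?\<xi> m"
            by (simp add: monom_eval_superset[OF F(1)])
        qed
        finally have "(\<Sum>m\<in>A. c m * ?\<xi> m) - ?e k = (\<Sum>m\<in>A. (c m - lookup (w k) m) * ?\<xi> m)"
          by (simp add: left_diff_distrib sum_subtractf)
        also have "\<bar>\<dots>\<bar> \<le> (\<Sum>m\<in>A. \<bar>(c m - lookup (w k) m) * ?\<xi> m\<bar>)" by (rule sum_abs)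
        also have "\<dots> \<le> (\<Sum>m\<in>A. \<bar>c m - lookup (w k) m\<bar> * ?\<mu> m)"
          unfolding abs_mult using A xi by (intro sum_mono mult_left_mono) auto
        also have "\<dots> \<le> 2 * C * (1 / 2) ^ k" using A by (intro ctail) simp
        finally show "dist (\<Sum>m\<in>A. c m * ?\<xi> m) s < e"
          using stail[of k] k by (simp add: dist_real_def)
      qed (use ksub in auto)
    qed
    then show "\<exists>s. ?e \<longlonglongrightarrow> s \<and> ((\<lambda>m. c m * ?\<xi> m) has_sum s) {m. keys m \<subseteq> F}" using s by blast
  qed
qed

lemma lookup_0_eq_eval: "lookup p 0 = mpoly_eval id (\<lambda>_. 0) (p :: ('v, real) mpoly)"
proof -
  have "mpoly_eval id (\<lambda>_. 0) p = (\<Sum>m\<in>keys p. if m = 0 then lookup p m else 0)"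
    unfolding mpoly_eval_altdef
  proof (rule sum.cong[OF refl])
    fix m :: "'v \<Rightarrow>\<^sub>0 nat"
    show "id (lookup p m) * monom_eval (\<lambda>_. 0) m = (if m = 0 then lookup p m else 0)"
    proof (cases "m = 0")
      case False
      then obtain v where v: "v \<in> keys m" by (metis keys_eq_empty all_not_in_conv)
      then have "(0::real) ^ lookup m v = 0" by (simp add: in_keys_iff)
      then have "monom_eval (\<lambda>_. 0::real) m = 0"
        unfolding monom_eval_def using v by (intro prod_zero) auto
      then show ?thesis using False by simp
    qed simp
  qed
  then show ?thesis by (simp add: in_keys_iff)
qed

text \<open>The implicit function theorem: \<open>w \<mapsto> w - q(w) / q\<^sub>1(0)\<close> is a contraction in the weighted norm.\<close>

theorem analytic_root:
  fixes q :: "('v, real) mpoly poly"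
  assumes F: "finite F" "\<And>n. mpoly_vars (coeff q n) \<subseteq> F"
    and q0: "lookup (coeff q 0) 0 = 0" and q1: "lookup (coeff q 1) 0 \<noteq> 0" and \<epsilon>: "\<epsilon> > 0"
  shows "\<exists>\<rho>>0. \<exists>c. \<forall>x. (\<forall>t\<in>F. \<bar>x t\<bar> \<le> \<rho>) \<longrightarrow> (\<exists>s. \<bar>s\<bar> \<le> \<epsilon> \<and> poly (map_poly (mpoly_eval id x) q) s = 0 \<and>
    ((\<lambda>m. c m * (\<Prod>t\<in>F. x t ^ lookup m t)) has_sum s) {m. keys m \<subseteq> F})"
proof -
  define b where "b = mconst (1 / lookup (coeff q 1) 0) * (1 :: ('v, real) mpoly)"
  \<comment> \<open>A fixed point of g is a zero of q, since b is a nonzero constant. The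
    coefficients of g in degrees 0 and 1 have no constant term.\<close>
  define g where "g = monom 1 1 - smult b q"
  have lb: "lookup (b * p) 0 = lookup p 0 / lookup (coeff q 1) 0" for p
  proof -
    note * = lookup_0_eq_eval
    show ?thesis unfolding *[of "b * p"] *[of p]
      by (simp add: b_def cring_hom.mult[OF ieval_hom] mpoly_eval_mconst[OF cring_hom_real_id])
  qed
  have g0: "lookup (coeff g 0) 0 = 0" by (simp add: g_def lb lookup_minus q0)
  have g1: "lookup (coeff g 1) 0 = 0" using q1 by (simp add: g_def lb lookup_minus lookup_one)
  have gv: "mpoly_vars (coeff g n) \<subseteq> F" for n
  proof -
    have "mpoly_vars (b * coeff q n) \<subseteq> F"
      using mpoly_vars_mult[of b "coeff q n"] F(2)[of n] by (auto simp: b_def)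
    moreover have "mpoly_vars (coeff (monom 1 1) n :: ('v, real) mpoly) = {}"
      by (simp add: coeff_monom)
    ultimately show ?thesis
      using mpoly_vars_add[of "coeff (monom 1 1) n" "- (b * coeff q n)"] by (auto simp: g_def)
  qed
  define d where "d = degree g"
  define A where "A = (\<Sum>j\<le>d. real j * wnorm 1 (coeff g j))"
  have A: "A \<ge> 0" unfolding A_def by (intro sum_nonneg mult_nonneg_nonneg wnorm_nonneg) auto
  \<comment> \<open>The bound 1/(4(A + 1)) makes the Lipschitz constant 2BA at most 1/2 on the ball
    of radius B. The choice of \<rho> in the next line makes the norm of g(0) at most B/2, so that
    the iteration stays in the ball; B \<le> \<epsilon> bounds the root.\<close>
  define B where "B = min (min \<epsilon> 1) (1 / (4 * (A + 1)))"
  define \<rho> where "\<rho> = min B (B / (2 * (wnorm 1 (coeff g 0) + 1)))"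
  have n0: "wnorm 1 (coeff g 0) \<ge> 0" by (rule wnorm_nonneg) simp
  have B: "B > 0" "B \<le> \<epsilon>" "B \<le> 1" "B * A \<le> 1 / 4"
  proof -
    show "B > 0" using \<epsilon> A by (auto simp: B_def)
    show "B \<le> \<epsilon>" "B \<le> 1" by (auto simp: B_def)
    have "B * A \<le> (1 / (4 * (A + 1))) * A" using A by (intro mult_right_mono) (auto simp: B_def)
    also have "\<dots> \<le> 1 / 4" using A by (simp add: field_simps)
    finally show "B * A \<le> 1 / 4" .
  qed
  have \<rho>: "\<rho> > 0" "\<rho> \<le> B" "\<rho> * wnorm 1 (coeff g 0) \<le> B / 2"
  proof -
    show "\<rho> > 0" using B n0 by (auto simp: \<rho>_def)
    show "\<rho> \<le> B" by (auto simp: \<rho>_def)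
    have "\<rho> * wnorm 1 (coeff g 0) \<le> (B / (2 * (wnorm 1 (coeff g 0) + 1))) * wnorm 1 (coeff g 0)"
      using n0 by (intro mult_right_mono) (auto simp: \<rho>_def)
    also have "\<dots> \<le> B / 2" using n0 B by (simp add: field_simps)
    finally show "\<rho> * wnorm 1 (coeff g 0) \<le> B / 2" .
  qed
  have \<rho>1: "0 \<le> \<rho>" "\<rho> \<le> 1" using \<rho> B by auto
  have lip: "wnorm \<rho> (poly g w - poly g w') \<le> 1 / 2 * wnorm \<rho> (w - w')"
    if "wnorm \<rho> w \<le> B" "wnorm \<rho> w' \<le> B" for w w'
  proof -
    have nn: "wnorm \<rho> (w - w') \<ge> 0" by (rule wnorm_nonneg[OF \<rho>1(1)])
    have summand: "wnorm \<rho> (coeff g j * (w ^ j - w' ^ j)) \<le> (2 * B) * (real j * wnorm 1 (coeff g j)) * wnorm \<rho> (w - w')" for j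
    proof (cases j)
      case (Suc i)
      have "wnorm \<rho> (coeff g j * (w ^ j - w' ^ j)) \<le> wnorm \<rho> (coeff g j) * (real j * B ^ i * wnorm \<rho> (w - w'))"
        using wnorm_power_diff[OF \<rho>1(1) that, of i]
        by (intro order_trans[OF wnorm_mult[OF \<rho>1(1)]] mult_left_mono wnorm_nonneg[OF \<rho>1(1)]) (simp add: Suc)
      also have "\<dots> = (wnorm \<rho> (coeff g j) * B ^ i) * (real j * wnorm \<rho> (w - w'))" by simp
      also have "wnorm \<rho> (coeff g j) * B ^ i \<le> (2 * B) * wnorm 1 (coeff g j)"
      \<comment> \<open>The linear term owes its small factor to \<open>g1\<close>, the higher terms
        to a factor B of B^i.\<close>
      proof (cases i)
        case 0
        then have "wnorm \<rho> (coeff g j) \<le> \<rho> * wnorm 1 (coeff g j)"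
          using g1 Suc by (intro wnorm_small \<rho>1) simp
        also have "\<dots> \<le> (2 * B) * wnorm 1 (coeff g j)"
          using \<rho> B by (intro mult_right_mono wnorm_nonneg) auto
        finally show ?thesis using 0 by simp
      next
        case (Suc k)
        have "B ^ i \<le> B ^ 1" using Suc B by (intro power_decreasing) auto
        then have "wnorm \<rho> (coeff g j) * B ^ i \<le> wnorm 1 (coeff g j) * (2 * B)"
          using B by (intro mult_mono wnorm_mono \<rho>1 wnorm_nonneg) auto
        then show ?thesis by (simp add: mult.commute)
      qed
      finally show ?thesis using nn by (simp add: mult_right_mono mult_ac)
    qed simp
    have "poly g w - poly g w' = (\<Sum>j\<le>d. coeff g j * (w ^ j - w' ^ j))"
      by (simp add: poly_altdef d_def right_diff_distrib sum_subtractf)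
    then have "wnorm \<rho> (poly g w - poly g w') \<le> (\<Sum>j\<le>d. wnorm \<rho> (coeff g j * (w ^ j - w' ^ j)))"
      using wnorm_sum[OF \<rho>1(1)] by metis
    also have "\<dots> \<le> (\<Sum>j\<le>d. (2 * B) * (real j * wnorm 1 (coeff g j)) * wnorm \<rho> (w - w'))"
      by (intro sum_mono summand)
    also have "\<dots> = (2 * (B * A)) * wnorm \<rho> (w - w')"
      by (simp add: A_def sum_distrib_left sum_distrib_right mult_ac)
    also have "\<dots> \<le> 1 / 2 * wnorm \<rho> (w - w')" using B nn by (intro mult_right_mono) auto
    finally show ?thesis .
  qed
  define w where "w = rec_nat 0 (\<lambda>_. poly g)"
  have w0: "w 0 = 0" and wS: "w (Suc k) = poly g (w k)" for k by (simp_all add: w_def)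
  have g0n: "wnorm \<rho> (coeff g 0) \<le> B / 2"
    using wnorm_small[OF g0 \<rho>1] \<rho>(3) by linarith
  have wB: "wnorm \<rho> (w k) \<le> B" for k
  proof (induction k)
    case (Suc k)
    have "wnorm \<rho> (poly g (w k)) \<le> wnorm \<rho> (poly g (w k) - poly g 0) + wnorm \<rho> (poly g 0)"
      using wnorm_add[OF \<rho>1(1), of "poly g (w k) - poly g 0" "poly g 0"] by simp
    also have "\<dots> \<le> 1 / 2 * wnorm \<rho> (w k) + B / 2"
      using lip[OF Suc, of 0] B g0n by (simp add: poly_0_coeff_0)
    finally show ?case using Suc by (simp add: wS)
  qed (use B in \<open>simp add: w0\<close>)
  have step: "wnorm \<rho> (w (Suc k) - w k) \<le> B * (1 / 2) ^ k" for k
  proof (induction k)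
    case 0
    then show ?case using wB[of 1] by (simp add: w0)
  next
    case (Suc k)
    have "wnorm \<rho> (w (Suc (Suc k)) - w (Suc k)) \<le> 1 / 2 * wnorm \<rho> (w (Suc k) - w k)"
      unfolding wS[of "Suc k"] using lip[OF wB[of "Suc k"] wB[of k]] by (simp add: wS[of k])
    then show ?case using Suc by simp
  qed
  have wv: "mpoly_vars (w k) \<subseteq> F" for k
  proof (induction k)
    case (Suc k)
    have "mpoly_vars (poly p (w k)) \<subseteq> F" if "\<And>n. mpoly_vars (coeff p n) \<subseteq> F" for p
      using that
    proof (induction p)
      case (pCons a p)
      have "mpoly_vars a \<subseteq> F" using pCons.prems[of 0] by simp
      moreover have "mpoly_vars (coeff p n) \<subseteq> F" for n using pCons.prems[of "Suc n"] by simp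
      then have "mpoly_vars (w k * poly p (w k)) \<subseteq> F"
        using pCons.IH Suc mpoly_vars_mult[of "w k" "poly p (w k)"] by blast
      ultimately show ?case using mpoly_vars_add[of a "w k * poly p (w k)"] by auto
    qed simp
    then show ?case using gv by (simp add: wS)
  qed (simp add: w0)
  obtain c where c: "\<And>x. (\<forall>t\<in>F. \<bar>x t\<bar> \<le> \<rho>) \<Longrightarrow> \<exists>s. (\<lambda>k. mpoly_eval id x (w k)) \<longlonglongrightarrow> s \<and>
      ((\<lambda>m. c m * (\<Prod>t\<in>F. x t ^ lookup m t)) has_sum s) {m. keys m \<subseteq> F}"
    using wnorm_limit[OF \<rho>(1) F(1) wv less_imp_le[OF B(1)] step] by blast
  have "\<exists>s. \<bar>s\<bar> \<le> \<epsilon> \<and> poly (map_poly (mpoly_eval id x) q) s = 0 \<and>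
      ((\<lambda>m. c m * (\<Prod>t\<in>F. x t ^ lookup m t)) has_sum s) {m. keys m \<subseteq> F}"
    if x: "\<forall>t\<in>F. \<bar>x t\<bar> \<le> \<rho>" for x
  proof -
    let ?e = "mpoly_eval id x"
    obtain s where s: "(\<lambda>k. ?e (w k)) \<longlonglongrightarrow> s"
        "((\<lambda>m. c m * (\<Prod>t\<in>F. x t ^ lookup m t)) has_sum s) {m. keys m \<subseteq> F}"
      using c[OF x] by blast
    have "\<bar>?e (w k)\<bar> \<le> B" for k
      by (rule order_trans[OF wnorm_eval[OF \<rho>1(1)] wB]) (use x wv in blast)
    then have "\<bar>s\<bar> \<le> B" using LIMSEQ_le_const2[OF tendsto_rabs[OF s(1)]] by blast
    then have "\<bar>s\<bar> \<le> \<epsilon>" using B by simp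
    moreover have "poly (map_poly ?e q) s = 0"
    proof -
      have e: "?e (w (Suc k)) = poly (map_poly ?e g) (?e (w k))" for k
        by (simp add: wS cring_hom.poly_map_poly[OF ieval_hom])
      have "(\<lambda>k. poly (map_poly ?e g) (?e (w k))) \<longlonglongrightarrow> poly (map_poly ?e g) s"
        by (rule isCont_tendsto_compose[OF poly_isCont s(1)])
      moreover have "(\<lambda>k. ?e (w (Suc k))) \<longlonglongrightarrow> s" using s(1) by (rule LIMSEQ_Suc)
      ultimately have "poly (map_poly ?e g) s = s" unfolding e by (rule LIMSEQ_unique)
      moreover have "map_poly ?e g = monom 1 1 - smult (?e b) (map_poly ?e q)"
        by (rule poly_eqI) (simp add: g_def cring_hom.coeff_map[OF ieval_hom] cring_hom.diff[OF ieval_hom]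
            cring_hom.mult[OF ieval_hom] coeff_monom cring_hom.one[OF ieval_hom] cring_hom.zero[OF ieval_hom])
      moreover have "?e b \<noteq> 0"
        using q1 by (simp add: b_def mpoly_eval_mconst[OF cring_hom_real_id])
      ultimately show ?thesis by (simp add: poly_monom)
    qed
    ultimately show ?thesis using s(2) by blast
  qed
  then show ?thesis using \<rho>(1) by blast
qed

section \<open>Contractible semialgebraic cells\<close>

lemma topspace_RT [simp]: "topspace (powertop_real T) = extensional T"
  by (simp add: powertop_real_eq_top_of_set)

lemma continuous_on_reval: "continuous_on A (\<lambda>x. reval (x :: 'v \<Rightarrow> real) p)"
  unfolding mpoly_eval_def
  by (intro continuous_intros continuous_on_subset[OF continuous_on_product_coordinates]) auto

lemma continuous_on_coord: "continuous_on A f \<Longrightarrow> continuous_on A (\<lambda>x. f x t)"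
  for f :: "'a::topological_space \<Rightarrow> 'v \<Rightarrow> real"
  by (rule continuous_on_product_then_coordinatewise)

text \<open>The contraction moves every loop to a constant one; base points may move, because simple
  connectedness is stated by free homotopies of loops. It also joins every point to the centre by a
  path.\<close>

lemma contractible_imp_simply_path_connected:
  fixes S :: "'a::topological_space set"
  assumes "contractible S"
  shows "simply_connected S" "path_connected S"
proof -
  obtain a where "homotopic_with_canon (\<lambda>x. True) S S id (\<lambda>x. a)"
    using assms by (auto simp: contractible_def)
  then obtain h where h: "continuous_on ({0..1::real} \<times> S) h" "h \<in> ({0..1} \<times> S) \<rightarrow> S"
      "\<And>x. h (0, x) = x" "\<And>x. h (1, x) = a"
    unfolding homotopic_with_def by (auto simp: continuous_map_subtopology_eu)
  have loop: "homotopic_loops S p (\<lambda>_. a)"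
    if p: "path p" "pathfinish p = pathstart p" "path_image p \<subseteq> S" for p
    unfolding homotopic_loops
  proof (intro exI conjI ballI)
    have pS: "p y \<in> S" if "y \<in> {0..1}" for y using p(3) that by (auto simp: path_image_def)
    show "continuous_on ({0..1} \<times> {0..1}) (\<lambda>z. h (fst z, p (snd z)))"
    proof (rule continuous_on_compose2[OF h(1)])
      have "continuous_on ({0..1} \<times> {0..1}) (\<lambda>z :: real \<times> real. p (snd z))"
        using p(1) unfolding path_def by (rule continuous_on_compose2) (auto intro: continuous_intros)
      then show "continuous_on ({0..1} \<times> {0..1}) (\<lambda>z :: real \<times> real. (fst z, p (snd z)))"
        by (intro continuous_intros)
    qed (use pS in auto)
    show "(\<lambda>z. h (fst z, p (snd z))) \<in> {0..1} \<times> {0..1} \<rightarrow> S"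
      using h(2) pS by auto
    show "pathfinish ((\<lambda>z. h (fst z, p (snd z))) \<circ> Pair t) = pathstart ((\<lambda>z. h (fst z, p (snd z))) \<circ> Pair t)"
      for t using p(2) by (simp add: pathfinish_def pathstart_def)
  qed (simp_all add: h)
  show "simply_connected S" unfolding simply_connected_def
    using loop homotopic_loops_sym homotopic_loops_trans by meson
  have "path_component S x a" if "x \<in> S" for x
    unfolding path_component_def
  proof (intro exI conjI)
    have "continuous_on {0..1} (\<lambda>s. h (s, x))"
      by (rule continuous_on_compose2[OF h(1)]) (use that in \<open>auto intro!: continuous_intros\<close>)
    then show "path (\<lambda>s. h (s, x))" by (simp add: path_def)
    show "path_image (\<lambda>s. h (s, x)) \<subseteq> S" using h(2) that by (auto simp: path_image_def)
  qed (simp_all add: pathstart_def pathfinish_def h)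
  then show "path_connected S"
    unfolding path_connected_component using path_component_sym path_component_trans by meson
qed

text \<open>The segment from f to g, formed on the coordinates in T only, so that all values stay
  \<open>undefined\<close> elsewhere.\<close>

lemma homotopic_with_linear_RT:
  fixes f g :: "'a::topological_space \<Rightarrow> 'v \<Rightarrow> real"
  assumes f: "continuous_on A f" and g: "continuous_on A g" and ext: "\<And>x. f x \<in> extensional T" "\<And>x. g x \<in> extensional T"
    and B: "\<And>x s. x \<in> A \<Longrightarrow> 0 \<le> s \<Longrightarrow> s \<le> 1 \<Longrightarrow> (\<lambda>t. if t \<in> T then (1 - s) * f x t + s * g x t else undefined) \<in> B"
  shows "homotopic_with_canon (\<lambda>_. True) A B f g"
  unfolding homotopic_with_def
proof (intro exI conjI allI ballI)
  let ?h = "\<lambda>z. \<lambda>t. if t \<in> T then (1 - fst z) * f (snd z) t + fst z * g (snd z) t else undefined"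
  have "continuous_on ({0..1} \<times> A) (\<lambda>z. f (snd z) t)" "continuous_on ({0..1} \<times> A) (\<lambda>z. g (snd z) t)" for t
    by (rule continuous_on_compose2[OF continuous_on_coord[OF f]] continuous_on_compose2[OF continuous_on_coord[OF g]],
        auto intro!: continuous_intros)+
  then have "continuous_on ({0..1} \<times> A) (\<lambda>z. ?h z t)" for t
    by (cases "t \<in> T") (auto intro!: continuous_intros)
  then have "continuous_on ({0..1} \<times> A) ?h" by (rule continuous_on_coordinatewise_then_product)
  then show "continuous_map (prod_topology (top_of_set {0..1}) (top_of_set A)) (top_of_set B) ?h"
    using B by (auto simp: continuous_map_subtopology_eu)
  show "?h (0, x) = f x" for x using ext(1)[of x] by (auto simp: extensional_def)
  show "?h (1, x) = g x" for x using ext(2)[of x] by (auto simp: extensional_def)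
qed simp

lemma contractible_extensional: "contractible (extensional T :: ('v \<Rightarrow> real) set)"
proof -
  let ?a = "restrict (\<lambda>_. 0) T :: 'v \<Rightarrow> real"
  have "homotopic_with_canon (\<lambda>_. True) (extensional T) (extensional T) (\<lambda>x. restrict x T) (\<lambda>x. ?a)"
  proof (rule homotopic_with_linear_RT[where T=T])
    have "continuous_on A (\<lambda>x :: 'v \<Rightarrow> real. restrict x T t)" for t A
      by (cases "t \<in> T") (auto intro: continuous_on_subset[OF continuous_on_product_coordinates])
    then show "continuous_on (extensional T) (\<lambda>x :: 'v \<Rightarrow> real. restrict x T)"
      by (rule continuous_on_coordinatewise_then_product)
  qed (auto simp: extensional_def)
  then have "homotopic_with_canon (\<lambda>_. True) (extensional T) (extensional T) id (\<lambda>x. ?a)"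
    by (rule homotopic_with_eq) (auto simp: extensional_restrict)
  then show ?thesis unfolding contractible_def by blast
qed

text \<open>A continuous selection from open intervals: the average of an enumeration of the rationals
  with weights that are positive exactly on the interval.\<close>

lemma continuous_selection:
  fixes \<psi> :: "'a::topological_space \<Rightarrow> real \<Rightarrow> real"
  assumes cont: "\<And>w. continuous_on A (\<lambda>x. \<psi> x w)" and bd: "\<And>x w. 0 \<le> \<psi> x w" "\<And>x w. \<psi> x w \<le> 1"
    and op: "\<And>x. x \<in> A \<Longrightarrow> open {w. \<psi> x w > 0}" and ne: "\<And>x. x \<in> A \<Longrightarrow> \<exists>w. \<psi> x w > 0"
    and conv: "\<And>x a b c. x \<in> A \<Longrightarrow> \<psi> x a > 0 \<Longrightarrow> \<psi> x b > 0 \<Longrightarrow> a \<le> c \<Longrightarrow> c \<le> b \<Longrightarrow> \<psi> x c > 0"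
  shows "\<exists>s. continuous_on A s \<and> (\<forall>x\<in>A. \<psi> x (s x) > 0)"
proof -
  define r :: "nat \<Rightarrow> real" where "r = from_nat_into \<rat>"
  have r: "range r = \<rat>" unfolding r_def
    by (rule range_from_nat_into) (auto intro: countable_rat)
  \<comment> \<open>The denominator makes both series, with terms \<open>a n\<close> and
    \<open>a n * r n\<close>, dominated by the geometric series.\<close>
  define a where "a n = (1 / 2) ^ n / (1 + \<bar>r n\<bar>)" for n
  have a: "a n > 0" for n by (simp add: a_def add_pos_nonneg)
  have a1: "a n \<le> (1 / 2) ^ n" "\<bar>a n * r n\<bar> \<le> (1 / 2) ^ n" for n
  proof -
    have "(1 / 2) ^ n * 1 \<le> (1 / 2 :: real) ^ n * (1 + \<bar>r n\<bar>)" "(1 / 2) ^ n * \<bar>r n\<bar> \<le> (1 / 2 :: real) ^ n * (1 + \<bar>r n\<bar>)"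
      by (rule mult_left_mono; simp)+
    then show "a n \<le> (1 / 2) ^ n" "\<bar>a n * r n\<bar> \<le> (1 / 2) ^ n"
      by (simp_all add: a_def abs_mult divide_le_eq add_pos_nonneg abs_of_pos[OF add_pos_nonneg])
  qed
  have geo: "summable (\<lambda>n. (1 / 2 :: real) ^ n)" by (rule summable_geometric) simp
  have b: "norm (a n * \<psi> x (r n)) \<le> (1 / 2) ^ n" "norm (a n * r n * \<psi> x (r n)) \<le> (1 / 2) ^ n" for n x
  proof -
    have "\<bar>a n\<bar> * \<bar>\<psi> x (r n)\<bar> \<le> (1 / 2) ^ n * 1" "\<bar>a n * r n\<bar> * \<bar>\<psi> x (r n)\<bar> \<le> (1 / 2) ^ n * 1"
      using a1[of n] a[of n] bd[of x "r n"] by (intro mult_mono; simp)+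
    then show "norm (a n * \<psi> x (r n)) \<le> (1 / 2) ^ n" "norm (a n * r n * \<psi> x (r n)) \<le> (1 / 2) ^ n"
      by (simp_all add: abs_mult)
  qed
  define den where "den x = (suminf (\<lambda>n. a n * \<psi> x (r n)))" for x
  define num where "num x = (suminf (\<lambda>n. a n * r n * \<psi> x (r n)))" for x
  have sm: "summable (\<lambda>n. a n * \<psi> x (r n))" "summable (\<lambda>n. a n * r n * \<psi> x (r n))" for x
    by (rule summable_comparison_test'[OF geo b(1)] summable_comparison_test'[OF geo b(2)])+
  have cden: "continuous_on A den"
  proof (rule uniform_limit_theorem)
    show "uniform_limit A (\<lambda>n x. \<Sum>i<n. a i * \<psi> x (r i)) den sequentially"
      unfolding den_def by (rule Weierstrass_m_test[OF b(1) geo])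
  qed (auto intro!: always_eventually continuous_intros cont)
  have cnum: "continuous_on A num"
  proof (rule uniform_limit_theorem)
    show "uniform_limit A (\<lambda>n x. \<Sum>i<n. a i * r i * \<psi> x (r i)) num sequentially"
      unfolding num_def by (rule Weierstrass_m_test[OF b(2) geo])
  qed (auto intro!: always_eventually continuous_intros cont)
  have hit: "\<exists>n. \<psi> x (r n) > 0" if x: "x \<in> A" for x
  proof -
    obtain w where "w \<in> {w. \<psi> x w > 0}" using ne[OF x] by blast
    then obtain e where e: "e > 0" "ball w e \<subseteq> {w. \<psi> x w > 0}" using op[OF x] open_contains_ball by blast
    obtain q where q: "q \<in> \<rat>" "w < q" "q < w + e" using Rats_dense_in_real[of w "w + e"] e(1) by auto
    then have "q \<in> ball w e" by (simp add: dist_real_def)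
    moreover obtain n where "q = r n" using q(1) r by blast
    ultimately show ?thesis using e(2) by blast
  qed
  have dpos: "den x > 0" if x: "x \<in> A" for x
  proof -
    obtain n where "\<psi> x (r n) > 0" using hit[OF x] by blast
    then show ?thesis unfolding den_def using a bd
      by (intro suminf_pos2[OF sm(1), of _ n]) (auto intro: mult_nonneg_nonneg less_imp_le mult_pos_pos)
  qed
  let ?s = "\<lambda>x. num x / den x"
  \<comment> \<open>If the average lay outside the interval, all rationals of positive weight would
    lie on one side of it, and the weighted sum of their differences to the average could not be
    zero.\<close>
  have "\<psi> x (?s x) > 0" if x: "x \<in> A" for x
  proof (rule ccontr)
    assume n0: "\<not> ?thesis"
    have "(suminf (\<lambda>n. a n * \<psi> x (r n) * (r n - ?s x))) = num x - den x * ?s x"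
    proof -
      have "(\<lambda>n. a n * r n * \<psi> x (r n) - a n * \<psi> x (r n) * ?s x) sums (num x - den x * ?s x)"
        unfolding num_def den_def by (intro sums_diff sums_mult2 summable_sums sm)
      then show ?thesis by (simp add: sums_iff algebra_simps)
    qed
    also have "\<dots> = 0" using dpos[OF x] by simp
    finally have 0: "(suminf (\<lambda>n. a n * \<psi> x (r n) * (r n - ?s x))) = 0" .
    have sm': "summable (\<lambda>n. a n * \<psi> x (r n) * (r n - ?s x))"
    proof -
      have "summable (\<lambda>n. a n * r n * \<psi> x (r n) - a n * \<psi> x (r n) * ?s x)"
        by (intro summable_diff summable_mult2 sm)
      then show ?thesis by (simp add: algebra_simps)
    qed
    obtain n where n: "\<psi> x (r n) > 0" using hit[OF x] by blast
    have nn: "a k * \<psi> x (r k) \<ge> 0" for k using a[of k] bd[of x "r k"] by simp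
    consider "r n < ?s x" | "r n > ?s x" using n n0 by (metis linorder_neqE)
    then show False
    proof cases
      case 1
      have neg: "\<psi> x (r k) > 0 \<Longrightarrow> r k < ?s x" for k
        using conv[OF x n, of "r k" "?s x"] n0 1 by force
      have "a k * \<psi> x (r k) * (?s x - r k) \<ge> 0" for k
      proof (cases "\<psi> x (r k) > 0")
        case True
        then show ?thesis using neg[of k] by (intro mult_nonneg_nonneg[OF nn]) simp
      next
        case False
        then have "\<psi> x (r k) = 0" using bd(1)[of x "r k"] by linarith
        then show ?thesis by simp
      qed
      note nonneg = this
      have pos: "a n * \<psi> x (r n) * (?s x - r n) > 0" using a[of n] n 1 by simp
      have "summable (\<lambda>n. a n * \<psi> x (r n) * (?s x - r n))"
        using summable_minus[OF sm'] by (simp add: algebra_simps)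
      from suminf_pos2[OF this nonneg pos]
      have "suminf (\<lambda>n. a n * \<psi> x (r n) * (?s x - r n)) > 0" .
      moreover have "(suminf (\<lambda>n. a n * \<psi> x (r n) * (?s x - r n))) = - (suminf (\<lambda>n. a n * \<psi> x (r n) * (r n - ?s x)))"
        using suminf_minus[OF sm'] by (simp add: algebra_simps)
      ultimately show False using 0 by simp
    next
      case 2
      have pos: "\<psi> x (r k) > 0 \<Longrightarrow> r k > ?s x" for k
        using conv[OF x, of "r k" "r n" "?s x"] n n0 2 by force
      have "a k * \<psi> x (r k) * (r k - ?s x) \<ge> 0" for k
      proof (cases "\<psi> x (r k) > 0")
        case True
        then show ?thesis using pos[of k] by (intro mult_nonneg_nonneg[OF nn]) simp
      next
        case False
        then have "\<psi> x (r k) = 0" using bd(1)[of x "r k"] by linarith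
        then show ?thesis by simp
      qed
      moreover have "a n * \<psi> x (r n) * (r n - ?s x) > 0" using a[of n] n 2 by simp
      ultimately have "(suminf (\<lambda>n. a n * \<psi> x (r n) * (r n - ?s x))) > 0" by (intro suminf_pos2[OF sm'])
      then show False using 0 by simp
    qed
  qed
  moreover have "continuous_on A ?s"
    by (intro continuous_on_divide cnum cden) (use dpos in force)
  ultimately show ?thesis by blast
qed

text \<open>Thom's lemma. By induction the derivative has constant sign on [a, b], so r is monotone
  there and lies between its end values, which have the same sign.\<close>

lemma thom_sgn:
  fixes r :: "'k::linordered_field poly"
  assumes I: "ivt TYPE('k)" and sg: "\<And>i. sgn (poly ((pderiv ^^ i) r) a) = sgn (poly ((pderiv ^^ i) r) b)"
    and c: "a \<le> c" "c \<le> b"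
  shows "sgn (poly r c) = sgn (poly r a)"
  using sg c
proof (induction "degree r" arbitrary: r c rule: less_induct)
  case less
  show ?case
  proof (cases "degree r = 0")
    case True
    then obtain k where "r = [:k:]" by (auto elim: degree_eq_zeroE)
    then show ?thesis by simp
  next
    case False
    have sg': "sgn (poly ((pderiv ^^ i) (pderiv r)) a) = sgn (poly ((pderiv ^^ i) (pderiv r)) b)" for i
      using less.prems(1)[of "Suc i"] by (simp add: funpow_swap1)
    have d: "sgn (poly (pderiv r) x) = sgn (poly (pderiv r) a)" if "a \<le> x" "x \<le> b" for x
      using less.hyps[OF _ sg' that] False by (simp add: degree_pderiv)
    have ab: "sgn (poly r a) = sgn (poly r b)" using less.prems(1)[of 0] by simp
    show ?thesis
    proof (cases "c = a \<or> c = b")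
      case True
      then show ?thesis using ab by metis
    next
      case False
      then have lt: "a < c" "c < b" using less.prems by auto
      have "sgn (poly r c - poly r a) = sgn (poly (pderiv r) a)"
        by (rule poly_mono_sgn[OF I lt(1)], rule d) (use lt in auto)
      moreover have "sgn (poly r b - poly r c) = sgn (poly (pderiv r) a)"
        by (rule poly_mono_sgn[OF I lt(2)], rule d) (use lt in auto)
      ultimately show ?thesis using ab by (auto simp: sgn_if split: if_splits)
    qed
  qed
qed

text \<open>By Thom's lemma for r' the derivative keeps a nonzero sign between the two points, so r
  would be strictly monotone there although it vanishes at both.\<close>

lemma thom_root_unique:
  fixes r :: "'k::linordered_field poly"
  assumes I: "ivt TYPE('k)" and sg: "\<And>i. sgn (poly ((pderiv ^^ i) r) a) = sgn (poly ((pderiv ^^ i) r) b)"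
    and 0: "poly r a = 0" "poly (pderiv r) a \<noteq> 0"
  shows "a = b"
proof -
  have False if "c < d" "\<And>i. sgn (poly ((pderiv ^^ i) r) c) = sgn (poly ((pderiv ^^ i) r) d)"
    "poly r c = 0" "poly (pderiv r) c \<noteq> 0" for c d
  proof -
    have sg': "sgn (poly ((pderiv ^^ i) (pderiv r)) c) = sgn (poly ((pderiv ^^ i) (pderiv r)) d)" for i
      using that(2)[of "Suc i"] by (simp add: funpow_swap1)
    have "sgn (poly r d - poly r c) = sgn (poly (pderiv r) c)"
      by (rule poly_mono_sgn[OF I that(1)], rule thom_sgn[OF I sg']) auto
    then show False using that(2)[of 0] that(3,4) by (simp add: sgn_0_0)
  qed
  note lt = this
  have e: "sgn (poly r a) = sgn (poly r b)" "sgn (poly (pderiv r) a) = sgn (poly (pderiv r) b)"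
    using sg[of 0] sg[of 1] by simp_all
  then have b: "poly r b = 0" "poly (pderiv r) b \<noteq> 0" using 0 by (metis sgn_0_0)+
  show ?thesis
  proof (rule ccontr)
    assume "a \<noteq> b"
    then consider "a < b" | "b < a" by (metis linorder_neqE)
    then show False
      by cases (use lt[of a b] lt[of b a] sg 0 b in \<open>metis+\<close>)
  qed
qed

section \<open>Cells around a generic point\<close>

definition cell :: "'v set \<Rightarrow> ('v, rat) mpoly set \<Rightarrow> ('v \<Rightarrow> real) set" where
  "cell T S = {x \<in> extensional T. \<forall>p\<in>S. reval x p > 0}"

lemma cell_mono: "S \<subseteq> S' \<Longrightarrow> cell T S' \<subseteq> cell T S"
  by (auto simp: cell_def)

lemma openin_cell:
  fixes S :: "('v, rat) mpoly set"
  assumes "finite S"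
  shows "openin (powertop_real T) (cell T S)"
proof -
  have "open (\<Inter>p\<in>S. {x :: 'v \<Rightarrow> real. 0 < reval x p})"
    by (intro open_INT assms ballI open_Collect_less continuous_on_reval continuous_on_const)
  moreover have "cell T S = extensional T \<inter> (\<Inter>p\<in>S. {x. 0 < reval x p})" by (auto simp: cell_def)
  ultimately show ?thesis unfolding powertop_real_eq_top_of_set by (metis openin_open)
qed

lemma Q_semialgebraic_cell:
  assumes "finite S" "\<And>p. p \<in> S \<Longrightarrow> mpoly_vars p \<subseteq> T"
  shows "Q_semialgebraic T (cell T S)"
  using assms
proof (induction S)
  case empty
  have "Q_semialgebraic T {x \<in> topspace (powertop_real T). reval x 0 \<ge> 0}"
    by (rule Q_semialgebraic.greater_eq) simp
  also have "{x \<in> topspace (powertop_real T). reval x 0 \<ge> 0} = cell T {}"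
    unfolding topspace_RT reval_simps by (auto simp: cell_def)
  finally show ?case .
next
  case (insert p S)
  have "Q_semialgebraic T ({x \<in> topspace (powertop_real T). reval x p > 0} \<inter> cell T S)"
    using insert by (intro Q_semialgebraic.inter Q_semialgebraic.greater) auto
  moreover have "cell T (insert p S) = {x \<in> topspace (powertop_real T). reval x p > 0} \<inter> cell T S"
    unfolding topspace_RT by (auto simp: cell_def)
  ultimately show ?case by simp
qed

lemma extensional_upd: "x \<in> extensional T \<Longrightarrow> t \<in> T \<Longrightarrow> x(t := w) \<in> extensional T"
  by (auto simp: extensional_def)

lemma mpoly_vars_empty_const: "mpoly_vars p \<subseteq> {} \<Longrightarrow> \<exists>c. p = mconst c" for p :: "('v, 'a::comm_ring_1) mpoly"
proof (induction p rule: mpoly_induct)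
  case (add p q)
  then show ?case using cring_hom.add[OF cring_hom_mconst] by metis
next
  case (mult p q)
  then show ?case using cring_hom.mult[OF cring_hom_mconst] by metis
qed auto

locale generic_point =
  fixes T :: "'v::linorder set" and \<tau> :: "'v \<Rightarrow> 'k::linordered_field"
  assumes I: "ivt TYPE('k)"
    and generic: "mpoly_vars p \<subseteq> T \<Longrightarrow> reval \<tau> p = 0 \<Longrightarrow> p = (0 :: ('v, rat) mpoly)"
begin

lemma I_real: "ivt TYPE(real)"
  unfolding ivt_def
proof (intro allI impI)
  fix p :: "real poly" and a b :: real
  assume ab: "a < b" and neg: "poly p a * poly p b < 0"
  then consider "poly p a < 0" "0 < poly p b" | "poly p a > 0" "0 > poly p b"
    by (auto simp: mult_less_0_iff)
  then show "\<exists>c. a < c \<and> c < b \<and> poly p c = 0"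
    by cases (use poly_IVT_pos[OF ab, of p] poly_IVT_neg[OF ab, of p] in auto)
qed

text \<open>\<open>positive S\<close>: the cell of \<open>S\<close>, interpreted over \<open>'k\<close>, contains the generic point \<open>\<tau>\<close>.\<close>

definition positive :: "('v, rat) mpoly set \<Rightarrow> bool" where
  "positive S \<longleftrightarrow> finite S \<and> (\<forall>p\<in>S. mpoly_vars p \<subseteq> T \<and> reval \<tau> p > 0)"

text \<open>A nonzero q in the variables T is represented by whichever of q and -q is positive at
  \<tau>. The cell of \<open>signed Q\<close> thus consists of the points where all members of
  \<open>Q\<close> have the same signs as at \<tau>.\<close>

definition signed :: "('v, rat) mpoly set \<Rightarrow> ('v, rat) mpoly set" where
  "signed Q = {p \<in> Q \<union> uminus ` Q. reval \<tau> p > 0}"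

lemma positive_union: "positive S \<Longrightarrow> positive S' \<Longrightarrow> positive (S \<union> S')"
  by (auto simp: positive_def)

lemma signed_vars:
  assumes "\<And>q. q \<in> Q \<Longrightarrow> mpoly_vars q \<subseteq> V" "p \<in> signed Q"
  shows "mpoly_vars p \<subseteq> V"
proof -
  obtain q where "q \<in> Q" "p = q \<or> p = - q" using assms(2) by (auto simp: signed_def)
  then show ?thesis using assms(1)[of q] by auto
qed

lemma positive_signed:
  assumes "finite Q" "\<And>q. q \<in> Q \<Longrightarrow> mpoly_vars q \<subseteq> T"
  shows "positive (signed Q)"
  using assms(1) signed_vars[OF assms(2)] by (auto simp: positive_def signed_def)

text \<open>Strict inequalities fix all signs, because only the zero polynomial vanishes at a
  generic point.\<close>

lemma signed_same_sgn:
  assumes pos: "\<And>p. p \<in> signed Q \<Longrightarrow> reval y p > (0 :: real)" and q: "q \<in> Q" "mpoly_vars q \<subseteq> T"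
  shows "same_sgn (reval \<tau> q) (reval y q)"
proof -
  consider "reval \<tau> q > 0" | "reval \<tau> q = 0" | "reval \<tau> (- q) > 0"
    by (auto simp: reval_simps intro: linorder_cases)
  then show ?thesis
  proof cases
    case 1
    then have "reval y q > 0" using q by (intro pos) (simp add: signed_def)
    then show ?thesis using 1 by (simp add: same_sgn_def)
  next
    case 2
    then have "q = 0" using generic q by blast
    then show ?thesis by (simp add: reval_simps)
  next
    case 3
    then have "reval y (- q) > 0" using q by (intro pos) (simp add: signed_def)
    then show ?thesis using 3 by (simp add: same_sgn_def reval_simps)
  qed
qed

lemma reval_section:
  fixes q :: "('v, rat) mpoly poly" and x :: "'v \<Rightarrow> 'f::field_char_0"
  assumes "\<And>n. mpoly_vars (coeff q n) \<subseteq> V" "t \<notin> V"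
  shows "reval (x(t := w)) (poly q (mvar t)) = poly (map_poly (reval x) q) w"
proof -
  have "map_poly (reval (x(t := w))) q = map_poly (reval x) q"
  proof (rule poly_eqI)
    fix n
    have "reval (x(t := w)) (coeff q n) = reval x (coeff q n)"
      by (rule mpoly_eval_cong) (use assms in auto)
    then show "coeff (map_poly (reval (x(t := w))) q) n = coeff (map_poly (reval x) q) n"
      by (simp add: cring_hom.coeff_map[OF reval_hom])
  qed
  then show ?thesis
    using cring_hom.poly_map_poly[OF reval_hom, of "x(t := w)" q "mvar t"]
    by (simp add: reval_simps)
qed

lemma poly_mvar_vars:
  fixes q :: "('v, rat) mpoly poly"
  assumes "\<And>n. mpoly_vars (coeff q n) \<subseteq> V"
  shows "mpoly_vars (poly q (mvar t)) \<subseteq> insert t (V :: 'v set)"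
  using assms
proof (induction q)
  case (pCons a q)
  have "mpoly_vars a \<subseteq> V" using pCons.prems[of 0] by simp
  moreover have "mpoly_vars (coeff q n) \<subseteq> V" for n using pCons.prems[of "Suc n"] by simp
  then have "mpoly_vars (mvar t * poly q (mvar t)) \<subseteq> insert t V"
    using pCons.IH mpoly_vars_mult[of "mvar t" "poly q (mvar t)"] by auto
  ultimately show ?case using mpoly_vars_add[of a "mvar t * poly q (mvar t)"] by auto
qed simp

lemma pderivs_vars:
  fixes q :: "('v, rat) mpoly poly"
  assumes "\<And>n. mpoly_vars (coeff q n) \<subseteq> V"
  shows "mpoly_vars (coeff ((pderiv ^^ i) q) n) \<subseteq> (V :: 'v set)"
  using assms
proof (induction i arbitrary: n)
  case (Suc i)
  have eq: "coeff ((pderiv ^^ Suc i) q) n = mconst (of_nat (Suc n)) * coeff ((pderiv ^^ i) q) (Suc n)"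
    by (simp only: funpow.simps o_apply coeff_pderiv cring_hom.of_nat[OF cring_hom_mconst])
  show ?case unfolding eq
    by (rule subset_trans[OF mpoly_vars_mult]) (use Suc in simp)
qed simp

lemma pderivs_zero: "degree q < i \<Longrightarrow> (pderiv ^^ i) q = (0 :: ('v, rat) mpoly poly)"
proof (induction i arbitrary: q)
  case (Suc i)
  show ?case
  proof (cases "degree q = 0")
    case True
    then have "pderiv q = 0" by (simp add: pderiv_eq_0_iff)
    moreover have "(pderiv ^^ i) (0 :: ('v, rat) mpoly poly) = 0" by (induction i) simp_all
    ultimately show ?thesis by (simp add: funpow_swap1)
  next
    case False
    then have "degree (pderiv q) < i" using Suc.prems by (simp add: degree_pderiv)
    then show ?thesis using Suc.IH by (simp add: funpow_swap1)
  qed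
qed simp

lemma map_pderivs: "map_poly (reval x) ((pderiv ^^ i) q) = (pderiv ^^ i) (map_poly (reval x) q)"
  for x :: "'v \<Rightarrow> 'f::field_char_0"
  by (induction i) (simp_all add: cring_hom_pderiv[OF reval_hom])

text \<open>Adding all derivatives of \<open>S\<close> with respect to \<open>t\<close> makes the fibres of the cell over the
  remaining coordinates convex, by Thom's lemma.\<close>

lemma thom_closure:
  assumes S: "positive S" "\<forall>p\<in>S. mpoly_vars p \<subseteq> insert t V" and tV: "t \<notin> V" "insert t V \<subseteq> T"
  shows "\<exists>S1. S \<subseteq> S1 \<and> positive S1 \<and> (\<forall>p\<in>S1. mpoly_vars p \<subseteq> insert t V) \<and>
    (\<forall>x :: 'v \<Rightarrow> real. \<forall>a b c. (\<forall>p\<in>S1. reval (x(t := a)) p > 0) \<longrightarrow> (\<forall>p\<in>S1. reval (x(t := b)) p > 0) \<longrightarrow> a \<le> c \<longrightarrow> c \<le> b \<longrightarrow>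
      (\<forall>p\<in>S1. reval (x(t := c)) p > 0))"
proof -
  define \<kappa> :: "('v, rat) mpoly \<Rightarrow> ('v, rat) mpoly poly"
    where "\<kappa> = uni (\<lambda>u. if u = t then [:0, 1:] else [:mvar u:])"
  have \<kappa>v: "mpoly_vars (coeff (\<kappa> p) n) \<subseteq> V" if "p \<in> S" for p n
    unfolding \<kappa>_def using bspec[OF S(2) that] by (rule coeff_uni_vars) (auto simp: coeff_pCons split: nat.splits)
  define D where "D p i = poly ((pderiv ^^ i) (\<kappa> p)) (mvar t)" for p i
  have Dv: "mpoly_vars (D p i) \<subseteq> insert t V" if "p \<in> S" for p i
    unfolding D_def by (intro poly_mvar_vars pderivs_vars \<kappa>v that)
  have D0: "D p 0 = p" for p
  proof -
    have hom: "cring_hom (\<lambda>q :: ('v, rat) mpoly poly. poly q (mvar t))" by unfold_locales simp_all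
    have "poly (\<kappa> p) (mvar t) = mpoly_eval (\<lambda>r. poly [:mconst r:] (mvar t))
        (\<lambda>u. poly (if u = t then [:0, 1:] else [:mvar u:] :: ('v, rat) mpoly poly) (mvar t)) p"
      unfolding \<kappa>_def uni_def by (rule mpoly_eval_comp[OF hom])
    also have "(\<lambda>u. poly (if u = t then [:0, 1:] else [:mvar u:] :: ('v, rat) mpoly poly) (mvar t)) = mvar" by (rule ext) simp
    finally show ?thesis by (simp add: D_def mpoly_eval_self)
  qed
  have Deval: "reval (x(t := w)) (D p i) = poly ((pderiv ^^ i) (map_poly (reval x) (\<kappa> p))) w"
    if "p \<in> S" for x :: "'v \<Rightarrow> real" and w p i
    unfolding D_def map_pderivs[symmetric]
    by (rule reval_section[OF pderivs_vars[OF \<kappa>v[OF that]] tV(1)])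
  \<comment> \<open>Order zero is included, so that \<open>S\<close> is contained in
    \<open>signed E\<close>; beyond the degree the derivatives are zero.\<close>
  define E where "E = (\<Union>p\<in>S. D p ` {..degree (\<kappa> p)})"
  have E: "finite E" "\<And>q. q \<in> E \<Longrightarrow> mpoly_vars q \<subseteq> insert t V"
    using S(1) Dv by (auto simp: E_def positive_def)
  have DE: "D p i \<in> E \<or> D p i = 0" if "p \<in> S" for p i
  proof (cases "i \<le> degree (\<kappa> p)")
    case True
    then show ?thesis using that by (auto simp: E_def)
  next
    case False
    then show ?thesis by (simp add: D_def pderivs_zero)
  qed
  show ?thesis
  proof (intro exI[of _ "signed E"] conjI ballI allI impI)
    show "S \<subseteq> signed E"
    proof
      fix p assume p: "p \<in> S"
      then have "D p 0 \<in> E" by (auto simp: E_def)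
      then show "p \<in> signed E" using p S(1) by (auto simp: signed_def D0 positive_def)
    qed
    show "positive (signed E)" using E tV by (intro positive_signed) auto
    show "mpoly_vars p \<subseteq> insert t V" if "p \<in> signed E" for p using signed_vars[OF E(2) that] .
    fix x :: "'v \<Rightarrow> real" and a b c q
    assume a: "\<forall>p\<in>signed E. reval (x(t := a)) p > 0" and b: "\<forall>p\<in>signed E. reval (x(t := b)) p > 0"
      and c: "a \<le> c" "c \<le> b" and q: "q \<in> signed E"
    have ss: "sgn (reval (x(t := a)) e) = sgn (reval (x(t := b)) e)" if "e \<in> E" for e
    proof -
      have "same_sgn (reval \<tau> e) (reval (x(t := a)) e)" "same_sgn (reval \<tau> e) (reval (x(t := b)) e)"
        using a b E(2)[OF that] tV that by (auto intro!: signed_same_sgn[of E])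
      then show ?thesis by (meson same_sgn_sym same_sgn_trans1)
    qed
    have key: "sgn (reval (x(t := c)) e) = sgn (reval (x(t := a)) e)" if e: "e \<in> E" for e
    proof -
      obtain p i where pi: "p \<in> S" "e = D p i" using e by (auto simp: E_def)
      let ?r = "(pderiv ^^ i) (map_poly (reval x) (\<kappa> p))"
      have "sgn (poly ?r c) = sgn (poly ?r a)"
      proof (rule thom_sgn[OF I_real _ c])
        fix j
        \<comment> \<open>Derivatives of a derivative of p belong to the same family, so Thom's
          lemma applies to every member of \<open>E\<close>.\<close>
        have "(pderiv ^^ j) ?r = (pderiv ^^ (j + i)) (map_poly (reval x) (\<kappa> p))" by (simp add: funpow_add)
        then have *: "poly ((pderiv ^^ j) ?r) w = reval (x(t := w)) (D p (j + i))" for w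
          using Deval[OF pi(1)] by simp
        show "sgn (poly ((pderiv ^^ j) ?r) a) = sgn (poly ((pderiv ^^ j) ?r) b)"
          unfolding * using DE[OF pi(1), of "j + i"] ss by (auto simp: reval_simps)
      qed
      then show ?thesis using Deval[OF pi(1)] pi(2) by simp
    qed
    have qa: "reval (x(t := a)) q > 0" using a q by blast
    from q consider "q \<in> E" | e where "e \<in> E" "q = - e" by (auto simp: signed_def)
    then show "reval (x(t := c)) q > 0"
    proof cases
      case 1
      then show ?thesis using key[OF 1] qa by (metis sgn_greater)
    next
      case 2
      then have "sgn (reval (x(t := c)) e) = sgn (reval (x(t := a)) e)" using key by blast
      then have "sgn (reval (x(t := c)) q) = sgn (reval (x(t := a)) q)"
        by (simp add: 2 reval_simps sgn_minus)
      then show ?thesis using qa by (metis sgn_greater)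
    qed
  qed
qed

text \<open>The cell of \<open>S3\<close> is a cylinder in direction t, and the new cell is a part
  of it whose fibres are nonempty open intervals. A continuous selection s gives the map x |-> x(t
  := s x) into the new cell. The identity is deformed into this map along the fibres, and the map
  into a constant by the contraction of the cylinder.\<close>

lemma cell_extend:
  assumes S3: "contractible (cell T S3)" "cell T S3 \<noteq> {}" "\<And>p. p \<in> S3 \<Longrightarrow> mpoly_vars p \<subseteq> V"
    and S1: "finite S1" and tV: "t \<notin> V" "t \<in> T"
    and ne: "\<And>x. x \<in> cell T S3 \<Longrightarrow> \<exists>w. \<forall>p\<in>S1. reval (x(t := w)) p > 0"
    and conv: "\<And>x a b c. \<forall>p\<in>S1. reval (x(t := a)) p > (0::real) \<Longrightarrow> \<forall>p\<in>S1. reval (x(t := b)) p > 0 \<Longrightarrow> a \<le> c \<Longrightarrow> c \<le> b \<Longrightarrow>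
      \<forall>p\<in>S1. reval (x(t := c)) p > 0"
  shows "contractible (cell T (S1 \<union> S3))" "cell T (S1 \<union> S3) \<noteq> {}"
proof -
  let ?C = "cell T S3" and ?D = "cell T (S1 \<union> S3)"
  have upd: "x(t := w) \<in> ?C" if "x \<in> ?C" for x w
  proof -
    have "reval (x(t := w)) p = reval x p" if "p \<in> S3" for p
      by (rule mpoly_eval_cong) (use S3(3)[OF that] tV in auto)
    then show ?thesis using that extensional_upd[OF _ tV(2), of x w] by (auto simp: cell_def)
  qed
  have D: "x(t := w) \<in> ?D \<longleftrightarrow> (\<forall>p\<in>S1. reval (x(t := w)) p > 0)" if "x \<in> ?C" for x w
    using upd[OF that, of w] by (auto simp: cell_def)
  \<comment> \<open>Continuous in x, with values in [0, 1] and positive exactly on the fibre, as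
    \<open>continuous_selection\<close> requires.\<close>
  define \<psi> where "\<psi> x w = (\<Prod>p\<in>S1. min 1 (max 0 (reval (x(t := w)) p)))" for x :: "'v \<Rightarrow> real" and w
  have \<psi>0: "\<psi> x w > 0 \<longleftrightarrow> (\<forall>p\<in>S1. reval (x(t := w)) p > 0)" for x w
  proof
    assume "\<psi> x w > 0"
    then have "\<psi> x w \<noteq> 0" by simp
    then have "\<forall>p\<in>S1. min 1 (max 0 (reval (x(t := w)) p)) \<noteq> 0" using S1 by (simp add: \<psi>_def)
    then show "\<forall>p\<in>S1. reval (x(t := w)) p > 0"
      by (intro ballI) (drule (1) bspec, simp add: min_def max_def split: if_splits)
  next
    assume "\<forall>p\<in>S1. reval (x(t := w)) p > 0"
    then show "\<psi> x w > 0" unfolding \<psi>_def by (intro prod_pos) auto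
  qed
  have cu: "continuous_on A (\<lambda>x. x(t := f x))" if "continuous_on A f" for A :: "('v \<Rightarrow> real) set" and f
  proof (rule continuous_on_coordinatewise_then_product)
    fix i
    show "continuous_on A (\<lambda>x. (x(t := f x)) i)"
      using that by (cases "i = t") (auto intro: continuous_on_subset[OF continuous_on_product_coordinates])
  qed
  have cr: "continuous_on A (\<lambda>x. reval (x(t := w)) p)" for A :: "('v \<Rightarrow> real) set" and w and p :: "('v, rat) mpoly"
  proof -
    have "continuous_on A ((\<lambda>x. reval x p) \<circ> (\<lambda>x. x(t := w)))"
      by (intro continuous_on_compose cu continuous_on_const continuous_on_reval)
    then show ?thesis by (simp add: o_def)
  qed
  have "\<exists>s. continuous_on ?C s \<and> (\<forall>x\<in>?C. \<psi> x (s x) > 0)"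
  proof (rule continuous_selection)
    show "continuous_on ?C (\<lambda>x. \<psi> x w)" for w
      unfolding \<psi>_def by (intro continuous_intros cr)
    show "0 \<le> \<psi> x w" "\<psi> x w \<le> 1" for x w unfolding \<psi>_def by (auto intro: prod_nonneg prod_le_1)
    have cw: "continuous_on UNIV (\<lambda>w. reval (x(t := w)) p)" for x :: "'v \<Rightarrow> real" and p
      by (intro continuous_at_imp_continuous_on ballI) (rule DERIV_isCont[OF reval_has_derivative])
    show "open {w. \<psi> x w > 0}" for x
    proof -
      have "{w. \<psi> x w > 0} = (\<Inter>p\<in>S1. {w. 0 < reval (x(t := w)) p})" unfolding \<psi>0 by auto
      moreover have "open \<dots>"
        by (intro open_INT S1 ballI open_Collect_less continuous_on_const cw)
      ultimately show ?thesis by simp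
    qed
    show "\<exists>w. \<psi> x w > 0" if "x \<in> ?C" for x using ne[OF that] unfolding \<psi>0 .
    show "\<psi> x c > 0" if "\<psi> x a > 0" "\<psi> x b > 0" "a \<le> c" "c \<le> b" for x a b c
      using conv[OF _ _ that(3,4), of x] that(1,2) unfolding \<psi>0 by blast
  qed
  then obtain s where s: "continuous_on ?C s" "\<And>x. x \<in> ?C \<Longrightarrow> \<psi> x (s x) > 0" by blast
  let ?r = "\<lambda>x. x(t := s x)"
  have rD: "?r x \<in> ?D" if "x \<in> ?C" for x using D[OF that] s(2)[OF that] unfolding \<psi>0 by blast
  then show "?D \<noteq> {}" using S3(2) by blast
  have DC: "?D \<subseteq> ?C" by (rule cell_mono) auto
  have cr: "continuous_on ?C ?r" by (rule cu[OF s(1)])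
  obtain a where a: "homotopic_with_canon (\<lambda>x. True) ?C ?C id (\<lambda>x. a)"
    using S3(1) unfolding contractible_def by blast
  have "homotopic_with_canon (\<lambda>x. True) ?C ?D (?r \<circ> id) (?r \<circ> (\<lambda>x. a))"
    by (rule homotopic_with_compose_continuous_map_left[OF a])
      (use cr rD in \<open>auto simp: continuous_map_subtopology_eu\<close>)
  then have "homotopic_with_canon (\<lambda>x. True) ?D ?D ((?r \<circ> id) \<circ> id) ((?r \<circ> (\<lambda>x. a)) \<circ> id)"
    by (rule homotopic_with_compose_continuous_map_right)
      (use DC in \<open>auto simp: continuous_map_subtopology_eu\<close>)
  then have 1: "homotopic_with_canon (\<lambda>x. True) ?D ?D ?r (\<lambda>_. ?r a)" by (simp add: o_def)
  \<comment> \<open>The identity on the cell, but with extensional values everywhere, as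
    \<open>homotopic_with_linear_RT\<close> requires.\<close>
  define e where "e x = restrict x T" for x :: "'v \<Rightarrow> real"
  have ce: "continuous_on A e" for A
    unfolding e_def
  proof (rule continuous_on_coordinatewise_then_product)
    fix i
    show "continuous_on A (\<lambda>x. restrict x T i)"
      by (cases "i \<in> T") (auto intro: continuous_on_subset[OF continuous_on_product_coordinates])
  qed
  have eD: "e x = x" if "x \<in> ?C" for x using that by (simp add: cell_def e_def extensional_restrict)
  have "homotopic_with_canon (\<lambda>_. True) ?D ?D e (\<lambda>x. e (?r x))"
  proof (rule homotopic_with_linear_RT[where T=T])
    show "continuous_on ?D (\<lambda>x. e (?r x))"
      by (rule continuous_on_compose2[OF ce[of UNIV] continuous_on_subset[OF cr DC]]) simp
    fix x l assume x: "x \<in> ?D" and l: "0 \<le> (l::real)" "l \<le> 1"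
    have xC: "x \<in> ?C" using x DC by blast
    have xe: "x \<in> extensional T" using x by (simp add: cell_def)
    let ?w = "(1 - l) * x t + l * s x"
    have eq: "(\<lambda>u. if u \<in> T then (1 - l) * e x u + l * e (?r x) u else undefined) = x(t := ?w)"
      using xe tV(2) by (auto simp: e_def fun_eq_iff extensional_def algebra_simps)
    have p1: "\<forall>p\<in>S1. reval (x(t := x t)) p > 0" using x by (simp add: cell_def)
    have p2: "\<forall>p\<in>S1. reval (x(t := s x)) p > 0" using s(2)[OF xC] unfolding \<psi>0 .
    have "\<forall>p\<in>S1. reval (x(t := ?w)) p > 0"
    proof (cases "x t \<le> s x")
      case True
      have "l * x t \<le> l * s x" "(1 - l) * x t \<le> (1 - l) * s x" using True l by (auto intro: mult_left_mono)
      then have "x t \<le> ?w" "?w \<le> s x" by (simp_all add: algebra_simps)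
      then show ?thesis by (rule conv[OF p1 p2])
    next
      case False
      then have "l * s x \<le> l * x t" "(1 - l) * s x \<le> (1 - l) * x t" using l by (auto intro: mult_left_mono)
      then have "s x \<le> ?w" "?w \<le> x t" by (simp_all add: algebra_simps)
      then show ?thesis by (rule conv[OF p2 p1])
    qed
    then show "(\<lambda>u. if u \<in> T then (1 - l) * e x u + l * e (?r x) u else undefined) \<in> ?D"
      unfolding eq D[OF xC] .
  qed (auto simp: e_def intro: ce[unfolded e_def])
  then have "homotopic_with_canon (\<lambda>_. True) ?D ?D id ?r"
    by (rule homotopic_with_eq) (use eD DC upd in \<open>auto simp: eD subsetD\<close>)
  from homotopic_with_trans[OF this 1] show "contractible ?D" unfolding contractible_def by blast
qed

text \<open>Induction over the variables. The derivatives in \<open>S1\<close> make the fibres in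
  direction t convex. Transfer from \<tau> makes them nonempty wherever the polynomials
  \<open>Q\<close> in the remaining variables have the same signs as at \<tau>, and the induction
  hypothesis supplies a contractible cell inside that region.\<close>

theorem contractible_refinement:
  assumes "finite V" "V \<subseteq> T" "positive S" "\<And>p. p \<in> S \<Longrightarrow> mpoly_vars p \<subseteq> V"
  shows "\<exists>S'. S \<subseteq> S' \<and> positive S' \<and> (\<forall>p\<in>S'. mpoly_vars p \<subseteq> V) \<and> cell T S' \<noteq> {} \<and> contractible (cell T S')"
  using assms
proof (induction V arbitrary: S rule: finite_induct)
  case empty
  have "cell T S = extensional T"
  proof -
    have "reval x p > 0" if pS: "p \<in> S" for x :: "'v \<Rightarrow> real" and p
    proof -
      obtain c where c: "p = mconst c" using mpoly_vars_empty_const empty.prems(3)[OF pS] by blast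
      have "reval \<tau> p > 0" using empty.prems(2) pS by (simp add: positive_def)
      then show ?thesis by (simp add: c reval_simps)
    qed
    then show ?thesis by (auto simp: cell_def)
  qed
  moreover have "(\<lambda>_. undefined) \<in> extensional T" by (simp add: extensional_def)
  ultimately show ?case using empty.prems contractible_extensional[of T] by (intro exI[of _ S]) auto
next
  case (insert t V)
  have "\<forall>p\<in>S. mpoly_vars p \<subseteq> insert t V" using insert.prems(3) by blast
  from thom_closure[OF insert.prems(2) this insert.hyps(2) insert.prems(1)]
  obtain S1 where S1: "S \<subseteq> S1" "positive S1" "\<forall>p\<in>S1. mpoly_vars p \<subseteq> insert t V"
    and conv: "\<forall>x :: 'v \<Rightarrow> real. \<forall>a b c. (\<forall>p\<in>S1. reval (x(t := a)) p > 0) \<longrightarrow>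
      (\<forall>p\<in>S1. reval (x(t := b)) p > 0) \<longrightarrow> a \<le> c \<longrightarrow> c \<le> b \<longrightarrow> (\<forall>p\<in>S1. reval (x(t := c)) p > 0)"
    by (elim exE conjE)
  note conv' = conv[THEN spec, THEN spec, THEN spec, THEN spec, THEN mp, THEN mp, THEN mp, THEN mp]
  have fin1: "finite S1" using S1(2) by (simp add: positive_def)
  have "\<exists>Q. finite Q \<and> (\<forall>q\<in>Q. mpoly_vars q \<subseteq> V) \<and>
    (\<forall>(x :: 'v \<Rightarrow> 'k) (y :: 'v \<Rightarrow> real). (\<forall>q\<in>Q. same_sgn (reval x q) (reval y q)) \<longrightarrow>
      (\<forall>z. \<exists>w. \<forall>p\<in>S1. same_sgn (reval (x(t := z)) p) (reval (y(t := w)) p)))"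
    by (rule mpoly_transfer[OF I I_real fin1 _ insert.hyps(2)]) (rule bspec[OF S1(3)])
  then obtain Q where Q: "finite Q" "\<forall>q\<in>Q. mpoly_vars q \<subseteq> V"
    and tr: "\<forall>(x :: 'v \<Rightarrow> 'k) (y :: 'v \<Rightarrow> real). (\<forall>q\<in>Q. same_sgn (reval x q) (reval y q)) \<longrightarrow>
      (\<forall>z. \<exists>w. \<forall>p\<in>S1. same_sgn (reval (x(t := z)) p) (reval (y(t := w)) p))"
    by (elim exE conjE)
  have VT: "V \<subseteq> T" "t \<in> T" using insert.prems(1) by auto
  have "positive (signed Q)" using Q(1) bspec[OF Q(2)] VT by (intro positive_signed) blast+
  note posQ = this
  have sv: "mpoly_vars p \<subseteq> V" if p: "p \<in> signed Q" for p
    by (rule signed_vars[OF _ p]) (rule bspec[OF Q(2)])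
  have "\<exists>S'. signed Q \<subseteq> S' \<and> positive S' \<and> (\<forall>p\<in>S'. mpoly_vars p \<subseteq> V) \<and> cell T S' \<noteq> {} \<and> contractible (cell T S')"
    by (rule insert.IH[OF VT(1) posQ]) (rule sv)
  then obtain S3 where S3: "signed Q \<subseteq> S3" "positive S3" "\<forall>p\<in>S3. mpoly_vars p \<subseteq> V"
    "cell T S3 \<noteq> {}" "contractible (cell T S3)" by (elim exE conjE)
  have ne: "\<exists>w. \<forall>p\<in>S1. reval (x(t := w)) p > 0" if x: "x \<in> cell T S3" for x
  proof -
    have "same_sgn (reval \<tau> q) (reval x q)" if q: "q \<in> Q" for q
    proof (rule signed_same_sgn[OF _ q])
      show "reval x p > 0" if "p \<in> signed Q" for p
      proof -
        have "p \<in> S3" using that S3(1) by blast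
        then show ?thesis using x by (simp add: cell_def)
      qed
      show "mpoly_vars q \<subseteq> T" using bspec[OF Q(2) q] VT(1) by (rule subset_trans)
    qed
    \<comment> \<open>The value \<open>\<tau> t\<close>, which satisfies the inequalities of
      \<open>S1\<close> over the field of \<tau>, is transferred to the fibre over x.\<close>
    then obtain w where w: "\<forall>p\<in>S1. same_sgn (reval (\<tau>(t := \<tau> t)) p) (reval (x(t := w)) p)"
      using tr by blast
    have "reval (x(t := w)) p > 0" if "p \<in> S1" for p
      using w S1(2) that by (auto simp: positive_def same_sgn_def)
    then show ?thesis by blast
  qed
  have "contractible (cell T (S1 \<union> S3))" "cell T (S1 \<union> S3) \<noteq> {}"
    by (rule cell_extend[OF S3(5,4) bspec[OF S3(3)] fin1 insert.hyps(2) VT(2) ne conv']; assumption)+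
  moreover have "positive (S1 \<union> S3)" using S1(2) S3(2) by (rule positive_union)
  moreover have "mpoly_vars p \<subseteq> insert t V" if "p \<in> S1 \<union> S3" for p using that S1(3) S3(3) by blast
  ultimately show ?case using S1(1) by (intro exI[of _ "S1 \<union> S3"]) blast
qed

end

section \<open>Analytic functions on \<open>\<real>\<^sup>T\<close>\<close>

lemma open_box:
  fixes V :: "('v \<Rightarrow> real) set"
  assumes "open V" "y0 \<in> V"
  shows "\<exists>F r. finite F \<and> r > 0 \<and> (\<forall>y. (\<forall>t\<in>F. \<bar>y t - y0 t\<bar> < r) \<longrightarrow> y \<in> V)"
proof -
  have "openin (powertop_real UNIV) V" using assms(1) by (simp add: euclidean_product_topology)
  then obtain U where U: "finite {i \<in> UNIV. U i \<noteq> topspace euclideanreal}" "\<forall>i\<in>UNIV. openin euclideanreal (U i)"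
    "y0 \<in> Pi\<^sub>E UNIV U" "Pi\<^sub>E UNIV U \<subseteq> V"
    using assms(2) unfolding openin_product_topology_alt by blast
  define F where "F = {i. U i \<noteq> UNIV}"
  have F: "finite F" using U(1) by (simp add: F_def)
  have "\<exists>r>0. ball (y0 i) r \<subseteq> U i" for i
    using U(2,3) by (auto simp: PiE_iff open_contains_ball)
  then obtain r where r: "\<And>i. r i > 0" "\<And>i. ball (y0 i) (r i) \<subseteq> U i" by metis
  define m where "m = Min (insert 1 (r ` F))"
  have m: "m > 0" "\<And>i. i \<in> F \<Longrightarrow> m \<le> r i" using F r(1) by (auto simp: m_def)
  have "y \<in> V" if y: "\<forall>t\<in>F. \<bar>y t - y0 t\<bar> < m" for y
  proof -
    have "y i \<in> U i" for i
    proof (cases "i \<in> F")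
      case True
      then have "dist (y0 i) (y i) < r i" using y m(2)[OF True] by (force simp: dist_real_def abs_minus_commute)
      then show ?thesis using r(2) by (auto simp: subset_iff)
    qed (simp add: F_def)
    then show ?thesis using U(4) by (auto simp: PiE_iff)
  qed
  then show ?thesis using F m(1) by blast
qed

lemma openin_box:
  assumes "finite F"
  shows "openin (powertop_real T) {x \<in> extensional T. \<forall>t\<in>F. \<bar>x t - a t\<bar> < (r :: real)}"
proof -
  have "open (\<Inter>t\<in>F. {x :: 'a \<Rightarrow> real. \<bar>x t - a t\<bar> < r})"
    by (intro open_INT assms ballI open_Collect_less continuous_intros
        continuous_on_subset[OF continuous_on_product_coordinates]) auto
  then have "openin (top_of_set (extensional T)) (extensional T \<inter> (\<Inter>t\<in>F. {x :: 'a \<Rightarrow> real. \<bar>x t - a t\<bar> < r}))"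
    by (rule openin_open_Int)
  moreover have "extensional T \<inter> (\<Inter>t\<in>F. {x. \<bar>x t - a t\<bar> < r}) = {x \<in> extensional T. \<forall>t\<in>F. \<bar>x t - a t\<bar> < r}"
    by auto
  ultimately show ?thesis unfolding powertop_real_eq_top_of_set by simp
qed

lemma openin_RT_box:
  assumes "openin (powertop_real T) W" "a \<in> W"
  shows "\<exists>F r. finite F \<and> r > 0 \<and> (\<forall>x\<in>extensional T. (\<forall>t\<in>F. \<bar>x t - a t\<bar> < r) \<longrightarrow> x \<in> W)"
proof -
  obtain V where V: "open V" "W = extensional T \<inter> V"
    using assms(1) unfolding powertop_real_eq_top_of_set openin_open by blast
  then show ?thesis using open_box[of V a] assms(2) by blast
qed

context
  fixes T F :: "'v set" and W :: "('v \<Rightarrow> real) set" and f :: "('v \<Rightarrow> real) \<Rightarrow> real"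
    and c :: "('v \<Rightarrow>\<^sub>0 nat) \<Rightarrow> real" and a :: "'v \<Rightarrow> real"
  assumes F: "finite F" "F \<subseteq> T" and W: "openin (powertop_real T) W" "a \<in> W"
    and ps: "\<And>x. x \<in> W \<Longrightarrow> ((\<lambda>m. c m * (\<Prod>t\<in>F. (x t - a t) ^ lookup m t)) has_sum f x) {m. keys m \<subseteq> F}"
begin

lemma prod_zero_power: "keys m \<subseteq> F \<Longrightarrow> m \<noteq> 0 \<Longrightarrow> (\<Prod>t\<in>F. (0::real) ^ lookup m t) = 0"
proof -
  assume m: "keys m \<subseteq> F" "m \<noteq> 0"
  then obtain v where v: "v \<in> keys m" by (metis keys_eq_empty all_not_in_conv)
  then have "(0::real) ^ lookup m v = 0" by (simp add: in_keys_iff)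
  then show ?thesis using F(1) v m(1) by (intro prod_zero) auto
qed

text \<open>Absolute convergence at a corner of the polydisc of radius r' bounds the nonconstant
  terms at distance \<theta> r' by \<theta> times a convergent series, since each of them contains
  at least one factor \<theta>.\<close>

lemma power_series_continuous_at:
  assumes "e > 0"
  shows "\<exists>r>0. \<forall>x\<in>W. (\<forall>t\<in>F. \<bar>x t - a t\<bar> < r) \<longrightarrow> \<bar>f x - f a\<bar> < e"
proof -
  let ?S = "{m :: 'v \<Rightarrow>\<^sub>0 nat. keys m \<subseteq> F}"
  from openin_RT_box[OF W] obtain F' r where "finite F'" and r0: "r > 0"
      "\<forall>x\<in>extensional T. (\<forall>t\<in>F'. \<bar>x t - a t\<bar> < r) \<longrightarrow> x \<in> W"
    by (elim exE conjE)
  note r = r0(1) r0(2)[THEN bspec, THEN mp]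
  have aT: "a \<in> extensional T" by (rule subsetD[OF openin_subset[OF W(1), unfolded topspace_RT] W(2)])
  define r' where "r' = r / 2"
  have r': "r' > 0" "r' < r" using r(1) by (auto simp: r'_def)
  \<comment> \<open>The corner of the polydisc; it still lies in \<open>W\<close> because r' <
    r.\<close>
  define z where "z t = (if t \<in> F then a t + r' else a t)" for t
  have "z \<in> extensional T" using aT F(2) by (auto simp: extensional_def z_def)
  then have "z \<in> W" using r' by (intro r(2)) (auto simp: z_def)
  then have "((\<lambda>m. c m * (\<Prod>t\<in>F. (z t - a t) ^ lookup m t)) has_sum f z) ?S" by (rule ps)
  then have "(\<lambda>m. c m * (\<Prod>t\<in>F. r' ^ lookup m t)) summable_on ?S"
    by (auto simp: summable_on_def z_def)
  then have "(\<lambda>m. \<bar>c m * (\<Prod>t\<in>F. r' ^ lookup m t)\<bar>) summable_on ?S"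
    using summable_on_iff_abs_summable_on_real by fastforce
  then obtain M where M: "((\<lambda>m. \<bar>c m * (\<Prod>t\<in>F. r' ^ lookup m t)\<bar>) has_sum M) ?S"
    by (auto simp: summable_on_def)
  have M0: "M \<ge> 0" by (rule has_sum_nonneg[OF M]) simp
  define \<theta> where "\<theta> = min 1 (e / (2 * (M + 1)))"
  have \<theta>: "0 < \<theta>" "\<theta> \<le> 1" using assms M0 by (auto simp: \<theta>_def)
  have "\<theta> * M \<le> (e / (2 * (M + 1))) * M" using M0 by (intro mult_right_mono) (auto simp: \<theta>_def)
  also have "\<dots> = e * (M / (2 * (M + 1)))" by simp
  also have "\<dots> < e * 1" using assms M0 by (intro mult_strict_left_mono) (simp_all add: divide_less_eq)
  also have "\<dots> = e" by simp
  finally have \<theta>M: "\<theta> * M < e" .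
  have "\<bar>f x - f a\<bar> \<le> \<theta> * M" if x: "x \<in> W" "\<forall>t\<in>F. \<bar>x t - a t\<bar> < \<theta> * r'" for x
  proof -
    let ?d = "\<lambda>m. c m * (\<Prod>t\<in>F. (x t - a t) ^ lookup m t) - c m * (\<Prod>t\<in>F. (a t - a t) ^ lookup m t)"
    have d: "(?d has_sum (f x - f a)) ?S"
      using has_sum_add[OF ps[OF x(1)] has_sum_uminusI[OF ps[OF W(2)]]] by (simp only: add_uminus_conv_diff)
    have bnd: "\<bar>?d m\<bar> \<le> \<theta> * \<bar>c m * (\<Prod>t\<in>F. r' ^ lookup m t)\<bar>" if m: "m \<in> ?S" for m
    proof (cases "m = 0")
      case True
      then show ?thesis using \<theta>(1) by simp
    next
      case False
      obtain v where v: "v \<in> keys m" using False by (metis keys_eq_empty all_not_in_conv)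
      have vF: "v \<in> F" using v m by blast
      have "\<bar>\<Prod>t\<in>F. (x t - a t) ^ lookup m t\<bar> = (\<Prod>t\<in>F. \<bar>x t - a t\<bar> ^ lookup m t)"
        by (simp add: abs_prod power_abs)
      also have "\<dots> \<le> (\<Prod>t\<in>F. (\<theta> * r') ^ lookup m t)"
        using x(2) by (intro prod_mono conjI power_mono) (auto intro: less_imp_le)
      also have "\<dots> = (\<Prod>t\<in>F. \<theta> ^ lookup m t) * (\<Prod>t\<in>F. r' ^ lookup m t)"
        by (simp add: power_mult_distrib prod.distrib)
      also have "(\<Prod>t\<in>F. \<theta> ^ lookup m t) = \<theta> ^ lookup m v * (\<Prod>t\<in>F - {v}. \<theta> ^ lookup m t)"
        using F(1) vF by (simp add: prod.remove)
      also have "\<dots> \<le> \<theta> ^ 1 * 1"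
        using v \<theta> by (intro mult_mono prod_le_1 power_decreasing prod_nonneg) (auto simp: in_keys_iff power_le_one)
      finally have "\<bar>\<Prod>t\<in>F. (x t - a t) ^ lookup m t\<bar> \<le> \<theta> * (\<Prod>t\<in>F. r' ^ lookup m t)"
        using r'(1) by (simp add: mult_right_mono prod_nonneg)
      then have "\<bar>c m\<bar> * \<bar>\<Prod>t\<in>F. (x t - a t) ^ lookup m t\<bar> \<le> \<bar>c m\<bar> * (\<theta> * (\<Prod>t\<in>F. r' ^ lookup m t))"
        by (rule mult_left_mono) simp
      then show ?thesis
        using prod_zero_power[of m] m False r'(1) by (simp add: abs_mult abs_prod mult_ac)
    qed
    have \<theta>Ms: "((\<lambda>m. \<theta> * \<bar>c m * (\<Prod>t\<in>F. r' ^ lookup m t)\<bar>) has_sum (\<theta> * M)) ?S"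
      using M by (rule has_sum_cmult_right)
    have "f x - f a \<le> \<theta> * M"
      by (rule has_sum_mono[OF d \<theta>Ms]) (use bnd in \<open>meson abs_le_D1\<close>)
    moreover have "- (f x - f a) \<le> \<theta> * M"
      by (rule has_sum_mono[OF has_sum_uminusI[OF d] \<theta>Ms]) (use bnd in \<open>meson abs_le_D2\<close>)
    ultimately show ?thesis by simp
  qed
  then show ?thesis using \<theta>M \<theta>(1) r'(1)
    by (intro exI[of _ "\<theta> * r'"] conjI ballI impI) (auto intro: le_less_trans)
qed

text \<open>On the line through a in direction t only the pure powers of the variable t survive,
  which leaves a power series in one variable. If t is not in F, the function is constant on the
  line near a.\<close>

lemma power_series_partial:
  assumes t: "t \<in> T"
  shows "\<exists>D. ((\<lambda>s. f (a(t := s))) has_real_derivative D) (at (a t))"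
proof -
  let ?S = "{m :: 'v \<Rightarrow>\<^sub>0 nat. keys m \<subseteq> F}"
  from openin_RT_box[OF W] obtain F' r where "finite F'" and r0: "r > 0"
      "\<forall>x\<in>extensional T. (\<forall>t\<in>F'. \<bar>x t - a t\<bar> < r) \<longrightarrow> x \<in> W"
    by (elim exE conjE)
  note r = r0(1) r0(2)[THEN bspec, THEN mp]
  have aT: "a \<in> extensional T" by (rule subsetD[OF openin_subset[OF W(1), unfolded topspace_RT] W(2)])
  have inW: "a(t := a t + h) \<in> W" if "\<bar>h\<bar> < r" for h
    using that r(1) by (intro r(2) extensional_upd aT t) auto
  have near: "\<forall>\<^sub>F s in nhds (a t). \<bar>s - a t\<bar> < r"
    using r(1) by (auto simp: eventually_nhds_metric dist_real_def)
  show ?thesis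
  proof (cases "t \<in> F")
    case False
    have "f (a(t := s)) = f a" if "\<bar>s - a t\<bar> < r" for s
    proof -
      have "a(t := s) \<in> W" using inW[OF that] by simp
      then have "((\<lambda>m. c m * (\<Prod>u\<in>F. ((a(t := s)) u - a u) ^ lookup m u)) has_sum f (a(t := s))) ?S" by (rule ps)
      also have "(\<lambda>m. c m * (\<Prod>u\<in>F. ((a(t := s)) u - a u) ^ lookup m u)) = (\<lambda>m. c m * (\<Prod>u\<in>F. (a u - a u) ^ lookup m u))"
        using False by (intro ext arg_cong2[where f="(*)"] prod.cong refl) auto
      finally show ?thesis using ps[OF W(2)] has_sum_unique by blast
    qed
    then have "\<forall>\<^sub>F s in nhds (a t). f (a(t := s)) = f a" using near by (auto elim: eventually_mono)
    then have "((\<lambda>s. f (a(t := s))) has_real_derivative 0) (at (a t))"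
      by (subst DERIV_cong_ev[OF refl _ refl]) auto
    then show ?thesis by blast
  next
    case True
    define b where "b k = c (single t k)" for k
    have sums: "(\<lambda>k. b k * h ^ k) sums f (a(t := a t + h))" if "\<bar>h\<bar> < r" for h
    proof -
      let ?g = "\<lambda>m. c m * (\<Prod>u\<in>F. ((a(t := a t + h)) u - a u) ^ lookup m u)"
      have g: "(?g has_sum f (a(t := a t + h))) ?S" by (rule ps[OF inW[OF that]])
      have gs: "?g (single t k) = b k * h ^ k" for k
      proof -
        have "(\<Prod>u\<in>F. ((a(t := a t + h)) u - a u) ^ lookup (single t k) u) = (\<Prod>u\<in>F. if u = t then h ^ k else 1)"
          by (intro prod.cong refl) (auto simp: lookup_single)
        also have "\<dots> = h ^ k" using F(1) True by simp
        finally show ?thesis by (simp add: b_def)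
      qed
      have "(?g has_sum f (a(t := a t + h))) (range (single t))"
      proof (rule iffD1[OF has_sum_cong_neutral g])
        fix m assume m: "m \<in> ?S - range (single t)"
        have "\<exists>v\<in>keys m. v \<noteq> t"
        proof (rule ccontr)
          assume "\<not> ?thesis"
          then have "m = single t (lookup m t)"
            by (intro poly_mapping_eqI) (auto simp: lookup_single when_def in_keys_iff)
          then show False using m by blast
        qed
        then obtain v where v: "v \<in> keys m" "v \<noteq> t" by blast
        then have "((a(t := a t + h)) v - a v) ^ lookup m v = 0" by (simp add: in_keys_iff)
        then show "?g m = 0" using F(1) v m by (auto intro!: prod_zero)
      next
        fix m assume m: "m \<in> range (single t) - ?S"
        then obtain k where k: "m = single t k" by auto
        have "keys m \<subseteq> F" unfolding k using True by simp
        then show "?g m = 0" using m by blast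
      qed simp
      then have "((\<lambda>k. ?g (single t k)) has_sum f (a(t := a t + h))) UNIV"
        by (subst (asm) has_sum_reindex) (auto simp: inj_on_def o_def dest: arg_cong[of _ _ "\<lambda>m. lookup m t"])
      then show ?thesis unfolding gs by (rule has_sum_imp_sums)
    qed
    have "summable (\<lambda>k. b k * (r / 2) ^ k)" using sums[of "r / 2"] r(1) by (auto simp: sums_iff)
    then have "((\<lambda>h. suminf (\<lambda>k. b k * h ^ k)) has_real_derivative suminf (\<lambda>k. diffs b k * 0 ^ k)) (at 0)"
      by (rule termdiffs_strong) (use r(1) in simp)
    then obtain D where D: "((\<lambda>h. suminf (\<lambda>k. b k * h ^ k)) has_real_derivative D) (at (a t - a t))" by auto
    have "((\<lambda>s. s - a t) has_real_derivative 1) (at (a t))" by (auto intro!: derivative_eq_intros)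
    from DERIV_chain2[OF D this]
    have D': "((\<lambda>s. suminf (\<lambda>k. b k * (s - a t) ^ k)) has_real_derivative D) (at (a t))" by simp
    have "\<forall>\<^sub>F s in nhds (a t). suminf (\<lambda>k. b k * (s - a t) ^ k) = f (a(t := s))"
      using near by (rule eventually_mono) (use sums in \<open>force simp: sums_iff\<close>)
    from DERIV_cong_ev[OF refl this refl, THEN iffD1, OF D']
    have "((\<lambda>s. f (a(t := s))) has_real_derivative D) (at (a t))" .
    then show ?thesis by blast
  qed
qed

end

lemma analytic_on_RT_subset: "analytic_on_RT T U f \<Longrightarrow> U \<subseteq> extensional T"
proof
  fix a assume "analytic_on_RT T U f" "a \<in> U"
  then obtain W where "openin (powertop_real T) W" "a \<in> W" unfolding analytic_on_RT_def by blast
  then show "a \<in> extensional T" using subsetD[OF openin_subset] topspace_RT by metis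
qed

lemma analytic_imp_continuous:
  assumes "analytic_on_RT T U f"
  shows "continuous_on U f"
  unfolding continuous_on_topological
proof (intro ballI allI impI)
  fix a B assume a: "a \<in> U" and B: "open B" "f a \<in> B"
  obtain e where e: "e > 0" "ball (f a) e \<subseteq> B" using B open_contains_ball by blast
  obtain F W c where FW: "finite F" "F \<subseteq> T" "openin (powertop_real T) W" "a \<in> W" "W \<subseteq> U"
    "\<forall>x\<in>W. ((\<lambda>m. c m * (\<Prod>t\<in>F. (x t - a t) ^ lookup m t)) has_sum f x) {m. keys m \<subseteq> F}"
    using bspec[OF assms[unfolded analytic_on_RT_def] a] by (elim exE conjE)
  have "\<exists>r>0. \<forall>x\<in>W. (\<forall>t\<in>F. \<bar>x t - a t\<bar> < r) \<longrightarrow> \<bar>f x - f a\<bar> < e"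
    by (rule power_series_continuous_at[OF FW(1-4) _ e(1)]) (rule bspec[OF FW(6)])
  then obtain r where r: "r > 0" "\<forall>x\<in>W. (\<forall>t\<in>F. \<bar>x t - a t\<bar> < r) \<longrightarrow> \<bar>f x - f a\<bar> < e"
    by (elim exE conjE)
  obtain V where V: "open V" "W = extensional T \<inter> V"
    using FW(3) unfolding powertop_real_eq_top_of_set openin_open by blast
  have "openin (powertop_real T) {x \<in> extensional T. \<forall>t\<in>F. \<bar>x t - a t\<bar> < r}" by (rule openin_box[OF FW(1)])
  then obtain V' where V': "open V'" "{x \<in> extensional T. \<forall>t\<in>F. \<bar>x t - a t\<bar> < r} = extensional T \<inter> V'"
    unfolding powertop_real_eq_top_of_set openin_open by blast
  have UT: "U \<subseteq> extensional T" using analytic_on_RT_subset[OF assms] .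
  have "a \<in> {x \<in> extensional T. \<forall>t\<in>F. \<bar>x t - a t\<bar> < r}" using a UT r(1) by auto
  then have "a \<in> V'" using V'(2) by blast
  moreover have "f y \<in> B" if y: "y \<in> U" "y \<in> V \<inter> V'" for y
  proof -
    have "y \<in> W" using y UT V(2) by blast
    moreover have "y \<in> {x \<in> extensional T. \<forall>t\<in>F. \<bar>x t - a t\<bar> < r}" using y UT V'(2) by blast
    ultimately have "\<bar>f y - f a\<bar> < e" using r(2) by blast
    then show ?thesis using e(2) by (auto simp: dist_real_def abs_minus_commute subset_iff)
  qed
  ultimately show "\<exists>A. open A \<and> a \<in> A \<and> (\<forall>y\<in>U. y \<in> A \<longrightarrow> f y \<in> B)"
    using V V' FW(4) by (intro exI[of _ "V \<inter> V'"]) auto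
qed

lemma analytic_imp_partial:
  assumes "analytic_on_RT T U f" "a \<in> U" "t \<in> T"
  shows "\<exists>D. ((\<lambda>s. f (a(t := s))) has_real_derivative D) (at (a t))"
proof -
  obtain F W c where FW: "finite F" "F \<subseteq> T" "openin (powertop_real T) W" "a \<in> W"
    "\<forall>x\<in>W. ((\<lambda>m. c m * (\<Prod>t\<in>F. (x t - a t) ^ lookup m t)) has_sum f x) {m. keys m \<subseteq> F}"
    using bspec[OF assms(1)[unfolded analytic_on_RT_def] assms(2)] by (elim exE conjE)
  show ?thesis by (rule power_series_partial[OF FW(1-4) _ assms(3)]) (rule bspec[OF FW(5)])
qed

subsection \<open>Analytic roots near a given point\<close>

lemma coeff_vars_add:
  "(\<And>n. mpoly_vars (coeff p n) \<subseteq> F) \<Longrightarrow> (\<And>n. mpoly_vars (coeff q n) \<subseteq> F) \<Longrightarrow> mpoly_vars (coeff (p + q) n) \<subseteq> F"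
  unfolding coeff_add by (rule subset_trans[OF mpoly_vars_add]) simp

text \<open>\<open>analytic_root\<close> after moving (a, b) to the origin. The shift turns rational
  coefficients into real ones, which is why that theorem is stated over the reals.\<close>

theorem analytic_root_at:
  fixes q :: "('v, rat) mpoly poly" and a :: "'v \<Rightarrow> real"
  assumes F: "finite F" "\<And>n. mpoly_vars (coeff q n) \<subseteq> F"
    and q0: "poly (map_poly (reval a) q) b = 0" and q1: "poly (pderiv (map_poly (reval a) q)) b \<noteq> 0" and \<epsilon>: "\<epsilon> > 0"
  shows "\<exists>\<rho>>0. \<exists>c. \<forall>x. (\<forall>t\<in>F. \<bar>x t - a t\<bar> \<le> \<rho>) \<longrightarrow> (\<exists>s. \<bar>s - b\<bar> \<le> \<epsilon> \<and> poly (map_poly (reval x) q) s = 0 \<and>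
    ((\<lambda>m. c m * (\<Prod>t\<in>F. (x t - a t) ^ lookup m t)) has_sum s) {m. keys m \<subseteq> F})"
proof -
  define \<sigma> :: "('v, rat) mpoly \<Rightarrow> ('v, real) mpoly"
    where "\<sigma> = mpoly_eval (\<lambda>r. mconst (of_rat r)) (\<lambda>t. mvar t + mconst (a t))"
  have hc: "cring_hom (\<lambda>r::rat. mconst (of_rat r) :: ('v, real) mpoly)"
    by (rule cring_hom_comp[OF cring_hom_mconst cring_hom_of_rat])
  have \<sigma>: "cring_hom \<sigma>" unfolding \<sigma>_def by (rule mpoly_eval_hom[OF hc])
  define q' where "q' = pcompose (map_poly \<sigma> q) [:mconst b, 1:]"
  have e\<sigma>: "mpoly_eval id u (\<sigma> p) = reval (\<lambda>t. u t + a t) p" for u p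
    unfolding \<sigma>_def
    by (subst mpoly_eval_comp[OF ieval_hom])
      (simp add: cring_hom.add[OF ieval_hom] mpoly_eval_mconst[OF cring_hom_real_id] mpoly_eval_mvar[OF cring_hom_real_id])
  have eq': "map_poly (mpoly_eval id u) q' = pcompose (map_poly (reval (\<lambda>t. u t + a t)) q) [:b, 1:]" for u
  proof -
    define E where "E = (mpoly_eval id u :: ('v, real) mpoly \<Rightarrow> real)"
    have E: "cring_hom E" unfolding E_def by (rule ieval_hom)
    have Eb: "E (mconst b) = b" unfolding E_def using mpoly_eval_mconst[OF cring_hom_real_id] by simp
    have "map_poly E (pcompose p [:mconst b, 1:]) = pcompose (map_poly E p) [:b, 1:]" for p
    proof (induction p)
      case (pCons c p)
      have "map_poly E [:mconst b, 1:] = [:b, 1:]"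
        by (simp add: cring_hom.map_poly_pCons[OF E] Eb cring_hom.one[OF E])
      then show ?case using pCons
        by (simp add: pcompose_pCons cring_hom.map_poly_pCons[OF E] cring_hom.map_poly_add[OF E]
            cring_hom.map_poly_mult[OF E] del: mult_pCons_left)
    qed simp
    then have "map_poly (mpoly_eval id u) (pcompose p [:mconst b, 1:]) = pcompose (map_poly (mpoly_eval id u) p) [:b, 1:]" for p
      unfolding E_def .
    moreover have "map_poly (mpoly_eval id u) (map_poly \<sigma> q) = map_poly (reval (\<lambda>t. u t + a t)) q"
      by (rule poly_eqI) (simp add: cring_hom.coeff_map[OF ieval_hom] cring_hom.coeff_map[OF \<sigma>]
          cring_hom.coeff_map[OF reval_hom] e\<sigma>)
    ultimately show ?thesis by (simp add: q'_def)
  qed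
  have vars: "mpoly_vars (coeff q' n) \<subseteq> F" for n
  proof -
    have "mpoly_vars (coeff (pcompose p [:mconst b, 1:]) n) \<subseteq> F"
      if "\<And>n. mpoly_vars (coeff p n) \<subseteq> F" for p :: "('v, real) mpoly poly" and n
      using that
    proof (induction p arbitrary: n)
      case (pCons c p)
      have c: "mpoly_vars c \<subseteq> F" using pCons.prems[of 0] by simp
      have p: "mpoly_vars (coeff p n) \<subseteq> F" for n using pCons.prems[of "Suc n"] by simp
      have "mpoly_vars (coeff [:c:] n) \<subseteq> F" for n using c by (simp add: coeff_pCons split: nat.splits)
      moreover have "mpoly_vars (coeff [:mconst b, 1 :: ('v, real) mpoly:] n) \<subseteq> F" for n
        by (simp add: coeff_pCons split: nat.splits)
      ultimately show ?case unfolding pcompose_pCons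
        by (intro coeff_vars_add coeff_vars_mult pCons.IH p)
    qed simp
    moreover have "mpoly_vars (\<sigma> (coeff q n)) \<subseteq> F" for n
      unfolding \<sigma>_def
    proof (rule mpoly_vars_eval[OF hc])
      fix t assume "t \<in> mpoly_vars (coeff q n)"
      then show "mpoly_vars (mvar t + mconst (a t) :: ('v, real) mpoly) \<subseteq> F"
        using mpoly_vars_add[of "mvar t" "mconst (a t)"] F(2)[of n] by auto
    qed simp
    ultimately show ?thesis unfolding q'_def by (simp only: cring_hom.coeff_map[OF \<sigma>])
  qed
  have c0: "lookup (coeff q' n) 0 = coeff (pcompose (map_poly (reval a) q) [:b, 1:]) n" for n
    using arg_cong[OF eq'[of "\<lambda>_. 0"], of "\<lambda>p. coeff p n"]
    by (simp add: lookup_0_eq_eval cring_hom.coeff_map[OF ieval_hom])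
  have "lookup (coeff q' 0) 0 = poly (pcompose (map_poly (reval a) q) [:b, 1:]) 0"
    by (simp only: c0 poly_0_coeff_0)
  then have "lookup (coeff q' 0) 0 = 0" using q0 by (simp add: poly_pcompose)
  moreover have "lookup (coeff q' 1) 0 \<noteq> 0"
  proof -
    have "coeff p 1 = poly (pderiv p) 0" for p :: "real poly" by (simp add: poly_0_coeff_0 coeff_pderiv)
    then show ?thesis unfolding c0 using q1 by (simp add: pderiv_pcompose poly_pcompose pderiv_pCons)
  qed
  ultimately obtain \<rho> c where \<rho>: "\<rho> > 0" and c: "\<forall>u. (\<forall>t\<in>F. \<bar>u t\<bar> \<le> \<rho>) \<longrightarrow> (\<exists>s. \<bar>s\<bar> \<le> \<epsilon> \<and>
      poly (map_poly (mpoly_eval id u) q') s = 0 \<and>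
      ((\<lambda>m. c m * (\<Prod>t\<in>F. u t ^ lookup m t)) has_sum s) {m. keys m \<subseteq> F})"
    using analytic_root[OF F(1) vars _ _ \<epsilon>] by meson
  \<comment> \<open>Undoing the shift by b changes the constant term only.\<close>
  define c' where "c' m = c m + (if m = 0 then b else 0)" for m
  have "\<exists>s. \<bar>s - b\<bar> \<le> \<epsilon> \<and> poly (map_poly (reval x) q) s = 0 \<and>
      ((\<lambda>m. c' m * (\<Prod>t\<in>F. (x t - a t) ^ lookup m t)) has_sum s) {m. keys m \<subseteq> F}"
    if x: "\<forall>t\<in>F. \<bar>x t - a t\<bar> \<le> \<rho>" for x
  proof -
    obtain s where s: "\<bar>s\<bar> \<le> \<epsilon>" "poly (map_poly (mpoly_eval id (\<lambda>t. x t - a t)) q') s = 0"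
      "((\<lambda>m. c m * (\<Prod>t\<in>F. (x t - a t) ^ lookup m t)) has_sum s) {m. keys m \<subseteq> F}"
      using c[THEN spec, of "\<lambda>t. x t - a t"] x by blast
    have "poly (map_poly (reval x) q) (b + s) = 0"
      using s(2) unfolding eq' by (simp add: poly_pcompose)
    moreover have "((\<lambda>m. (if m = 0 then b else 0) * (\<Prod>t\<in>F. (x t - a t) ^ lookup m t)) has_sum b) {m. keys m \<subseteq> F}"
      by (rule has_sum_finite_neutralI[of "{0}"]) auto
    from has_sum_add[OF s(3) this]
    have "((\<lambda>m. c' m * (\<Prod>t\<in>F. (x t - a t) ^ lookup m t)) has_sum (b + s)) {m. keys m \<subseteq> F}"
      by (simp add: c'_def distrib_right add.commute)
    ultimately show ?thesis using s(1) by (intro exI[of _ "b + s"]) simp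
  qed
  then show ?thesis using \<rho> by blast
qed

section \<open>The field of Nash germs at the generic point\<close>

lemma map_poly_mdiff_pCons: "map_poly (mdiff t) (pCons c q) = pCons (mdiff t c) (map_poly (mdiff t) q)"
proof -
  have "mdiff t 0 = 0" using mdiff_mconst[of t 0] by (simp add: mconst_def)
  then show ?thesis by (intro poly_eqI) (simp add: coeff_map_poly coeff_pCons split: nat.splits)
qed

lemma degree_pderivs: "degree ((pderiv ^^ i) q) = degree q - i"
  for q :: "('v::linorder, rat) mpoly poly"
  by (induction i) (simp_all add: degree_pderiv)

text \<open>The chain rule for s |-> q(x(t := s), g(s)), by induction along Horner's scheme.\<close>

lemma DERIV_poly_reval:
  fixes q :: "('v::linorder, rat) mpoly poly"
  assumes "(g has_real_derivative D) (at s)"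
  shows "((\<lambda>s. poly (map_poly (reval (x(t := s))) q) (g s)) has_real_derivative
    poly (map_poly (reval (x(t := s))) (map_poly (mdiff t) q)) (g s) +
    poly (map_poly (reval (x(t := s))) (pderiv q)) (g s) * D) (at s)"
proof (induction q)
  case (pCons c q)
  show ?case
    unfolding map_poly_mdiff_pCons pderiv_pCons cring_hom.map_poly_pCons[OF reval_hom]
      cring_hom.map_poly_add[OF reval_hom] poly_pCons poly_add
    by (rule DERIV_cong[OF DERIV_add[OF reval_has_derivative DERIV_mult[OF assms pCons(2)]]])
      (simp add: reval_simps algebra_simps fun_upd_def)
qed simp

locale nash =
  fixes T :: "'k::linordered_field set"
  assumes ivt: "ivt TYPE('k)" and indep: "alg_indep T"
    and maximal: "T \<subseteq> S \<Longrightarrow> alg_indep S \<Longrightarrow> S = T"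
begin

sublocale generic_point T "\<lambda>a. a"
  using ivt indep by unfold_locales (auto simp: alg_indep_def)

definition \<Omega> :: "('k \<Rightarrow> real) set set" where
  "\<Omega> = {cell T S |S. positive S \<and> cell T S \<noteq> {} \<and> contractible (cell T S)}"

lemma refine:
  assumes "positive S"
  shows "\<exists>U\<in>\<Omega>. U \<subseteq> cell T S"
proof -
  let ?V = "\<Union>p\<in>S. mpoly_vars p"
  have "\<exists>S'. S \<subseteq> S' \<and> positive S' \<and> (\<forall>p\<in>S'. mpoly_vars p \<subseteq> ?V) \<and> cell T S' \<noteq> {} \<and> contractible (cell T S')"
    by (rule contractible_refinement) (use assms in \<open>auto simp: positive_def\<close>)
  then obtain S' where S': "S \<subseteq> S'" "positive S'" "cell T S' \<noteq> {}" "contractible (cell T S')"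
    by (elim exE conjE)
  have "cell T S' \<in> \<Omega>" unfolding \<Omega>_def mem_Collect_eq by (intro exI[of _ S'] conjI refl S')
  then show ?thesis using cell_mono[OF S'(1)] by (rule bexI[rotated])
qed

text \<open>Truth near the generic point. Positive cells are used because they are closed under
  intersection, unlike the contractible ones; by \<open>refine\<close> the members of \<Omega> give
  the same notion.\<close>

definition ev :: "(('k \<Rightarrow> real) \<Rightarrow> bool) \<Rightarrow> bool" where
  "ev P \<longleftrightarrow> (\<exists>S. positive S \<and> (\<forall>x\<in>cell T S. P x))"

lemma ev_Omega: "ev P \<longleftrightarrow> (\<exists>U\<in>\<Omega>. \<forall>x\<in>U. P x)"
proof
  assume "ev P"
  then obtain S where "positive S" "\<forall>x\<in>cell T S. P x" by (auto simp: ev_def)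
  then show "\<exists>U\<in>\<Omega>. \<forall>x\<in>U. P x" using refine[of S] by blast
next
  assume "\<exists>U\<in>\<Omega>. \<forall>x\<in>U. P x"
  then show "ev P" by (auto simp: ev_def \<Omega>_def)
qed

lemma ev_mono: "ev P \<Longrightarrow> (\<And>x. P x \<Longrightarrow> Q x) \<Longrightarrow> ev Q"
  unfolding ev_def by blast

lemma ev_conj: "ev P \<Longrightarrow> ev Q \<Longrightarrow> ev (\<lambda>x. P x \<and> Q x)"
proof -
  assume "ev P" "ev Q"
  then obtain S S' where S: "positive S" "\<forall>x\<in>cell T S. P x" "positive S'" "\<forall>x\<in>cell T S'. Q x"
    by (auto simp: ev_def)
  have "cell T (S \<union> S') \<subseteq> cell T S \<inter> cell T S'" by (auto simp: cell_def)
  then show ?thesis unfolding ev_def using positive_union[OF S(1,3)] S(2,4) by blast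
qed

lemma ev_True: "(\<And>x. P x) \<Longrightarrow> ev P"
  unfolding ev_def by (intro exI[of _ "{}"]) (simp add: positive_def)

lemma ev_Ball: "finite A \<Longrightarrow> (\<And>a. a \<in> A \<Longrightarrow> ev (P a)) \<Longrightarrow> ev (\<lambda>x. \<forall>a\<in>A. P a x)"
proof (induction A rule: finite_induct)
  case (insert a A)
  have "ev (\<lambda>x. P a x \<and> (\<forall>a\<in>A. P a x))" using insert by (intro ev_conj) auto
  then show ?case by (rule ev_mono) auto
qed (auto intro: ev_True)

lemma OmegaD:
  assumes "U \<in> \<Omega>"
  shows "U \<noteq> {}" "openin (powertop_real T) U" "contractible U" "connected U"
    "Q_semialgebraic T U" "U \<subseteq> extensional T" "ev (\<lambda>x. x \<in> U)"
proof -
  obtain S where S: "U = cell T S" "positive S" "cell T S \<noteq> {}" "contractible (cell T S)"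
    using assms by (auto simp: \<Omega>_def)
  show "U \<noteq> {}" "contractible U" using S by auto
  show "openin (powertop_real T) U" unfolding S(1) by (rule openin_cell) (use S(2) in \<open>simp add: positive_def\<close>)
  show "connected U"
    by (rule path_connected_imp_connected, rule contractible_imp_simply_path_connected) (use S in simp)
  show "Q_semialgebraic T U" unfolding S(1)
    by (rule Q_semialgebraic_cell) (use S(2) in \<open>auto simp: positive_def\<close>)
  show "U \<subseteq> extensional T" unfolding S(1) cell_def by blast
  show "ev (\<lambda>x. x \<in> U)" unfolding ev_Omega using assms by blast
qed

lemma ev_ex: "ev P \<Longrightarrow> \<exists>x\<in>extensional T. P x"
  unfolding ev_Omega using OmegaD(1,6) by blast

lemma ev_signed:
  assumes "mpoly_vars p \<subseteq> T"
  shows "ev (\<lambda>x. same_sgn (reval (\<lambda>a. a) p) (reval x p))"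
proof -
  have "positive (signed {p})" using assms by (intro positive_signed) auto
  moreover have "same_sgn (reval (\<lambda>a. a) p) (reval x p)" if "x \<in> cell T (signed {p})" for x
    by (rule signed_same_sgn[of "{p}"]) (use that assms in \<open>auto simp: cell_def\<close>)
  ultimately show ?thesis unfolding ev_def by blast
qed

lemma c_filter_Omega: "c_filter T \<Omega>"
  unfolding c_filter_def
proof (intro conjI ballI allI impI)
  fix U assume U: "U \<in> \<Omega>"
  show "U \<noteq> {}" "openin (powertop_real T) U" "Q_semialgebraic T U" by (fact OmegaD[OF U])+
  show con: "connectedin (powertop_real T) U"
    unfolding powertop_real_eq_top_of_set connectedin_subtopology using OmegaD[OF U] by simp
  show "\<exists>U\<^sub>0. \<exists>U'\<in>\<Omega>. openin (powertop_real T) U\<^sub>0 \<and> connectedin (powertop_real T) U\<^sub>0 \<and>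
        simply_connected U\<^sub>0 \<and> Q_semialgebraic T U\<^sub>0 \<and> U' \<subseteq> U\<^sub>0 \<and> U\<^sub>0 \<subseteq> U"
    using OmegaD[OF U] con contractible_imp_simply_path_connected(1)[OF OmegaD(3)[OF U]] U
    by (intro exI[of _ U] bexI[of _ U]) auto
next
  fix V assume V: "Q_algebraic T V \<and> V \<subset> topspace (powertop_real T)"
  then obtain S :: "('k, rat) mpoly set" where S: "\<forall>P\<in>S. mpoly_vars P \<subseteq> T"
    "V = {x \<in> topspace (powertop_real T). \<forall>P\<in>S. reval x P = 0}" unfolding Q_algebraic_def by blast
  obtain x where x: "x \<in> topspace (powertop_real T)" "x \<notin> V" using V by (elim conjE) (drule psubset_imp_ex_mem, blast)
  \<comment> \<open>A proper algebraic subset satisfies a nontrivial equation P = 0, and P vanishes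
    neither at the generic point nor near it.\<close>
  then obtain P where P: "P \<in> S" "reval x P \<noteq> 0" unfolding S(2) by blast
  then have "P \<noteq> 0" by (auto simp: reval_simps)
  then have "reval (\<lambda>a. a) P \<noteq> 0" using generic S(1) P(1) by blast
  then have "ev (\<lambda>x. reval x P \<noteq> 0)"
    by (intro ev_mono[OF ev_signed[OF bspec[OF S(1) P(1)]]]) (auto dest: same_sgn_zero)
  then obtain U where "U \<in> \<Omega>" "\<forall>x\<in>U. reval x P \<noteq> 0" unfolding ev_Omega by blast
  then show "\<exists>U\<in>\<Omega>. V \<inter> U = {}" using S(2) P(1) by blast
next
  fix U\<^sub>1 U\<^sub>2 assume "U\<^sub>1 \<in> \<Omega>" "U\<^sub>2 \<in> \<Omega>"
  then have "ev (\<lambda>x. x \<in> U\<^sub>1 \<and> x \<in> U\<^sub>2)" by (intro ev_conj OmegaD)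
  then show "\<exists>U\<^sub>3\<in>\<Omega>. U\<^sub>3 \<subseteq> U\<^sub>1 \<inter> U\<^sub>2" unfolding ev_Omega by blast
qed

subsection \<open>The Nash function of an element\<close>

text \<open>A polynomial of least degree among the nonzero ones over Q[T] that vanish at
  \<open>a\<close>. Its derivatives of positive order up to its degree are nonzero of smaller
  degree, so they cannot vanish at \<open>a\<close>.\<close>

lemma min_poly_ex:
  "\<exists>q. (\<forall>n. mpoly_vars (coeff q n) \<subseteq> T) \<and> degree q > 0 \<and> poly (map_poly (reval (\<lambda>a. a)) q) a = 0 \<and>
    (\<forall>i. 0 < i \<longrightarrow> i \<le> degree q \<longrightarrow> poly (map_poly (reval (\<lambda>a. a)) ((pderiv ^^ i) q)) a \<noteq> 0)"
proof -
  define good where "good q \<longleftrightarrow> (\<forall>n. mpoly_vars (coeff q n) \<subseteq> T) \<and> q \<noteq> 0 \<and>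
    poly (map_poly (reval (\<lambda>a. a)) q) a = 0" for q
  have "\<exists>q. (\<forall>n. mpoly_vars (coeff q n) \<subseteq> T) \<and> map_poly (reval (\<lambda>a. a)) q \<noteq> 0 \<and>
    poly (map_poly (reval (\<lambda>a. a)) q) a = 0"
    by (rule algebraic_over_base[OF indep maximal])
  then obtain q0 where q0: "good q0" unfolding good_def by (metis map_poly_0)
  obtain q where q: "good q" "\<And>q'. good q' \<Longrightarrow> degree q \<le> degree q'"
    using ex_has_least_nat[of good q0 degree] q0 by blast
  have vars: "mpoly_vars (coeff q n) \<subseteq> T" for n using q(1) by (simp add: good_def)
  have "degree q > 0"
  proof (rule ccontr)
    assume "\<not> degree q > 0"
    then obtain c where c: "q = [:c:]" by (auto elim: degree_eq_zeroE)
    then have "reval (\<lambda>a. a) c = 0" using q(1) by (simp add: good_def cring_hom.map_poly_pCons[OF reval_hom])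
    moreover have "mpoly_vars c \<subseteq> T" using vars[of 0] c by simp
    ultimately have "c = 0" using generic by blast
    then show False using q(1) c by (simp add: good_def)
  qed
  moreover have "poly (map_poly (reval (\<lambda>a. a)) ((pderiv ^^ i) q)) a \<noteq> 0" if i: "0 < i" "i \<le> degree q" for i
  proof
    assume 0: "poly (map_poly (reval (\<lambda>a. a)) ((pderiv ^^ i) q)) a = 0"
    have "(pderiv ^^ i) q \<noteq> 0"
    proof
      assume *: "(pderiv ^^ i) q = 0"
      obtain j where j: "i = Suc j" using i by (cases i) auto
      then have "pderiv ((pderiv ^^ j) q) = 0" using * by simp
      then have "degree ((pderiv ^^ j) q) = 0" by (simp only: pderiv_eq_0_iff)
      then show False using i j by (simp add: degree_pderivs)
    qed
    then have "good ((pderiv ^^ i) q)" using 0 pderivs_vars[OF vars] by (simp add: good_def)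
    then show False using q(2)[of "(pderiv ^^ i) q"] i by (simp add: degree_pderivs)
  qed
  ultimately show ?thesis using q(1) unfolding good_def by blast
qed

definition min_poly :: "'k \<Rightarrow> ('k, rat) mpoly poly" where
  "min_poly a = (SOME q. (\<forall>n. mpoly_vars (coeff q n) \<subseteq> T) \<and> degree q > 0 \<and> poly (map_poly (reval (\<lambda>a. a)) q) a = 0 \<and>
    (\<forall>i. 0 < i \<longrightarrow> i \<le> degree q \<longrightarrow> poly (map_poly (reval (\<lambda>a. a)) ((pderiv ^^ i) q)) a \<noteq> 0))"

lemma min_poly:
  "mpoly_vars (coeff (min_poly a) n) \<subseteq> T" "degree (min_poly a) > 0"
  "poly (map_poly (reval (\<lambda>a. a)) (min_poly a)) a = 0"
  "0 < i \<Longrightarrow> i \<le> degree (min_poly a) \<Longrightarrow> poly (map_poly (reval (\<lambda>a. a)) ((pderiv ^^ i) (min_poly a))) a \<noteq> 0"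
  using someI_ex[OF min_poly_ex[of a]] unfolding min_poly_def[symmetric] by blast+

lemma map_poly_reval_cong:
  fixes x y :: "'k \<Rightarrow> 'f::field_char_0"
  assumes "\<And>n. mpoly_vars (coeff q n) \<subseteq> V" "\<And>t. t \<in> V \<Longrightarrow> x t = y t"
  shows "map_poly (reval x) q = map_poly (reval y) q"
proof (rule poly_eqI)
  fix n
  have "reval x (coeff q n) = reval y (coeff q n)"
    by (rule mpoly_eval_cong) (use assms in blast)
  then show "coeff (map_poly (reval x) q) n = coeff (map_poly (reval y) q) n"
    by (simp add: cring_hom.coeff_map[OF reval_hom])
qed

lemma reval_poly_mvar: "reval x (poly q (mvar a)) = poly (map_poly (reval x) q) (x a)"
  using cring_hom.poly_map_poly[OF reval_hom, of x q "mvar a"] by (simp add: reval_simps)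

text \<open>By Thom's lemma, the signs of all derivatives of the minimal polynomial single out one
  of its roots.\<close>

definition root_type :: "'k \<Rightarrow> ('k \<Rightarrow> real) \<Rightarrow> real \<Rightarrow> bool" where
  "root_type a x w \<longleftrightarrow> (\<forall>i. same_sgn (poly (map_poly (reval (\<lambda>a. a)) ((pderiv ^^ i) (min_poly a))) a)
    (poly (map_poly (reval x) ((pderiv ^^ i) (min_poly a))) w))"

lemma root_typeD:
  assumes "root_type a x w"
  shows "poly (map_poly (reval x) (min_poly a)) w = 0"
    "poly (map_poly (reval x) (pderiv (min_poly a))) w \<noteq> 0"
proof -
  have s: "same_sgn (poly (map_poly (reval (\<lambda>a. a)) ((pderiv ^^ i) (min_poly a))) a)
    (poly (map_poly (reval x) ((pderiv ^^ i) (min_poly a))) w)" for i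
    using assms by (simp add: root_type_def)
  show "poly (map_poly (reval x) (min_poly a)) w = 0"
    using same_sgn_zero[OF s[of 0]] min_poly(3) by simp
  show "poly (map_poly (reval x) (pderiv (min_poly a))) w \<noteq> 0"
    using same_sgn_zero[OF s[of 1]] min_poly(4)[of 1 a] min_poly(2)[of a] by simp
qed

lemma root_type_unique:
  assumes "root_type a x w" "root_type a x w'"
  shows "w = w'"
proof (rule thom_root_unique[OF I_real])
  let ?r = "map_poly (reval x) (min_poly a)"
  show "poly ?r w = 0" using root_typeD(1)[OF assms(1)] .
  show "poly (pderiv ?r) w \<noteq> 0"
    using root_typeD(2)[OF assms(1)] by (simp add: cring_hom_pderiv[OF reval_hom])
  fix i
  have "same_sgn (poly ((pderiv ^^ i) ?r) u) (poly (map_poly (reval (\<lambda>a. a)) ((pderiv ^^ i) (min_poly a))) a)"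
    if "root_type a x u" for u
    using that unfolding root_type_def map_pderivs[of x, symmetric] by (blast intro: same_sgn_sym)
  then show "sgn (poly ((pderiv ^^ i) ?r) w) = sgn (poly ((pderiv ^^ i) ?r) w')"
    using assms same_sgn_trans1 by blast
qed

lemma root_type_cong:
  assumes "\<And>t. t \<in> T \<Longrightarrow> x t = y t"
  shows "root_type a x w \<longleftrightarrow> root_type a y w"
proof -
  have "map_poly (reval x) ((pderiv ^^ i) (min_poly a)) = map_poly (reval y) ((pderiv ^^ i) (min_poly a))" for i
    by (rule map_poly_reval_cong[OF pderivs_vars[OF min_poly(1)] assms])
  then show ?thesis by (simp add: root_type_def)
qed

lemma root_typeI:
  assumes "\<And>i. i \<le> degree (min_poly a) \<Longrightarrow>
    same_sgn (poly (map_poly (reval (\<lambda>a. a)) ((pderiv ^^ i) (min_poly a))) a)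
      (poly (map_poly (reval x) ((pderiv ^^ i) (min_poly a))) w)"
  shows "root_type a x w"
  unfolding root_type_def
proof
  fix i
  show "same_sgn (poly (map_poly (reval (\<lambda>a. a)) ((pderiv ^^ i) (min_poly a))) a)
      (poly (map_poly (reval x) ((pderiv ^^ i) (min_poly a))) w)"
    using assms[of i] pderivs_zero[of "min_poly a" i] by (cases "i \<le> degree (min_poly a)") simp_all
qed

text \<open>On T it is the coordinate itself for every x, so polynomials in T take the same values
  at \<open>val x\<close> and at x. Elsewhere it is meaningful only where a root of the right type
  exists, which is the case near the generic point.\<close>

definition val :: "('k \<Rightarrow> real) \<Rightarrow> 'k \<Rightarrow> real" where
  "val x a = (if a \<in> T then x a else THE w. root_type a x w)"

lemma val_eq: "a \<notin> T \<Longrightarrow> root_type a x w \<Longrightarrow> val x a = w"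
  unfolding val_def by (auto intro: the_equality root_type_unique)

text \<open>The elements of V are eliminated one at a time by \<open>mpoly_transfer\<close>, which
  asks for signs of polynomials in the remaining ones only; after the last of them,
  \<open>ev_signed\<close> applies.\<close>

lemma sign_extension:
  assumes "finite V" "V \<inter> T = {}" "finite P" "\<And>p. p \<in> P \<Longrightarrow> mpoly_vars p \<subseteq> T \<union> V"
  shows "ev (\<lambda>x. \<exists>y :: 'k \<Rightarrow> real. (\<forall>t\<in>T. y t = x t) \<and> (\<forall>p\<in>P. same_sgn (reval (\<lambda>a. a) p) (reval y p)))"
  using assms
proof (induction V arbitrary: P rule: finite_induct)
  case empty
  have "ev (\<lambda>x. \<forall>p\<in>P. same_sgn (reval (\<lambda>a. a) p) (reval x p))"
    by (rule ev_Ball[OF empty.prems(2)], rule ev_signed) (use empty.prems(3) in simp)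
  then show ?case by (rule ev_mono) blast
next
  case (insert a V)
  have a: "a \<notin> T \<union> V" and V: "V \<inter> T = {}" using insert by auto
  have "\<exists>Q. finite Q \<and> (\<forall>q\<in>Q. mpoly_vars q \<subseteq> T \<union> V) \<and>
    (\<forall>(x :: 'k \<Rightarrow> 'k) (y :: 'k \<Rightarrow> real). (\<forall>q\<in>Q. same_sgn (reval x q) (reval y q)) \<longrightarrow>
      (\<forall>z. \<exists>w. \<forall>p\<in>P. same_sgn (reval (x(a := z)) p) (reval (y(a := w)) p)))"
    by (rule mpoly_transfer[OF I I_real insert.prems(2) _ a]) (use insert.prems(3) in simp)
  then obtain Q where Q: "finite Q" "\<forall>q\<in>Q. mpoly_vars q \<subseteq> T \<union> V"
    and tr: "\<forall>(x :: 'k \<Rightarrow> 'k) (y :: 'k \<Rightarrow> real). (\<forall>q\<in>Q. same_sgn (reval x q) (reval y q)) \<longrightarrow>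
      (\<forall>z. \<exists>w. \<forall>p\<in>P. same_sgn (reval (x(a := z)) p) (reval (y(a := w)) p))"
    by (elim exE conjE)
  have "ev (\<lambda>x. \<exists>y :: 'k \<Rightarrow> real. (\<forall>t\<in>T. y t = x t) \<and> (\<forall>p\<in>Q. same_sgn (reval (\<lambda>a. a) p) (reval y p)))"
    by (rule insert.IH[OF V Q(1)]) (rule bspec[OF Q(2)])
  then show ?case
  proof (rule ev_mono)
    fix x :: "'k \<Rightarrow> real"
    assume "\<exists>y :: 'k \<Rightarrow> real. (\<forall>t\<in>T. y t = x t) \<and> (\<forall>p\<in>Q. same_sgn (reval (\<lambda>a. a) p) (reval y p))"
    then obtain y :: "'k \<Rightarrow> real" where y: "\<forall>t\<in>T. y t = x t" "\<forall>p\<in>Q. same_sgn (reval (\<lambda>a. a) p) (reval y p)"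
      by (elim exE conjE)
    \<comment> \<open>The variable \<open>a\<close> has the value \<open>a\<close> at the identity
      point, so the transfer of z = a leaves that point unchanged.\<close>
    obtain w where w: "\<forall>p\<in>P. same_sgn (reval ((\<lambda>a. a)(a := a)) p) (reval (y(a := w)) p)"
      using tr[THEN spec, THEN spec, THEN mp, OF y(2), THEN spec, of a] by (elim exE)
    moreover have "(\<lambda>a. a)(a := a) = (\<lambda>a. a :: 'k)" by auto
    moreover have "\<forall>t\<in>T. (y(a := w)) t = x t" using y(1) a by auto
    ultimately show "\<exists>y :: 'k \<Rightarrow> real. (\<forall>t\<in>T. y t = x t) \<and> (\<forall>p\<in>P. same_sgn (reval (\<lambda>a. a) p) (reval y p))"
      by (intro exI[of _ "y(a := w)"]) simp
  qed
qed

text \<open>The derivatives of the minimal polynomials are added to the sign conditions. A real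
  extension y that respects them takes, at each element of p outside T, a root of the type of that
  element, so uniqueness forces y to agree with \<open>val x\<close>. The algebraic and order
  properties of the embedding are instances of this.\<close>

theorem val_same_sgn: "ev (\<lambda>x. same_sgn (reval (\<lambda>a. a) p) (reval (val x) p))"
proof -
  define V where "V = mpoly_vars p - T"
  define D where "D a i = poly ((pderiv ^^ i) (min_poly a)) (mvar a)" for a i
  define P where "P = insert p (\<Union>a\<in>V. D a ` {..degree (min_poly a)})"
  have V: "finite V" "V \<inter> T = {}" by (auto simp: V_def)
  have "mpoly_vars (D a i) \<subseteq> insert a T" for a i
    unfolding D_def by (intro poly_mvar_vars pderivs_vars min_poly(1))
  then have Pv: "mpoly_vars r \<subseteq> T \<union> V" if "r \<in> P" for r
    using that unfolding P_def V_def by blast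
  have Pfin: "finite P" using V by (simp add: P_def)
  have "ev (\<lambda>x. \<exists>y :: 'k \<Rightarrow> real. (\<forall>t\<in>T. y t = x t) \<and> (\<forall>p\<in>P. same_sgn (reval (\<lambda>a. a) p) (reval y p)))"
    by (rule sign_extension[OF V Pfin Pv])
  then show ?thesis
  proof (rule ev_mono)
    fix x :: "'k \<Rightarrow> real"
    assume "\<exists>y :: 'k \<Rightarrow> real. (\<forall>t\<in>T. y t = x t) \<and> (\<forall>p\<in>P. same_sgn (reval (\<lambda>a. a) p) (reval y p))"
    then obtain y :: "'k \<Rightarrow> real" where y: "\<forall>t\<in>T. y t = x t" "\<forall>p\<in>P. same_sgn (reval (\<lambda>a. a) p) (reval y p)"
      by (elim exE conjE)
    have "val x a = y a" if a: "a \<in> mpoly_vars p" for a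
    proof (cases "a \<in> T")
      case True
      then show ?thesis using y(1) by (simp add: val_def)
    next
      case False
      then have aV: "a \<in> V" using a by (simp add: V_def)
      have "root_type a y (y a)"
      proof (rule root_typeI)
        fix i assume "i \<le> degree (min_poly a)"
        then have "D a i \<in> P" using aV by (auto simp: P_def)
        then have "same_sgn (reval (\<lambda>a. a) (D a i)) (reval y (D a i))" using y(2) by blast
        then show "same_sgn (poly (map_poly (reval (\<lambda>a. a)) ((pderiv ^^ i) (min_poly a))) a)
            (poly (map_poly (reval y) ((pderiv ^^ i) (min_poly a))) (y a))"
          by (simp only: D_def reval_poly_mvar)
      qed
      then have "root_type a x (y a)" using root_type_cong[of x y a "y a"] y(1) by simp
      then show ?thesis by (rule val_eq[OF False])
    qed
    then have "reval (val x) p = reval y p" by (rule mpoly_eval_cong)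
    then show "same_sgn (reval (\<lambda>a. a) p) (reval (val x) p)" using y(2) by (simp add: P_def)
  qed
qed

lemma val_zero: "reval (\<lambda>a. a) p = 0 \<Longrightarrow> ev (\<lambda>x. reval (val x) p = 0)"
  by (rule ev_mono[OF val_same_sgn[of p]]) (auto dest: same_sgn_zero)

lemma root_type_val: "ev (\<lambda>x. root_type a x (val x a))"
proof -
  let ?D = "\<lambda>i. poly ((pderiv ^^ i) (min_poly a)) (mvar a)"
  have "ev (\<lambda>x. \<forall>i\<in>{..degree (min_poly a)}. same_sgn (reval (\<lambda>a. a) (?D i)) (reval (val x) (?D i)))"
    by (rule ev_Ball[OF finite_atMost val_same_sgn])
  then show ?thesis
  proof (rule ev_mono)
    fix x :: "'k \<Rightarrow> real"
    assume *: "\<forall>i\<in>{..degree (min_poly a)}. same_sgn (reval (\<lambda>a. a) (?D i)) (reval (val x) (?D i))"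
    have "root_type a (val x) (val x a)"
      by (rule root_typeI) (use * in \<open>simp add: reval_poly_mvar\<close>)
    then show "root_type a x (val x a)" using root_type_cong[of x "val x" a "val x a"] by (simp add: val_def)
  qed
qed

text \<open>The elements a + b, a and b enter as separate variables, and their relation is a
  polynomial that vanishes at the identity point.\<close>

lemma val_add: "ev (\<lambda>x. val x (a + b) = val x a + val x b)"
  by (rule ev_mono[OF val_zero[of "mvar (a + b) - (mvar a + mvar b)"]]) (simp_all add: reval_simps)

lemma val_mult: "ev (\<lambda>x. val x (a * b) = val x a * val x b)"
  by (rule ev_mono[OF val_zero[of "mvar (a * b) - mvar a * mvar b"]]) (simp_all add: reval_simps)

lemma val_one: "ev (\<lambda>x. val x 1 = 1)"
  by (rule ev_mono[OF val_zero[of "mvar 1 - 1"]]) (simp_all add: reval_simps)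

lemma val_0: "ev (\<lambda>x. val x 0 = 0)"
  by (rule ev_mono[OF val_zero[of "mvar 0"]]) (simp_all add: reval_simps)

lemma val_less: "ev (\<lambda>x. a < b \<longleftrightarrow> val x a < val x b)"
  by (rule ev_mono[OF val_same_sgn[of "mvar b - mvar a"]]) (simp add: reval_simps same_sgn_def)

lemma val_eq_iff: "ev (\<lambda>x. a = b \<longleftrightarrow> val x a = val x b)"
  by (rule ev_mono[OF val_same_sgn[of "mvar b - mvar a"]]) (auto simp: reval_simps dest: same_sgn_zero)

text \<open>The implicit function theorem gives an analytic root close to \<open>val x0 a\<close>.
  The derivatives of the minimal polynomial do not vanish there and keep their signs nearby, so this
  root has the right type and coincides with \<open>val\<close>.\<close>

lemma val_analytic:
  assumes U: "openin (powertop_real T) U" and rt: "\<And>x. x \<in> U \<Longrightarrow> root_type a x (val x a)"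
  shows "analytic_on_RT T U (\<lambda>x. val x a)"
  unfolding analytic_on_RT_def
proof
  fix x0 assume x0: "x0 \<in> U"
  let ?q = "min_poly a" and ?b = "val x0 a"
  define F where "F = (\<Union>n\<le>degree ?q. mpoly_vars (coeff ?q n))"
  have F: "finite F" "F \<subseteq> T" using min_poly(1)[of a] by (auto simp: F_def)
  have Fv: "mpoly_vars (coeff ?q n) \<subseteq> F" for n
    by (cases "n \<le> degree ?q") (auto simp: F_def coeff_eq_0)
  define y0 where "y0 = case_option ?b x0"
  let ?d = "\<lambda>i. of_uni ((pderiv ^^ i) ?q)"
  \<comment> \<open>The pairs (x, w), with w stored at \<open>None\<close>, where all derivatives of
    positive order have the same signs as at (x0, b).\<close>
  define V where "V = (\<Inter>i\<in>{1..degree ?q}. {y :: 'k option \<Rightarrow> real. reval y (?d i) * reval y0 (?d i) > 0})"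
  have "open V" unfolding V_def
    by (intro open_INT ballI open_Collect_less continuous_intros continuous_on_reval) simp
  moreover have "y0 \<in> V" unfolding V_def
  proof
    fix i assume i: "i \<in> {1..degree ?q}"
    have "same_sgn (poly (map_poly (reval (\<lambda>a. a)) ((pderiv ^^ i) ?q)) a) (reval y0 (?d i))"
      using rt[OF x0] by (simp add: root_type_def y0_def reval_of_uni)
    then have "reval y0 (?d i) \<noteq> 0" using same_sgn_zero min_poly(4)[of i a] i by fastforce
    then show "y0 \<in> {y. reval y (?d i) * reval y0 (?d i) > 0}"
      by (auto simp: zero_less_mult_iff)
  qed
  ultimately have "\<exists>F r. finite F \<and> r > 0 \<and> (\<forall>y. (\<forall>t\<in>F. \<bar>y t - y0 t\<bar> < r) \<longrightarrow> y \<in> V)" by (rule open_box)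
  then obtain F1 r where "finite F1" and r: "r > 0" "\<forall>y. (\<forall>t\<in>F1. \<bar>y t - y0 t\<bar> < r) \<longrightarrow> y \<in> V"
    by (elim exE conjE)
  have "r / 2 > 0" using r(1) by simp
  have "\<exists>\<rho>>0. \<exists>c. \<forall>x. (\<forall>t\<in>F. \<bar>x t - x0 t\<bar> \<le> \<rho>) \<longrightarrow> (\<exists>s. \<bar>s - ?b\<bar> \<le> r / 2 \<and> poly (map_poly (reval x) ?q) s = 0 \<and>
    ((\<lambda>m. c m * (\<Prod>t\<in>F. (x t - x0 t) ^ lookup m t)) has_sum s) {m. keys m \<subseteq> F})"
    by (rule analytic_root_at[OF F(1) Fv _ _ \<open>r / 2 > 0\<close>])
      (use root_typeD[OF rt[OF x0]] in \<open>simp_all add: cring_hom_pderiv[OF reval_hom]\<close>)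
  then obtain \<rho> c where \<rho>: "\<rho> > 0" and c: "\<forall>x. (\<forall>t\<in>F. \<bar>x t - x0 t\<bar> \<le> \<rho>) \<longrightarrow> (\<exists>s. \<bar>s - ?b\<bar> \<le> r / 2 \<and>
    poly (map_poly (reval x) ?q) s = 0 \<and>
    ((\<lambda>m. c m * (\<Prod>t\<in>F. (x t - x0 t) ^ lookup m t)) has_sum s) {m. keys m \<subseteq> F})"
    by (elim exE conjE)
  define G where "G = F \<union> {t. Some t \<in> F1}"
  have G: "finite G" unfolding G_def using F(1) finite_vimageI[OF \<open>finite F1\<close>, of Some] by (simp add: vimage_def)
  define W where "W = {x \<in> extensional T. \<forall>t\<in>G. \<bar>x t - x0 t\<bar> < min \<rho> r} \<inter> U"
  have W: "openin (powertop_real T) W" unfolding W_def by (intro openin_Int openin_box G U)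
  have x0W: "x0 \<in> W"
  proof -
    have "x0 \<in> extensional T" using openin_subset[OF U] x0 unfolding topspace_RT by blast
    then show ?thesis using x0 \<rho> r by (simp add: W_def)
  qed
  have ps: "((\<lambda>m. c m * (\<Prod>t\<in>F. (x t - x0 t) ^ lookup m t)) has_sum val x a) {m. keys m \<subseteq> F}" if x: "x \<in> W" for x
  proof -
    have near: "\<bar>x t - x0 t\<bar> < \<rho>" "\<bar>x t - x0 t\<bar> < r" if "t \<in> G" for t using x that by (auto simp: W_def)
    have xU: "x \<in> U" using x by (simp add: W_def)
    have "\<forall>t\<in>F. \<bar>x t - x0 t\<bar> \<le> \<rho>" using near(1) by (auto simp: G_def intro: less_imp_le)
    from c[THEN spec, THEN mp, OF this] obtain s where s: "\<bar>s - ?b\<bar> \<le> r / 2" "poly (map_poly (reval x) ?q) s = 0"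
      "((\<lambda>m. c m * (\<Prod>t\<in>F. (x t - x0 t) ^ lookup m t)) has_sum s) {m. keys m \<subseteq> F}"
      by (elim exE conjE)
    have "case_option s x \<in> V"
    proof (rule r(2)[THEN spec, THEN mp], rule ballI)
      fix u assume u: "u \<in> F1"
      show "\<bar>case_option s x u - y0 u\<bar> < r"
      proof (cases u)
        case None
        then show ?thesis using s(1) r(1) by (simp add: y0_def)
      next
        case (Some t)
        then have "t \<in> G" using u by (simp add: G_def)
        then show ?thesis using near(2)[of t] Some by (simp add: y0_def)
      qed
    qed
    then have V: "reval (case_option s x) (?d i) * reval y0 (?d i) > 0" if "i \<in> {1..degree ?q}" for i
      using that unfolding V_def by blast
    have "root_type a x s"
    proof (rule root_typeI)
      fix i assume i: "i \<le> degree ?q"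
      show "same_sgn (poly (map_poly (reval (\<lambda>a. a)) ((pderiv ^^ i) ?q)) a)
        (poly (map_poly (reval x) ((pderiv ^^ i) ?q)) s)"
      proof (cases "i = 0")
        case True
        then show ?thesis using s(2) min_poly(3) by simp
      next
        case False
        have 1: "same_sgn (poly (map_poly (reval (\<lambda>a. a)) ((pderiv ^^ i) ?q)) a) (reval y0 (?d i))"
          using rt[OF x0] by (simp add: root_type_def y0_def reval_of_uni)
        have 2: "reval (case_option s x) (?d i) * reval y0 (?d i) > 0" using V i False by simp
        have "same_sgn (poly (map_poly (reval (\<lambda>a. a)) ((pderiv ^^ i) ?q)) a) (reval (case_option s x) (?d i))"
          using 1 2 unfolding same_sgn_def by (auto simp: zero_less_mult_iff)
        then show ?thesis by (simp add: reval_of_uni)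
      qed
    qed
    then have "s = val x a" using root_type_unique rt[OF xU] by blast
    then show ?thesis using s(3) by simp
  qed
  show "\<exists>F W c. finite F \<and> F \<subseteq> T \<and> openin (powertop_real T) W \<and> x0 \<in> W \<and> W \<subseteq> U \<and>
     (\<forall>x\<in>W. ((\<lambda>m. c m * (\<Prod>t\<in>F. (x t - x0 t) ^ lookup m t)) has_sum val x a) {m. keys m \<subseteq> F})"
    using F W x0W ps by (intro exI[of _ F] exI[of _ W] exI[of _ c] conjI ballI) (auto simp: W_def)
qed

end

lemma analytic_on_RT_cong:
  assumes "\<And>x. x \<in> U \<Longrightarrow> f x = g x" "analytic_on_RT T U f"
  shows "analytic_on_RT T U g"
  unfolding analytic_on_RT_def
proof
  fix a assume "a \<in> U"
  from bspec[OF assms(2)[unfolded analytic_on_RT_def] this]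
  obtain F W c where *: "finite F" "F \<subseteq> T" "openin (powertop_real T) W" "a \<in> W" "W \<subseteq> U"
    "\<forall>x\<in>W. ((\<lambda>m. c m * (\<Prod>t\<in>F. (x t - a t) ^ lookup m t)) has_sum f x) {m. keys m \<subseteq> F}"
    by (elim exE conjE)
  have "\<forall>x\<in>W. ((\<lambda>m. c m * (\<Prod>t\<in>F. (x t - a t) ^ lookup m t)) has_sum g x) {m. keys m \<subseteq> F}"
  proof
    fix x assume x: "x \<in> W"
    then have "f x = g x" using assms(1) *(5) by blast
    then show "((\<lambda>m. c m * (\<Prod>t\<in>F. (x t - a t) ^ lookup m t)) has_sum g x) {m. keys m \<subseteq> F}"
      using bspec[OF *(6) x] by simp
  qed
  with *(1-5) show "\<exists>F W. \<exists>c :: ('a \<Rightarrow>\<^sub>0 nat) \<Rightarrow> real.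
     finite F \<and> F \<subseteq> T \<and> openin (powertop_real T) W \<and> a \<in> W \<and> W \<subseteq> U \<and>
     (\<forall>x\<in>W. ((\<lambda>m. c m * (\<Prod>t\<in>F. (x t - a t) ^ lookup m t)) has_sum g x) {m. keys m \<subseteq> F})"
    by (intro exI conjI)
qed

lemma derivation_poly_reval:
  fixes \<delta> :: "'k::linordered_field \<Rightarrow> 'k"
  assumes der: "derivation \<delta>" and V: "finite V" "\<And>n. mpoly_vars (coeff q n) \<subseteq> V"
  shows "\<delta> (poly (map_poly (reval (\<lambda>a. a)) q) a) =
    (\<Sum>t\<in>V. poly (map_poly (reval (\<lambda>a. a)) (map_poly (mdiff t) q)) a * \<delta> t) +
    poly (map_poly (reval (\<lambda>a. a)) (pderiv q)) a * \<delta> a"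
  using V(2)
proof (induction q)
  case 0
  then show ?case by (simp add: derivation_0[OF der])
next
  case (pCons c q)
  have c: "mpoly_vars c \<subseteq> V" using pCons.prems[of 0] by simp
  have q: "mpoly_vars (coeff q n) \<subseteq> V" for n using pCons.prems[of "Suc n"] by simp
  have "\<delta> (reval (\<lambda>a. a) c) = (\<Sum>t\<in>V. reval (\<lambda>a. a) (mdiff t c) * \<delta> (reval (\<lambda>a. a) (mvar t)))"
    by (rule derivation_along_eval[OF c V(1)])
      (simp_all add: reval_simps derivation_of_rat[OF der] derivation_add[OF der] derivation_mult[OF der])
  then show ?case
    using pCons.IH[OF q]
    unfolding map_poly_mdiff_pCons pderiv_pCons cring_hom.map_poly_pCons[OF reval_hom]
      cring_hom.map_poly_add[OF reval_hom] poly_pCons poly_add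
      derivation_add[OF der] derivation_mult[OF der]
    by (simp add: reval_simps algebra_simps sum.distrib sum_distrib_left)
qed

context nash
begin

section \<open>Classes of Nash functions and the embedding of the field\<close>

lemma ev_extensional: "ev (\<lambda>x. x \<in> extensional T)"
  unfolding ev_def by (intro exI[of _ "{}"]) (simp add: positive_def cell_def)

lemma nash_class_iff:
  "(W, h) \<in> nash_class T \<Omega> U f \<longleftrightarrow> W \<in> \<Omega> \<and> h \<in> nash_functions T W \<and> ev (\<lambda>x. x \<in> U \<and> x \<in> W \<and> h x = f x)"
proof -
  have "(\<exists>U\<^sub>3\<in>\<Omega>. U\<^sub>3 \<subseteq> U \<inter> W \<and> (\<forall>x\<in>U\<^sub>3. h x = f x)) \<longleftrightarrow> ev (\<lambda>x. x \<in> U \<and> x \<in> W \<and> h x = f x)"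
    unfolding ev_Omega by (rule bex_cong) auto
  then show ?thesis by (simp add: nash_class_def)
qed

lemma nash_class_cong:
  assumes "ev (\<lambda>x. x \<in> U \<and> x \<in> U' \<and> f x = f' x)"
  shows "nash_class T \<Omega> U f = nash_class T \<Omega> U' f'"
proof -
  have "ev (\<lambda>x. x \<in> U \<and> x \<in> W \<and> h x = f x) \<longleftrightarrow> ev (\<lambda>x. x \<in> U' \<and> x \<in> W \<and> h x = f' x)" for W h
  proof
    assume "ev (\<lambda>x. x \<in> U \<and> x \<in> W \<and> h x = f x)"
    from ev_conj[OF this assms] show "ev (\<lambda>x. x \<in> U' \<and> x \<in> W \<and> h x = f' x)"
      by (rule ev_mono) simp
  next
    assume "ev (\<lambda>x. x \<in> U' \<and> x \<in> W \<and> h x = f' x)"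
    from ev_conj[OF this assms] show "ev (\<lambda>x. x \<in> U \<and> x \<in> W \<and> h x = f x)"
      by (rule ev_mono) simp
  qed
  then have "(W, h) \<in> nash_class T \<Omega> U f \<longleftrightarrow> (W, h) \<in> nash_class T \<Omega> U' f'" for W h
    by (simp only: nash_class_iff)
  then show ?thesis by auto
qed

text \<open>\<open>val\<close> need not be a Nash function on the whole space, but
  \<open>nash_class\<close> compares functions near the generic point only; \<open>phi_rep\<close>
  provides a genuine representative.\<close>

definition \<phi> :: "'k \<Rightarrow> 'k germ" where
  "\<phi> a = nash_class T \<Omega> (extensional T) (\<lambda>x. val x a)"

lemma nash_class_eq_phi: "ev (\<lambda>x. x \<in> U \<and> f x = val x a) \<Longrightarrow> nash_class T \<Omega> U f = \<phi> a"
  unfolding \<phi>_def by (rule nash_class_cong, rule ev_mono[OF ev_conj[OF ev_extensional]]) auto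

lemma phiD:
  assumes "(U, f) \<in> \<phi> a"
  shows "U \<in> \<Omega>" "f \<in> nash_functions T U" "ev (\<lambda>x. x \<in> U \<and> f x = val x a)"
proof -
  show "U \<in> \<Omega>" "f \<in> nash_functions T U" using assms unfolding \<phi>_def nash_class_iff by auto
  have "ev (\<lambda>x. x \<in> extensional T \<and> x \<in> U \<and> f x = val x a)" using assms unfolding \<phi>_def nash_class_iff by auto
  then show "ev (\<lambda>x. x \<in> U \<and> f x = val x a)" by (rule ev_mono) simp
qed

lemma map_min_poly_nonzero: "map_poly (reval (\<lambda>a. a)) (min_poly a) \<noteq> 0"
proof
  assume "map_poly (reval (\<lambda>a. a)) (min_poly a) = 0"
  then have "map_poly (reval (\<lambda>a. a)) ((pderiv ^^ 1) (min_poly a)) = 0"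
    by (simp add: cring_hom_pderiv[OF reval_hom])
  then show False using min_poly(4)[of 1 a] min_poly(2)[of a] by simp
qed

lemma phi_rep: "\<exists>U\<in>\<Omega>. (U, restrict (\<lambda>x. val x a) U) \<in> \<phi> a \<and> restrict (\<lambda>x. val x a) U \<in> nash_functions T U"
proof -
  obtain U where U: "U \<in> \<Omega>" "\<And>x. x \<in> U \<Longrightarrow> root_type a x (val x a)"
    using root_type_val[of a] unfolding ev_Omega by blast
  let ?f = "restrict (\<lambda>x. val x a) U"
  have "analytic_on_RT T U ?f"
    by (rule analytic_on_RT_cong[OF _ val_analytic[OF OmegaD(2)[OF U(1)] U(2)]]) simp
  moreover have "of_uni (min_poly a) \<noteq> 0"
  proof
    assume "of_uni (min_poly a) = 0"
    then have "poly (map_poly (reval (\<lambda>a. a)) (min_poly a)) z = 0" for z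
      using reval_of_uni[of z "\<lambda>a. a" "min_poly a"] by (simp add: reval_simps)
    then show False using map_min_poly_nonzero poly_all_0_iff_0 by blast
  qed
  moreover have "mpoly_vars (of_uni (min_poly a)) \<subseteq> insert None (Some ` T)"
    by (rule mpoly_vars_of_uni[OF min_poly(1)])
  moreover have "reval (case_option (?f x) x) (of_uni (min_poly a)) = 0" if "x \<in> U" for x
    using root_typeD(1)[OF U(2)[OF that]] that by (simp add: reval_of_uni)
  ultimately have f: "?f \<in> nash_functions T U" unfolding nash_functions_def by blast
  moreover have "ev (\<lambda>x. x \<in> extensional T \<and> x \<in> U \<and> ?f x = val x a)"
    using ev_conj[OF ev_extensional OmegaD(7)[OF U(1)]] by (rule ev_mono) simp
  ultimately have "(U, ?f) \<in> \<phi> a" unfolding \<phi>_def nash_class_iff using U(1) by blast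
  then show ?thesis using U(1) f by blast
qed

lemma phi_carrier: "\<phi> a \<in> carrier (nash_field T \<Omega>)"
proof -
  obtain U where U: "U \<in> \<Omega>" "(U, restrict (\<lambda>x. val x a) U) \<in> \<phi> a" "restrict (\<lambda>x. val x a) U \<in> nash_functions T U"
    using phi_rep by blast
  have "nash_class T \<Omega> U (restrict (\<lambda>x. val x a) U) = \<phi> a"
    by (rule nash_class_eq_phi[OF phiD(3)[OF U(2)]])
  then show ?thesis using U(1,3) unfolding nash_field_def by auto
qed

text \<open>The operations on germs are unions over all representatives. Here the united classes
  coincide and a representative exists, so the union is that class.\<close>

lemma UNION_phi:
  assumes "\<And>U f. (U, f) \<in> \<phi> a \<Longrightarrow> G U f = X'"
  shows "(\<Union>(U, f)\<in>\<phi> a. G U f) = X'"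
  using assms phi_rep[of a] by fastforce

lemma phi_mult: "\<phi> (a * b) = \<phi> a \<otimes>\<^bsub>nash_field T \<Omega>\<^esub> \<phi> b"
proof -
  have "nash_class T \<Omega> (U \<inter> V) (\<lambda>x. f x * g x) = \<phi> (a * b)" if "(U, f) \<in> \<phi> a" "(V, g) \<in> \<phi> b" for U f V g
    by (rule nash_class_eq_phi, rule ev_mono[OF ev_conj[OF val_mult[of a b] ev_conj[OF phiD(3)[OF that(1)] phiD(3)[OF that(2)]]]]) simp
  then show ?thesis by (simp add: nash_field_def UNION_phi)
qed

lemma phi_add: "\<phi> (a + b) = \<phi> a \<oplus>\<^bsub>nash_field T \<Omega>\<^esub> \<phi> b"
proof -
  have "nash_class T \<Omega> (U \<inter> V) (\<lambda>x. f x + g x) = \<phi> (a + b)" if "(U, f) \<in> \<phi> a" "(V, g) \<in> \<phi> b" for U f V g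
    by (rule nash_class_eq_phi, rule ev_mono[OF ev_conj[OF val_add[of a b] ev_conj[OF phiD(3)[OF that(1)] phiD(3)[OF that(2)]]]]) simp
  then show ?thesis by (simp add: nash_field_def UNION_phi)
qed

lemma phi_one: "\<phi> 1 = \<one>\<^bsub>nash_field T \<Omega>\<^esub>"
  unfolding nash_field_def ring_record_simps monoid.simps topspace_RT
  by (rule nash_class_eq_phi[symmetric], rule ev_mono[OF ev_conj[OF ev_extensional val_one]]) simp

lemma phi_zero: "\<phi> 0 = \<zero>\<^bsub>nash_field T \<Omega>\<^esub>"
  unfolding nash_field_def ring_record_simps topspace_RT
  by (rule nash_class_eq_phi[symmetric], rule ev_mono[OF ev_conj[OF ev_extensional val_0]]) simp

lemma phi_inj: "\<phi> a = \<phi> b \<Longrightarrow> a = b"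
proof -
  assume eq: "\<phi> a = \<phi> b"
  obtain U f where f: "(U, f) \<in> \<phi> a" using phi_rep by blast
  have "(U, f) \<in> \<phi> b" using f eq by simp
  from ev_conj[OF phiD(3)[OF f] phiD(3)[OF this]] have "ev (\<lambda>x. val x a = val x b)"
    by (rule ev_mono) simp
  from ev_conj[OF this val_eq_iff[of a b]] have "ev (\<lambda>x. a = b)" by (rule ev_mono) simp
  then show "a = b" using ev_ex by blast
qed

lemma phi_less: "a < b \<longleftrightarrow> nash_less \<Omega> (\<phi> a) (\<phi> b)"
proof
  assume ab: "a < b"
  obtain U f where f: "(U, f) \<in> \<phi> a" using phi_rep by blast
  obtain V g where g: "(V, g) \<in> \<phi> b" using phi_rep by blast
  from ev_conj[OF val_less[of a b] ev_conj[OF phiD(3)[OF f] phiD(3)[OF g]]]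
  have "ev (\<lambda>x. x \<in> U \<inter> V \<and> f x < g x)" by (rule ev_mono) (use ab in simp)
  then obtain W where "W \<in> \<Omega>" "\<forall>x\<in>W. x \<in> U \<inter> V \<and> f x < g x" unfolding ev_Omega by blast
  then show "nash_less \<Omega> (\<phi> a) (\<phi> b)" unfolding nash_less_def using f g by blast
next
  assume "nash_less \<Omega> (\<phi> a) (\<phi> b)"
  then obtain U f V g W where *: "(U, f) \<in> \<phi> a" "(V, g) \<in> \<phi> b" "W \<in> \<Omega>" "\<forall>x\<in>W. f x < g x"
    unfolding nash_less_def by blast
  have "ev (\<lambda>x. f x < g x)" using *(3,4) unfolding ev_Omega by blast
  from ev_conj[OF this ev_conj[OF phiD(3)[OF *(1)] ev_conj[OF phiD(3)[OF *(2)] val_less[of a b]]]]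
  have "ev (\<lambda>x. a < b)" by (rule ev_mono) simp
  then show "a < b" using ev_ex by blast
qed

subsection \<open>Every Nash germ is the germ of an element\<close>

lemma val_continuous: "\<exists>U\<in>\<Omega>. continuous_on U (\<lambda>x. val x a)"
proof -
  obtain U where U: "U \<in> \<Omega>" "\<And>x. x \<in> U \<Longrightarrow> root_type a x (val x a)"
    using root_type_val[of a] unfolding ev_Omega by blast
  then show ?thesis using analytic_imp_continuous[OF val_analytic[OF OmegaD(2)[OF U(1)] U(2)]] by blast
qed

text \<open>Transfer in the direction from the reals to \<open>K\<close>. The polynomials X - a for
  the roots \<open>a\<close> of q in \<open>K\<close> are included, so the sign zero of X - z at the
  transferred root z forces w = \<open>val x z\<close>.\<close>

lemma real_root_is_val:
  assumes vars: "\<And>n. mpoly_vars (coeff q n) \<subseteq> T" and q: "map_poly (reval (\<lambda>a. a)) q \<noteq> 0"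
  defines "R \<equiv> {a. poly (map_poly (reval (\<lambda>a. a)) q) a = 0}"
  shows "ev (\<lambda>x. \<forall>w. poly (map_poly (reval x) q) w = 0 \<longrightarrow> (\<exists>a\<in>R. w = val x a))"
proof -
  have R: "finite R" unfolding R_def by (rule poly_roots_finite[OF q])
  define P where "P = insert q ((\<lambda>a. [:- mvar a, 1:]) ` R)"
  have P: "finite P" using R by (simp add: P_def)
  from poly_transfer[OF I_real I P]
  obtain Q where Q: "finite Q" "\<forall>(h :: ('k, rat) mpoly \<Rightarrow> real) (h' :: ('k, rat) mpoly \<Rightarrow> 'k).
      cring_hom h \<and> cring_hom h' \<and> (\<forall>c\<in>Q. same_sgn (h c) (h' c)) \<longrightarrow>
      (\<forall>z. \<exists>w. \<forall>p\<in>P. same_sgn (poly (map_poly h p) z) (poly (map_poly h' p) w))"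
    by (elim exE conjE)
  have "ev (\<lambda>x. \<forall>c\<in>Q. same_sgn (reval (\<lambda>a. a) c) (reval (val x) c))"
    by (rule ev_Ball[OF Q(1) val_same_sgn])
  then show ?thesis
  proof (rule ev_mono, intro allI impI)
    fix x :: "'k \<Rightarrow> real" and w
    assume "\<forall>c\<in>Q. same_sgn (reval (\<lambda>a. a) c) (reval (val x) c)" and w: "poly (map_poly (reval x) q) w = 0"
    then have "\<forall>c\<in>Q. same_sgn (reval (val x) c) (reval (\<lambda>a. a) c)" using same_sgn_sym by blast
    then obtain z where z: "\<forall>p\<in>P. same_sgn (poly (map_poly (reval (val x)) p) w) (poly (map_poly (reval (\<lambda>a. a)) p) z)"
      using Q(2)[THEN spec, THEN spec, THEN mp, OF conjI[OF reval_hom conjI[OF reval_hom]], THEN spec, of "val x" "\<lambda>a. a" w]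
      by blast
    have "map_poly (reval (val x)) q = map_poly (reval x) q"
      by (rule map_poly_reval_cong[OF vars]) (simp add: val_def)
    moreover have "q \<in> P" by (simp add: P_def)
    ultimately have "same_sgn (poly (map_poly (reval x) q) w) (poly (map_poly (reval (\<lambda>a. a)) q) z)"
      using bspec[OF z, of q] by simp
    from same_sgn_zero[OF this] have zR: "z \<in> R" unfolding R_def using w by simp
    then have "[:- mvar z, 1:] \<in> P" by (simp add: P_def)
    then have "same_sgn (poly (map_poly (reval (val x)) [:- mvar z, 1:]) w)
        (poly (map_poly (reval (\<lambda>a. a)) [:- mvar z, 1:]) z)" using z by blast
    then have "same_sgn (w - val x z) (z - z)"
      by (simp add: cring_hom.map_poly_pCons[OF reval_hom] reval_simps)
    then have "w = val x z" using same_sgn_zero by fastforce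
    then show "\<exists>a\<in>R. w = val x a" using zR by blast
  qed
qed

text \<open>On a small W from \<Omega> the root functions are continuous and differ pairwise at
  every point. The sets where f equals one of them are closed, disjoint and finite in number, and
  they cover the connected set W, so one of them is W.\<close>

lemma nash_function_is_val:
  assumes U: "U \<in> \<Omega>" and f: "f \<in> nash_functions T U"
  shows "\<exists>a. ev (\<lambda>x. x \<in> U \<and> f x = val x a)"
proof -
  obtain P :: "('k option, rat) mpoly" where P: "P \<noteq> 0" "mpoly_vars P \<subseteq> insert None (Some ` T)"
    "\<forall>x\<in>U. reval (case_option (f x) x) P = 0" using f unfolding nash_functions_def by blast
  have fc: "continuous_on U f"
    using f analytic_imp_continuous unfolding nash_functions_def by blast
  define q where "q = to_uni P"
  have vars: "mpoly_vars (coeff q n) \<subseteq> T" for n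
    unfolding q_def by (rule mpoly_vars_coeff_to_uni[OF P(2)])
  have "q \<noteq> 0" using of_uni_to_uni[of P] P(1) cring_hom.zero[OF of_uni_hom] by (auto simp: q_def)
  have mq: "map_poly (reval (\<lambda>a. a)) q \<noteq> 0"
  proof
    assume 0: "map_poly (reval (\<lambda>a. a)) q = 0"
    have "coeff q n = 0" for n
    proof (rule generic[OF vars])
      show "reval (\<lambda>a. a) (coeff q n) = 0"
        using arg_cong[OF 0, of "\<lambda>p. coeff p n"] by (simp add: cring_hom.coeff_map[OF reval_hom])
    qed
    then show False using \<open>q \<noteq> 0\<close> by (simp add: poly_eq_iff)
  qed
  define R where "R = {a. poly (map_poly (reval (\<lambda>a. a)) q) a = 0}"
  have R: "finite R" unfolding R_def by (rule poly_roots_finite[OF mq])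
  have 1: "ev (\<lambda>x. \<forall>w. poly (map_poly (reval x) q) w = 0 \<longrightarrow> (\<exists>a\<in>R. w = val x a))"
    unfolding R_def by (rule real_root_is_val[OF vars mq])
  have "\<exists>W\<in>\<Omega>. \<forall>a. a \<in> R \<longrightarrow> continuous_on W (\<lambda>x. val x a)"
  proof -
    obtain C where C: "\<And>a. C a \<in> \<Omega>" "\<And>a. continuous_on (C a) (\<lambda>x. val x a)" using val_continuous by metis
    have "ev (\<lambda>x. \<forall>a\<in>R. x \<in> C a)" by (rule ev_Ball[OF R OmegaD(7)[OF C(1)]])
    then obtain W where W: "W \<in> \<Omega>" "\<forall>x\<in>W. \<forall>a\<in>R. x \<in> C a" unfolding ev_Omega by blast
    have "continuous_on W (\<lambda>x. val x a)" if "a \<in> R" for a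
      by (rule continuous_on_subset[OF C(2)]) (use W(2) that in blast)
    then show ?thesis using W(1) by blast
  qed
  then obtain W0 where W0: "W0 \<in> \<Omega>" "\<And>a. a \<in> R \<Longrightarrow> continuous_on W0 (\<lambda>x. val x a)" by blast
  have "ev (\<lambda>x. \<forall>a\<in>R. \<forall>b\<in>R. a = b \<longleftrightarrow> val x a = val x b)"
    by (intro ev_Ball R val_eq_iff)
  from ev_conj[OF ev_conj[OF 1 OmegaD(7)[OF U]] ev_conj[OF OmegaD(7)[OF W0(1)] this], unfolded ev_Omega]
  obtain W where "W \<in> \<Omega>" and Wall: "\<forall>x\<in>W. ((\<forall>w. poly (map_poly (reval x) q) w = 0 \<longrightarrow> (\<exists>a\<in>R. w = val x a)) \<and> x \<in> U) \<and>
      x \<in> W0 \<and> (\<forall>a\<in>R. \<forall>b\<in>R. a = b \<longleftrightarrow> val x a = val x b)"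
    by (elim bexE)
  note Wq = bspec[OF Wall, THEN conjunct1, THEN conjunct1, THEN spec, THEN mp]
  have WU: "W \<subseteq> U" by (rule subsetI) (rule bspec[OF Wall, THEN conjunct1, THEN conjunct2])
  have WW0: "W \<subseteq> W0" by (rule subsetI) (rule bspec[OF Wall, THEN conjunct2, THEN conjunct1])
  have fr: "\<exists>a\<in>R. f x = val x a" if x: "x \<in> W" for x
  proof -
    have "poly (map_poly (reval x) q) (f x) = 0"
      unfolding q_def poly_to_uni using P(3) WU x by blast
    then show ?thesis by (rule Wq[OF x])
  qed
  have sep: "a = b" if "x \<in> W" "a \<in> R" "b \<in> R" "val x a = val x b" for x a b
    using bspec[OF bspec[OF bspec[OF Wall that(1), THEN conjunct2, THEN conjunct2] that(2)] that(3)] that(4) by simp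
  define A where "A a = {x \<in> W. f x - val x a = 0}" for a
  have clA: "closedin (top_of_set W) (A a)" if "a \<in> R" for a
    unfolding A_def
    by (intro continuous_closedin_preimage_constant continuous_on_diff
        continuous_on_subset[OF fc WU] continuous_on_subset[OF W0(2)[OF that] WW0])
  obtain x0 where x0: "x0 \<in> W" using OmegaD(1)[OF \<open>W \<in> \<Omega>\<close>] by blast
  obtain a where a: "a \<in> R" "f x0 = val x0 a" using fr[OF x0] by blast
  have "A a \<inter> (\<Union>b\<in>R - {a}. A b) = {}" using sep a(1) by (auto simp: A_def)
  moreover have "A a \<union> (\<Union>b\<in>R - {a}. A b) = W" using fr by (fastforce simp: A_def)
  moreover have "closedin (top_of_set W) (\<Union>b\<in>R - {a}. A b)"
    using clA R by (intro closedin_Union) auto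
  moreover have "A a \<noteq> {}" using x0 a(2) by (auto simp: A_def)
  ultimately have "(\<Union>b\<in>R - {a}. A b) = {}"
    using OmegaD(4)[OF \<open>W \<in> \<Omega>\<close>] clA[OF a(1)] unfolding connected_closedin_eq by blast
  then have "A a = W" using \<open>A a \<union> _ = W\<close> by blast
  then have "\<forall>x\<in>W. x \<in> U \<and> f x = val x a" using WU unfolding A_def by auto
  then have "ev (\<lambda>x. x \<in> U \<and> f x = val x a)" unfolding ev_Omega using \<open>W \<in> \<Omega>\<close> by blast
  then show ?thesis by blast
qed

lemma phi_bij: "bij_betw \<phi> UNIV (carrier (nash_field T \<Omega>))"
proof (rule bij_betw_imageI)
  show "inj \<phi>" using phi_inj by (rule injI)
  show "range \<phi> = carrier (nash_field T \<Omega>)"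
  proof
    show "range \<phi> \<subseteq> carrier (nash_field T \<Omega>)" using phi_carrier by blast
    show "carrier (nash_field T \<Omega>) \<subseteq> range \<phi>"
    proof
      fix A assume "A \<in> carrier (nash_field T \<Omega>)"
      then obtain U f where U: "U \<in> \<Omega>" "f \<in> nash_functions T U" "A = nash_class T \<Omega> U f"
        unfolding nash_field_def by auto
      obtain a where "ev (\<lambda>x. x \<in> U \<and> f x = val x a)" using nash_function_is_val[OF U(1,2)] by blast
      then have "A = \<phi> a" unfolding U(3) by (rule nash_class_eq_phi)
      then show "A \<in> range \<phi>" by blast
    qed
  qed
qed

lemma phi_iso: "\<phi> \<in> ring_iso ring_of_type_algebra (nash_field T \<Omega>)"
  unfolding ring_iso_def
proof (intro CollectI conjI ring_hom_memI)
  show "bij_betw \<phi> (carrier ring_of_type_algebra) (carrier (nash_field T \<Omega>))"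
    using phi_bij by (simp add: ring_of_type_algebra_def)
qed (simp_all add: ring_of_type_algebra_def phi_carrier phi_mult phi_add phi_one)

text \<open>The ring laws are carried over from \<open>K\<close> along the bijection; only the zero
  of the image remains to be identified.\<close>

lemma nash_field_ring: "ring (nash_field T \<Omega>)"
proof -
  have "ring (ring_of_type_algebra :: 'k ring)" by (rule ring_from_type_algebra)
  from ring.ring_iso_imp_img_ring[OF this phi_iso]
  have "ring (nash_field T \<Omega> \<lparr>ring.zero := \<phi> 0\<rparr>)" by (simp add: ring_of_type_algebra_def)
  then show ?thesis by (simp add: phi_zero)
qed

lemma phi_finsum:
  assumes "finite B"
  shows "finsum (nash_field T \<Omega>) (\<lambda>t. \<phi> (c t)) B = \<phi> (\<Sum>t\<in>B. c t)"
proof -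
  interpret ring "nash_field T \<Omega>" by (rule nash_field_ring)
  show ?thesis using assms
    by (induction B) (simp_all add: phi_zero phi_add phi_carrier Pi_def)
qed

subsection \<open>Derivatives\<close>

definition num :: "'k \<Rightarrow> 'k \<Rightarrow> ('k, rat) mpoly" where
  "num t a = poly (map_poly (mdiff t) (min_poly a)) (mvar a)"

definition den :: "'k \<Rightarrow> ('k, rat) mpoly" where
  "den a = poly (pderiv (min_poly a)) (mvar a)"

text \<open>The derivative of an implicit function, computed inside \<open>K\<close> at the root
  \<open>a\<close> of its minimal polynomial.\<close>

definition partial :: "'k \<Rightarrow> 'k \<Rightarrow> 'k" where
  "partial t a = - (reval (\<lambda>a. a) (num t a) / reval (\<lambda>a. a) (den a))"

lemma den_nonzero: "reval (\<lambda>a. a) (den a) \<noteq> 0"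
  using min_poly(4)[of 1 a] min_poly(2)[of a] by (simp add: den_def reval_poly_mvar)

lemma coeff_map_mdiff: "coeff (map_poly (mdiff t) q) n = mdiff t (coeff q n)"
  using mdiff_mconst[of t 0] by (simp add: coeff_map_poly mconst_def)

text \<open>The equation q(x, f(x)) = 0 is differentiated in direction t and compared with the
  relation that \<open>val\<close> inherits from the definition of \<open>partial\<close> in
  \<open>K\<close>; q' is nonzero at a root of the right type.\<close>

lemma phi_partial:
  assumes t: "t \<in> T"
  shows "nash_partial T \<Omega> t (\<phi> a) = \<phi> (partial t a)"
  unfolding nash_partial_def
proof (rule UNION_phi, rule nash_class_eq_phi)
  fix U f assume f: "(U, f) \<in> \<phi> a"
  let ?b = "partial t a" and ?q = "min_poly a"
  have "reval (\<lambda>a. a) (mvar ?b * den a + num t a) = 0"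
    using den_nonzero[of a] by (simp add: reval_simps partial_def)
  note * = ev_conj[OF val_zero[OF this] ev_conj[OF phiD(3)[OF f] root_type_val[of a]]]
  obtain W where W: "W \<in> \<Omega>" "\<And>x. x \<in> W \<Longrightarrow> reval (val x) (mvar ?b * den a + num t a) = 0"
    "\<And>x. x \<in> W \<Longrightarrow> x \<in> U \<and> f x = val x a" "\<And>x. x \<in> W \<Longrightarrow> root_type a x (val x a)"
    using * unfolding ev_Omega by blast
  have fan: "analytic_on_RT T U f" using phiD(2)[OF f] unfolding nash_functions_def by blast
  have "deriv (\<lambda>s. f (x(t := s))) (x t) = val x ?b" if x: "x \<in> W" for x
  proof -
    have fx: "x \<in> U" "f x = val x a" using W(3)[OF x] by auto
    obtain D where D: "((\<lambda>s. f (x(t := s))) has_real_derivative D) (at (x t))"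
      using analytic_imp_partial[OF fan fx(1) t] by blast
    from openin_RT_box[OF OmegaD(2)[OF W(1)] x]
    obtain F r where r: "r > 0" "\<forall>y\<in>extensional T. (\<forall>u\<in>F. \<bar>y u - x u\<bar> < r) \<longrightarrow> y \<in> W"
      by (elim exE conjE)
    have xT: "x \<in> extensional T" using OmegaD(6)[OF W(1)] x by blast
    let ?G = "\<lambda>s. poly (map_poly (reval (x(t := s))) ?q) (f (x(t := s)))"
    have "?G s = 0" if "\<bar>s - x t\<bar> < r" for s
    proof -
      have "x(t := s) \<in> W" by (rule r(2)[rule_format, OF extensional_upd[OF xT t]]) (use that r(1) in simp)
      then show ?thesis using W(3) root_typeD(1)[OF W(4)] by metis
    qed
    moreover have "\<forall>\<^sub>F s in nhds (x t). \<bar>s - x t\<bar> < r"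
      using r(1) by (auto simp: eventually_nhds_metric dist_real_def)
    ultimately have "\<forall>\<^sub>F s in nhds (x t). ?G s = 0" by (auto elim: eventually_mono)
    then have "(?G has_real_derivative 0) (at (x t))" by (subst DERIV_cong_ev[OF refl _ refl]) auto
    from DERIV_unique[OF DERIV_poly_reval[OF D, of x t ?q] this]
    have 1: "poly (map_poly (reval x) (map_poly (mdiff t) ?q)) (val x a) +
        poly (map_poly (reval x) (pderiv ?q)) (val x a) * D = 0"
      by (simp add: fx(2))
    have "map_poly (reval (val x)) (map_poly (mdiff t) ?q) = map_poly (reval x) (map_poly (mdiff t) ?q)"
      by (rule map_poly_reval_cong[where V=T]) (simp_all add: coeff_map_mdiff mpoly_vars_mdiff[OF min_poly(1)] val_def)
    moreover have "map_poly (reval (val x)) (pderiv ?q) = map_poly (reval x) (pderiv ?q)"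
      by (rule map_poly_reval_cong[where V=T]) (use pderivs_vars[where q="min_poly a" and i=1, OF min_poly(1)] in \<open>simp_all add: val_def\<close>)
    ultimately have 2: "val x ?b * poly (map_poly (reval x) (pderiv ?q)) (val x a) +
        poly (map_poly (reval x) (map_poly (mdiff t) ?q)) (val x a) = 0"
      using W(2)[OF x] by (simp add: reval_simps num_def den_def reval_poly_mvar)
    have "poly (map_poly (reval x) (pderiv ?q)) (val x a) * D =
        poly (map_poly (reval x) (pderiv ?q)) (val x a) * val x ?b"
      using 1 2 by (metis add.commute add_left_cancel mult.commute)
    then have "D = val x ?b" using root_typeD(2)[OF W(4)[OF x]] by simp
    then show ?thesis using DERIV_imp_deriv[OF D] by simp
  qed
  then show "ev (\<lambda>x. x \<in> U \<and> deriv (\<lambda>s. f (x(t := s))) (x t) = val x ?b)"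
    unfolding ev_Omega using W(1,3) by blast
qed

text \<open>\<delta> is applied to q(a) = 0, and the result is solved for \<delta> a. Only variables
  in the coefficients of the minimal polynomial contribute, so the sum is finite.\<close>

lemma derivation_eq_sum_partial:
  assumes der: "derivation \<delta>"
  shows "finite {t \<in> T. partial t a \<noteq> 0}" "\<delta> a = (\<Sum>t\<in>{t \<in> T. partial t a \<noteq> 0}. \<delta> t * partial t a)"
proof -
  let ?q = "min_poly a"
  define V where "V = (\<Union>n\<le>degree ?q. mpoly_vars (coeff ?q n))"
  have V: "finite V" "V \<subseteq> T" using min_poly(1)[of a] by (auto simp: V_def)
  have Vc: "mpoly_vars (coeff ?q n) \<subseteq> V" for n
    by (cases "n \<le> degree ?q") (auto simp: V_def coeff_eq_0)
  have sub: "{t \<in> T. partial t a \<noteq> 0} \<subseteq> V"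
  proof
    fix t assume t: "t \<in> {t \<in> T. partial t a \<noteq> 0}"
    show "t \<in> V"
    proof (rule ccontr)
      assume "t \<notin> V"
      then have "mdiff t (coeff ?q n) = 0" for n
        by (intro mdiff_notin_vars) (use Vc[of n] in blast)
      then have "map_poly (mdiff t) ?q = 0" by (simp add: poly_eq_iff coeff_map_mdiff)
      then have "partial t a = 0" by (simp add: partial_def num_def reval_simps)
      then show False using t by simp
    qed
  qed
  then show "finite {t \<in> T. partial t a \<noteq> 0}" using V(1) finite_subset by blast
  let ?d = "reval (\<lambda>a. a) (den a)"
  have "0 = \<delta> (poly (map_poly (reval (\<lambda>a. a)) ?q) a)" by (simp add: min_poly(3) derivation_0[OF der])
  also have "\<dots> = (\<Sum>t\<in>V. reval (\<lambda>a. a) (num t a) * \<delta> t) + ?d * \<delta> a"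
    unfolding derivation_poly_reval[OF der V(1) Vc] num_def den_def reval_poly_mvar ..
  finally have "\<delta> a = - (\<Sum>t\<in>V. reval (\<lambda>a. a) (num t a) * \<delta> t) / ?d"
    using den_nonzero[of a] by (simp add: field_simps eq_neg_iff_add_eq_0)
  also have "\<dots> = (\<Sum>t\<in>V. \<delta> t * partial t a)"
    by (simp add: partial_def sum_negf sum_divide_distrib mult.commute)
  also have "\<dots> = (\<Sum>t\<in>{t \<in> T. partial t a \<noteq> 0}. \<delta> t * partial t a)"
    by (rule sum.mono_neutral_right[OF V(1) sub]) (use V(2) in auto)
  finally show "\<delta> a = (\<Sum>t\<in>{t \<in> T. partial t a \<noteq> 0}. \<delta> t * partial t a)" .
qed

text \<open>The germs of the \<delta> t serve as the family g. Injectivity of \<phi> identifies the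
  index set of \<open>nash_deriv\<close> with the t for which \<open>partial t a\<close> is
  nonzero.\<close>

lemma phi_derivation:
  assumes der: "derivation \<delta>"
  shows "\<phi> (\<delta> a) = nash_deriv T \<Omega> (\<lambda>t. \<phi> (\<delta> t)) (\<phi> a)"
proof -
  interpret ring "nash_field T \<Omega>" by (rule nash_field_ring)
  let ?B = "{t \<in> T. partial t a \<noteq> 0}"
  have "partial t a = 0 \<longleftrightarrow> \<phi> (partial t a) = \<zero>\<^bsub>nash_field T \<Omega>\<^esub>" for t
    using phi_inj phi_zero by metis
  then have B: "{t \<in> T. nash_partial T \<Omega> t (\<phi> a) \<noteq> \<zero>\<^bsub>nash_field T \<Omega>\<^esub>} = ?B"
    using phi_partial by auto
  have "nash_deriv T \<Omega> (\<lambda>t. \<phi> (\<delta> t)) (\<phi> a) = finsum (nash_field T \<Omega>) (\<lambda>t. \<phi> (\<delta> t * partial t a)) ?B"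
    unfolding nash_deriv_def B
    by (rule finsum_cong') (auto simp: phi_partial phi_mult phi_carrier Pi_def)
  also have "\<dots> = \<phi> (\<Sum>t\<in>?B. \<delta> t * partial t a)"
    by (rule phi_finsum[OF derivation_eq_sum_partial(1)[OF der]])
  also have "\<dots> = \<phi> (\<delta> a)" using derivation_eq_sum_partial(2)[OF der, of a] by simp
  finally show ?thesis ..
qed

end

theorem corollary2:
  fixes \<delta> :: "'k::linordered_field \<Rightarrow> 'k"
  assumes "ordered_diff_closed \<delta>"
  shows "\<exists>(T :: 'k set) \<Omega> g \<phi>.
    infinite T \<and> c_filter T \<Omega> \<and> (\<forall>t\<in>T. g t \<in> carrier (nash_field T \<Omega>)) \<and>
    \<phi> \<in> ring_iso (ring_of_type_algebra :: 'k ring) (nash_field T \<Omega>) \<and>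
    (\<forall>x. \<phi> (\<delta> x) = nash_deriv T \<Omega> g (\<phi> x)) \<and>
    (\<forall>x y. x < y \<longleftrightarrow> nash_less \<Omega> (\<phi> x) (\<phi> y))"
proof -
  have der: "derivation \<delta>" and rc: "real_closed TYPE('k)"
    using assms by (simp_all add: ordered_diff_closed_def)
  obtain E :: "'k set" where E: "infinite E" "alg_indep E" using infinite_alg_indep[OF assms] by blast
  \<comment> \<open>A base that contains E is infinite without any comparison of the sizes of two
    bases.\<close>
  obtain T where T: "E \<subseteq> T" "alg_indep T" "\<forall>S. T \<subseteq> S \<longrightarrow> alg_indep S \<longrightarrow> S = T"
    using alg_indep_extend[OF E(2)] by blast
  interpret nash T
    using real_closed_imp_ivt[OF rc] T(2,3) by unfold_locales blast+
  show ?thesis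
  proof (intro exI conjI allI ballI)
    show "infinite T" using E(1) T(1) finite_subset by blast
    show "c_filter T \<Omega>" by (rule c_filter_Omega)
    show "\<phi> (\<delta> t) \<in> carrier (nash_field T \<Omega>)" for t by (rule phi_carrier)
    show "\<phi> \<in> ring_iso ring_of_type_algebra (nash_field T \<Omega>)" by (rule phi_iso)
    show "\<phi> (\<delta> x) = nash_deriv T \<Omega> (\<lambda>t. \<phi> (\<delta> t)) (\<phi> x)" for x by (rule phi_derivation[OF der])
    show "x < y \<longleftrightarrow> nash_less \<Omega> (\<phi> x) (\<phi> y)" for x y by (rule phi_less)
  qed
qed

end
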